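(* Let $d\geq 1$, let $\alpha \in (1, 2)$, let $\nu_\alpha$ be a non-degenerate symmetric $\alpha$-stable L\'evy measure on $\mathbb{R}^d$ with spectral measure $\lambda_1$. Let $\mu_\alpha$ be the associated $\alpha$-stable probability measure on $\mathbb{R}^d$, let $p_\alpha$ be its positive Lebesgue density, and assume that, for all $p \in [1 , +\infty)$, $$\left\| \frac{\nabla(p_\alpha)}{p_\alpha} \right\|_{L^p(\mu_\alpha)} < +\infty.$$ Then, for all $p \in [1 , +\infty)$, all $t >0$ and all $f \in \mathcal{C}_c^{\infty}(\mathbb{R}^d)$, $$\left\| P_t^\alpha(f) - f \right\|_{L^p(\mathbb{R}^d,dx)} \leq \frac{t^{1 - \frac{1}{\alpha}}}{\alpha-1} \left\| \frac{\nabla(p_\alpha)}{p_\alpha} \right\|_{L^p(\mu_\alpha)} \left\| D^{\alpha-1}(f) \right\|_{L^p(\mathbb{R}^d,dx)}.$$ Moreover, for all $ p \in [1, \alpha)$, all $t >0$ and all $f \in \mathcal{C}_c^{\infty}(\mathbb{R}^d)$, $$\left\| P_t^\alpha(f) - f \right\|_{L^p(\mathbb{R}^d,dx)} \leq t^{\frac{1}{\alpha}} \left(\mathbb{E} |Y_\alpha|^p \right)^{\frac{1}{p}} \| \sigma_\alpha \left(\nabla(f)\right) \|_{L^p(\mathbb{R}^d,dx)},$$ where $Y_\alpha$ is a real random variable with characteristic function $\mathbb{E} \exp\left(i \xi Y_\alpha \right) = \exp \left( - |\xi|^\alpha\right)$, for all $\xi \in \mathbb{R}$.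
   Context: $\|\cdot\|$ and $\langle\cdot;\cdot\rangle$ are the Euclidean norm and inner product on $\mathbb{R}^d$, and $\mathbb{S}^{d-1}$ is the Euclidean unit sphere. A symmetric $\alpha$-stable L\'evy measure on $\mathbb{R}^d$ is a measure of the form $\nu_\alpha(B)=\int_{\mathbb{S}^{d-1}}\int_0^{+\infty} \mathbf{1}_B(ry)\,\frac{dr}{r^{\alpha+1}}\,\sigma(dy)$, where $\sigma$ (the spherical component) is a finite positive Borel measure on $\mathbb{S}^{d-1}$ with $\sigma(B)=\sigma(-B)$ for all Borel $B$. Its spectral measure is $\lambda_1 = -\cos(\alpha\pi/2)\frac{\Gamma(2-\alpha)}{\alpha(\alpha-1)}\sigma$, and $\nu_\alpha$ is non-degenerate if $\inf_{y\in\mathbb{S}^{d-1}}\int_{\mathbb{S}^{d-1}}|\langle y;x\rangle|^\alpha\lambda_1(dx)>0$. Set $\sigma_\alpha(\xi)=\left(\int_{\mathbb{S}^{d-1}}|\langle y;\xi\rangle|^\alpha\lambda_1(dy)\right)^{1/\alpha}$. The associated $\alpha$-stable probability measure $\mu_\alpha$ is characterized by $\int_{\mathbb{R}^d}e^{i\langle y;\xi\rangle}\mu_\alpha(dy)=\exp(-\sigma_\alpha(\xi)^\alpha)$; it has a positive smooth Lebesgue density $p_\alpha$. The stable heat semigroup is $P_t^\alpha(f)(x)=\int_{\mathbb{R}^d}f(x+t^{1/\alpha}y)\mu_\alpha(dy)$, and the fractional gradient is $D^{\alpha-1}(f)(x)=\int_{\mathbb{R}^d}(f(x+u)-f(x))\,u\,\nu_\alpha(du)$.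 $L^p(\mu_\alpha)$ is the Lebesgue space over $(\mathbb{R}^d,\mathcal{B}(\mathbb{R}^d),\mu_\alpha)$; $L^p$ norms of $\mathbb{R}^d$-valued functions are $L^p$ norms of their Euclidean norms. *)

theory Defs
  imports "HOL-Probability.Probability"
begin

section \<open>Lebesgue norms\<close>

text \<open>
  All norms take values in \<open>[0, \<infinity>]\<close>, so that an infinite norm is not confused with a
  Bochner integral that defaults to \<open>0\<close>.
\<close>

definition enn_powr :: "ennreal \<Rightarrow> real \<Rightarrow> ennreal" where
  "enn_powr I q = (if I = \<infinity> then \<infinity> else ennreal (enn2real I powr q))"

definition Lp_norm :: "real \<Rightarrow> 'a measure \<Rightarrow> ('a \<Rightarrow> 'b::real_normed_vector) \<Rightarrow> ennreal" where
  "Lp_norm p M f = enn_powr (\<integral>\<^sup>+x. ennreal (norm (f x) powr p) \<partial>M) (1 / p)"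

section \<open>Gradients and smooth functions\<close>

definition gradient :: "('a::euclidean_space \<Rightarrow> real) \<Rightarrow> 'a \<Rightarrow> 'a" where
  "gradient f x = (THE v. GDERIV f x :> v)"

lemma gradient_eqI:
  fixes f :: "'a::euclidean_space \<Rightarrow> real"
  assumes "GDERIV f x :> v"
  shows "gradient f x = v"
  unfolding gradient_def
proof (rule the_equality)
  show "GDERIV f x :> v" by fact
next
  fix w assume "GDERIV f x :> w"
  then have "(\<lambda>h. h \<bullet> w) = (\<lambda>h. h \<bullet> v)"
    using assms unfolding gderiv_def by (rule has_derivative_unique)
  then have "\<forall>h. h \<bullet> w = h \<bullet> v"
    by (rule fun_cong[THEN allI])
  then show "w = v"
    by (simp only: vector_eq_ldot)
qed

primrec C_k :: "nat \<Rightarrow> ('a::euclidean_space \<Rightarrow> real) \<Rightarrow> bool" where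
  "C_k 0 f \<longleftrightarrow> continuous_on UNIV f"
| "C_k (Suc k) f \<longleftrightarrow>
     (\<forall>x. f differentiable at x) \<and> (\<forall>v. C_k k (\<lambda>x. frechet_derivative f (at x) v))"

definition smooth :: "('a::euclidean_space \<Rightarrow> real) \<Rightarrow> bool" where
  "smooth f \<longleftrightarrow> (\<forall>k. C_k k f)"

definition Cc_infinity :: "('a::euclidean_space \<Rightarrow> real) set" where
  "Cc_infinity = {f. smooth f \<and> compact (closure {x. f x \<noteq> 0})}"

section \<open>Stable Levy measures and stable laws\<close>

text \<open>
  The spherical component lives on the sphere itself, with the trace Borel \<open>\<sigma>\<close>-algebra; it is
  not a measure on the ambient space.
\<close>

definition spherical_component :: "'a::euclidean_space measure \<Rightarrow> bool" where
  "spherical_component \<sigma> \<longleftrightarrow>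
     finite_measure \<sigma> \<and>
     sets \<sigma> = sets (restrict_space borel (sphere 0 1)) \<and>
     (\<forall>B\<in>sets \<sigma>. emeasure \<sigma> B = emeasure \<sigma> (uminus ` B))"

definition symmetric_stable_levy_measure ::
  "real \<Rightarrow> 'a::euclidean_space measure \<Rightarrow> 'a measure \<Rightarrow> bool" where
  "symmetric_stable_levy_measure \<alpha> \<sigma> \<nu> \<longleftrightarrow>
     spherical_component \<sigma> \<and>
     sets \<nu> = sets borel \<and>
     (\<forall>B\<in>sets borel. emeasure \<nu> B =
        (\<integral>\<^sup>+y. (\<integral>\<^sup>+r\<in>{0<..}. indicator B (r *\<^sub>R y) * ennreal (1 / r powr (\<alpha> + 1)) \<partial>lborel) \<partial>\<sigma>))"

definition spectral_measure :: "real \<Rightarrow> 'a::euclidean_space measure \<Rightarrow> 'a measure" where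
  "spectral_measure \<alpha> \<sigma> =
     scale_measure (ennreal (- cos (\<alpha> * pi / 2) * (Gamma (2 - \<alpha>) / (\<alpha> * (\<alpha> - 1))))) \<sigma>"

definition non_degenerate :: "real \<Rightarrow> 'a::euclidean_space measure \<Rightarrow> bool" where
  "non_degenerate \<alpha> lam\<^sub>1 \<longleftrightarrow>
     (INF y\<in>sphere 0 1. LINT x|lam\<^sub>1. \<bar>y \<bullet> x\<bar> powr \<alpha>) > 0"

definition stable_scale :: "real \<Rightarrow> 'a::euclidean_space measure \<Rightarrow> 'a \<Rightarrow> real" where
  "stable_scale \<alpha> lam\<^sub>1 \<xi> = (LINT y|lam\<^sub>1. \<bar>y \<bullet> \<xi>\<bar> powr \<alpha>) powr (1 / \<alpha>)"

definition stable_law ::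
  "real \<Rightarrow> 'a::euclidean_space measure \<Rightarrow> 'a measure \<Rightarrow> bool" where
  "stable_law \<alpha> lam\<^sub>1 \<mu> \<longleftrightarrow>
     prob_space \<mu> \<and> sets \<mu> = sets borel \<and>
     (\<forall>\<xi>. (CLINT y|\<mu>. iexp (y \<bullet> \<xi>)) = complex_of_real (exp (- (stable_scale \<alpha> lam\<^sub>1 \<xi> powr \<alpha>))))"

definition positive_smooth_density ::
  "'a::euclidean_space measure \<Rightarrow> ('a \<Rightarrow> real) \<Rightarrow> bool" where
  "positive_smooth_density \<mu> p \<longleftrightarrow>
     smooth p \<and> (\<forall>x. p x > 0) \<and> \<mu> = density lborel (\<lambda>x. ennreal (p x))"

definition standard_stable_variable :: "real \<Rightarrow> 'w measure \<Rightarrow> ('w \<Rightarrow> real) \<Rightarrow> bool" where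
  "standard_stable_variable \<alpha> N Y \<longleftrightarrow>
     prob_space N \<and> Y \<in> borel_measurable N \<and>
     (\<forall>\<xi>. char (distr N borel Y) \<xi> = complex_of_real (exp (- (\<bar>\<xi>\<bar> powr \<alpha>))))"

section \<open>Stable heat semigroup and fractional gradient\<close>

definition stable_semigroup ::
  "real \<Rightarrow> 'a::euclidean_space measure \<Rightarrow> real \<Rightarrow> ('a \<Rightarrow> real) \<Rightarrow> 'a \<Rightarrow> real" where
  "stable_semigroup \<alpha> \<mu> t f x = (LINT y|\<mu>. f (x + t powr (1 / \<alpha>) *\<^sub>R y))"

definition frac_gradient ::
  "'a::euclidean_space measure \<Rightarrow> ('a \<Rightarrow> real) \<Rightarrow> 'a \<Rightarrow> 'a" where
  "frac_gradient \<nu> f x = (LINT u|\<nu>. (f (x + u) - f x) *\<^sub>R u)"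

end

theory Submission
  imports Defs
begin

text \<open>
  Put \<open>R = t powr (1 / \<alpha>)\<close>. The generator of the stable semigroup is \<open>1 / \<alpha>\<close> times the divergence of
  the fractional gradient; integrating it in time, substituting \<open>s = r powr \<alpha>\<close> and integrating by parts
  against the density \<open>p\<close> of \<open>\<mu>\<close> gives
  \<open>P\<^sub>t f x - f x = - \<integral>\<^sub>0\<^sup>R r powr (\<alpha> - 2) \<integral> \<langle>D f (x + r y); \<nabla> p y\<rangle> dy dr\<close>.
  Both sides are integrals of increments of \<open>f\<close>, so by Gaussian mollification it suffices to check this on
  plane waves, where it reduces to \<open>\<integral> sin (u \<bullet> \<xi>) (u \<bullet> \<xi>) \<nu>(du) = \<alpha> \<sigma>\<^sub>\<alpha>(\<xi>) powr \<alpha>\<close>.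
  Jensen's inequality for the measure \<open>r powr (\<alpha> - 2) dr \<otimes> \<mu>\<close>, of total mass
  \<open>R powr (\<alpha> - 1) / (\<alpha> - 1)\<close>, and translation invariance then give the first bound. For the second
  bound, Jensen's inequality is applied to
  \<open>f (x + R y) - f x = \<integral>\<^sub>0\<^sup>1 \<langle>R y; \<nabla> f (x + s R y)\<rangle> ds\<close>, and \<open>y \<bullet> \<xi>\<close> has under \<open>\<mu>\<close> the law of
  \<open>\<sigma>\<^sub>\<alpha>(\<xi>) Y\<close>.
\<close>

section \<open>Jensen's inequality for extended norms\<close>

text \<open>Increments, rather than values of \<open>f\<close>, are what makes the check on waves
  possible. A plane wave is not integrable and \<open>\<nu>\<close> may have infinite mass near 0,
  but a bounded Lipschitz function has increments of size \<open>min 1 (norm u)\<close> under a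
  shift by \<open>u\<close>. The fractional gradient supplies one more factor \<open>u\<close>, and
  \<open>min 1 (norm u) * norm u\<close> is \<open>\<nu>\<close>-integrable for
  \<open>1 < \<alpha> < 2\<close>. The evolution equation only suggests the formula; the proof
  verifies it wave by wave. Fourier inversion is applied to the Gaussian alone, and \<open>f\<close>
  is reached as a limit of Gaussian convolutions, with a bounded Lipschitz constant that is uniform
  along the limit. The relation between \<open>\<nu>\<close> and
  \<open>\<sigma>\<^sub>\<alpha>\<close> rests on a sine integral whose value, \<open>- cos
  (\<alpha> * pi / 2) * Gamma (2 - \<alpha>) / (\<alpha> - 1)\<close>, is \<open>\<alpha>\<close>
  times the factor in \<open>spectral_measure\<close>. This ratio is the reason for the
  \<open>1 / \<alpha>\<close> in front of the divergence.\<close>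

lemma enn_powr_mono:
  assumes "I \<le> J" "0 \<le> q"
  shows "enn_powr I q \<le> enn_powr J q"
proof (cases "J = \<infinity>")
  case True
  then show ?thesis by (simp add: enn_powr_def)
next
  case False
  then have "I \<noteq> \<infinity>" using assms(1) by (auto simp: top_unique)
  moreover have "enn2real I \<le> enn2real J"
    using False assms(1) by (simp add: enn2real_mono top.not_eq_extremum)
  ultimately show ?thesis
    using False assms(2) by (auto simp: enn_powr_def intro!: ennreal_leI powr_mono2)
qed

text \<open>The mixed cases check that the convention \<open>0 * \<infinity> = 0\<close> survives
  taking powers, so the final bounds split into factors even when one of the norms is
  infinite.\<close>

lemma enn_powr_mult:
  assumes "0 < q"
  shows "enn_powr (I * J) q = enn_powr I q * enn_powr J q"
proof (cases I; cases J)
  fix a b :: real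
  assume "0 \<le> a" "I = ennreal a" "0 \<le> b" "J = ennreal b"
  then show ?thesis
    by (simp add: enn_powr_def powr_mult flip: ennreal_mult)
next
  fix a :: real assume *: "0 \<le> a" "I = ennreal a" "J = \<top>"
  show ?thesis
    using * assms by (cases "a = 0") (auto simp: enn_powr_def ennreal_mult_top ennreal_top_mult powr_eq_0_iff)
next
  fix a :: real assume *: "I = \<top>" "0 \<le> a" "J = ennreal a"
  show ?thesis
    using * assms by (cases "a = 0") (auto simp: enn_powr_def ennreal_mult_top ennreal_top_mult powr_eq_0_iff)
qed (simp add: enn_powr_def)

lemma enn_powr_ennreal_powr:
  assumes "0 \<le> a" "1 \<le> p"
  shows "enn_powr (ennreal (a powr p)) (1 / p) = ennreal a"
  using assms by (simp add: enn_powr_def powr_powr)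

text \<open>The concave function \<open>x powr (1 / p)\<close> lies below its tangent at
  \<open>x = c powr p\<close>; the bound is this fact at \<open>x = h powr p\<close>, with equality
  for \<open>h = c\<close>.\<close>

lemma powr_Young_le:
  fixes h c p :: real
  assumes "0 \<le> h" "0 < c" "1 \<le> p"
  shows "h \<le> (c powr (1 - p) / p) * h powr p + (1 - 1 / p) * c"
proof (cases "h = 0")
  case True
  then show ?thesis using assms by (simp add: field_simps)
next
  case False
  \<comment> \<open>Young's inequality for \<open>h powr p * c powr (1 - p)\<close> and
    \<open>c\<close> with weights \<open>1 / p\<close> and \<open>1 - 1 / p\<close>: on the left the
    powers of \<open>c\<close> cancel and \<open>h\<close> remains.\<close>
  have "(h powr p * c powr (1 - p)) powr (1 / p) * c powr (1 - 1 / p)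
      \<le> (1 / p) * (h powr p * c powr (1 - p)) + (1 - 1 / p) * c"
    using assms False by (intro Youngs_inequality_0) (auto simp: field_simps)
  also have "(h powr p * c powr (1 - p)) powr (1 / p) * c powr (1 - 1 / p)
      = h * (c powr ((1 - p) / p) * c powr (1 - 1 / p))"
    using assms False by (simp add: powr_mult powr_powr)
  also have "c powr ((1 - p) / p) * c powr (1 - 1 / p) = c powr 0"
    unfolding powr_add[symmetric] using assms by (intro arg_cong2[where f="(powr)"]) (auto simp: field_simps)
  finally show ?thesis using assms by (simp add: mult_ac)
qed

text \<open>Jensen's inequality, integrating the tangent line at \<open>c = (i / W) powr (1 / p)\<close>.\<close>

lemma powr_le_nn_integral_powr:
  fixes h :: "'w \<Rightarrow> real"
  assumes [measurable]: "h \<in> borel_measurable M" and h: "\<And>w. 0 \<le> h w"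
    and W: "emeasure M (space M) = ennreal W" "0 < W" and p: "1 \<le> p"
    and F: "0 \<le> F" "ennreal F \<le> (\<integral>\<^sup>+w. ennreal (h w) \<partial>M)"
  shows "ennreal (F powr p) \<le> ennreal (W powr (p - 1)) * (\<integral>\<^sup>+w. ennreal (h w powr p) \<partial>M)"
    (is "_ \<le> _ * ?I")
proof (cases ?I)
  case top
  then show ?thesis using W by (simp add: ennreal_mult_top)
next
  case (real i)
  show ?thesis
  proof (cases "i = 0")
    case True
    then have "AE w in M. h w = 0"
      using real nn_integral_0_iff_AE[of "\<lambda>w. ennreal (h w powr p)" M] by simp
    then have "(\<integral>\<^sup>+w. ennreal (h w) \<partial>M) = 0"
      by (subst nn_integral_0_iff_AE) (auto elim: eventually_mono)
    then have "F = 0" using F by simp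
    then show ?thesis using p by simp
  next
    case False
    then have i: "0 < i" using real by simp
    define c where "c = (i / W) powr (1 / p)"
    have c: "0 < c" using i W by (simp add: c_def)
    have cp: "c powr p = i / W" using i W p by (simp add: c_def powr_powr)
    have "(\<integral>\<^sup>+w. ennreal (h w) \<partial>M)
        \<le> (\<integral>\<^sup>+w. ennreal (c powr (1 - p) / p) * ennreal (h w powr p) + ennreal ((1 - 1 / p) * c) \<partial>M)"
    proof (rule nn_integral_mono)
      fix w
      have "ennreal (h w) \<le> ennreal (c powr (1 - p) / p * h w powr p + (1 - 1 / p) * c)"
        by (intro ennreal_leI powr_Young_le h c p)
      also have "\<dots> = ennreal (c powr (1 - p) / p * h w powr p) + ennreal ((1 - 1 / p) * c)"
        using c p by (intro ennreal_plus) auto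
      also have "ennreal (c powr (1 - p) / p * h w powr p) = ennreal (c powr (1 - p) / p) * ennreal (h w powr p)"
        using c p by (intro ennreal_mult) auto
      finally show "ennreal (h w) \<le> ennreal (c powr (1 - p) / p) * ennreal (h w powr p) + ennreal ((1 - 1 / p) * c)" .
    qed
    also have "\<dots> = ennreal (c powr (1 - p) / p) * ennreal i + ennreal ((1 - 1 / p) * c) * ennreal W"
      by (simp add: nn_integral_add nn_integral_cmult real W)
    also have "\<dots> = ennreal (c powr (1 - p) / p * i) + ennreal ((1 - 1 / p) * c * W)"
      using c p W i by (subst (1 2) ennreal_mult) auto
    also have "\<dots> = ennreal (c powr (1 - p) / p * i + (1 - 1 / p) * c * W)"
      using c p W i by (intro ennreal_plus[symmetric]) auto
    \<comment> \<open>Since \<open>i = W * c powr p\<close>, the two terms are the fractions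
      \<open>1 / p\<close> and \<open>1 - 1 / p\<close> of \<open>c * W\<close>.\<close>
    also have "c powr (1 - p) * i = c * W"
      using c p W i cp by (simp add: powr_diff field_simps)
    then have "c powr (1 - p) / p * i + (1 - 1 / p) * c * W = c * W"
      using p by (simp add: field_simps)
    finally have "ennreal F \<le> ennreal (c * W)" using F(2) by (rule order_trans[rotated])
    then have "F \<le> c * W" using c W by (simp add: ennreal_le_iff)
    then have "F powr p \<le> (c * W) powr p" using F p by (intro powr_mono2) auto
    also have "\<dots> = W powr (p - 1) * i"
      using c W cp p i by (simp add: powr_mult powr_diff)
    finally show ?thesis
      using real i by (simp add: ennreal_leI flip: ennreal_mult)
  qed
qed

text \<open>Jensen in \<open>w\<close> for each \<open>x\<close>, then Tonelli. The swap puts the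
  \<open>x\<close> integral inside, where translation invariance removes the shifts by which
  \<open>H\<close> depends on \<open>w\<close> in both applications.\<close>

lemma nn_integral_powr_mixture_le:
  fixes H :: "'x \<Rightarrow> 'w \<Rightarrow> real" and F :: "'x \<Rightarrow> real"
  assumes "sigma_finite_measure M" "sigma_finite_measure L"
    and [measurable]: "case_prod H \<in> borel_measurable (L \<Otimes>\<^sub>M M)" and H: "\<And>x w. 0 \<le> H x w"
    and W: "emeasure M (space M) = ennreal W" "0 < W" and p: "1 \<le> p"
    and F: "\<And>x. x \<in> space L \<Longrightarrow> ennreal \<bar>F x\<bar> \<le> (\<integral>\<^sup>+w. ennreal (H x w) \<partial>M)"
  shows "(\<integral>\<^sup>+x. ennreal (\<bar>F x\<bar> powr p) \<partial>L)
      \<le> ennreal (W powr (p - 1)) * (\<integral>\<^sup>+w. (\<integral>\<^sup>+x. ennreal (H x w powr p) \<partial>L) \<partial>M)"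
proof -
  interpret M: sigma_finite_measure M by fact
  interpret L: sigma_finite_measure L by fact
  interpret LM: pair_sigma_finite L M ..
  have "(\<integral>\<^sup>+x. ennreal (\<bar>F x\<bar> powr p) \<partial>L)
      \<le> (\<integral>\<^sup>+x. ennreal (W powr (p - 1)) * (\<integral>\<^sup>+w. ennreal (H x w powr p) \<partial>M) \<partial>L)"
    by (intro nn_integral_mono powr_le_nn_integral_powr H W p F) auto
  also have "\<dots> = ennreal (W powr (p - 1)) * (\<integral>\<^sup>+x. (\<integral>\<^sup>+w. ennreal (H x w powr p) \<partial>M) \<partial>L)"
    by (intro nn_integral_cmult) measurable
  also have "(\<integral>\<^sup>+x. (\<integral>\<^sup>+w. ennreal (H x w powr p) \<partial>M) \<partial>L)
      = (\<integral>\<^sup>+w. (\<integral>\<^sup>+x. ennreal (H x w powr p) \<partial>L) \<partial>M)"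
    by (rule LM.Fubini'[symmetric]) measurable
  finally show ?thesis .
qed

section \<open>Gradients and integration by parts\<close>

lemma GDERIV_gradient:
  fixes f :: "'a::euclidean_space \<Rightarrow> real"
  assumes "f differentiable at x"
  shows "GDERIV f x :> gradient f x"
    and "gradient f x = (\<Sum>b\<in>Basis. frechet_derivative f (at x) b *\<^sub>R b)"
proof -
  define D where "D = frechet_derivative f (at x)"
  define v where "v = (\<Sum>b\<in>Basis. D b *\<^sub>R b)"
  have D: "(f has_derivative D) (at x)"
    using assms unfolding D_def by (simp only: frechet_derivative_works)
  interpret D: bounded_linear D using D by (rule has_derivative_bounded_linear)
  have Dv: "D h = h \<bullet> v" for h
  proof -
    have "D h = D (\<Sum>b\<in>Basis. (h \<bullet> b) *\<^sub>R b)" by (simp add: euclidean_representation)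
    also have "\<dots> = h \<bullet> v" by (simp add: D.sum D.scaleR v_def inner_sum_right mult.commute)
    finally show ?thesis .
  qed
  then have "GDERIV f x :> v" using D by (simp add: gderiv_def flip: Dv)
  then have "gradient f x = v" by (rule gradient_eqI)
  then show "GDERIV f x :> gradient f x"
    "gradient f x = (\<Sum>b\<in>Basis. frechet_derivative f (at x) b *\<^sub>R b)"
    using \<open>GDERIV f x :> v\<close> by (simp_all only: D_def v_def)
qed

lemma smooth_gradient:
  fixes f :: "'a::euclidean_space \<Rightarrow> real"
  assumes "smooth f"
  shows "GDERIV f x :> gradient f x" and "continuous_on UNIV (gradient f)"
    and "continuous_on UNIV f"
proof -
  have C: "C_k (Suc 0) f" using assms by (simp add: smooth_def del: C_k.simps)
  then have d: "f differentiable at x" for x by simp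
  show "GDERIV f x :> gradient f x" using d by (rule GDERIV_gradient(1))
  have "gradient f = (\<lambda>x. \<Sum>b\<in>Basis. frechet_derivative f (at x) b *\<^sub>R b)"
    using GDERIV_gradient(2)[OF d] by (rule ext)
  moreover have "continuous_on UNIV (\<lambda>x. frechet_derivative f (at x) b)" for b
    using C by simp
  ultimately show "continuous_on UNIV (gradient f)"
    by (auto intro!: continuous_on_sum continuous_on_scaleR continuous_on_const)
  have "C_k 0 f" using assms by (simp only: smooth_def)
  then show "continuous_on UNIV f" by (simp only: C_k.simps)
qed

lemma GDERIV_line:
  fixes q :: "'a::euclidean_space \<Rightarrow> real"
  assumes "\<And>x. GDERIV q x :> G x"
  shows "((\<lambda>s. q (x + s *\<^sub>R v)) has_real_derivative v \<bullet> G (x + s *\<^sub>R v)) (at s)"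
proof -
  have 1: "(q has_derivative (\<lambda>h. h \<bullet> G (x + s *\<^sub>R v))) (at (x + s *\<^sub>R v))"
    using assms[of "x + s *\<^sub>R v"] unfolding gderiv_def .
  have 2: "((\<lambda>s. x + s *\<^sub>R v) has_derivative (\<lambda>h. h *\<^sub>R v)) (at s)"
    by (auto intro!: derivative_eq_intros)
  have 3: "(\<lambda>h. (h *\<^sub>R v) \<bullet> G (x + s *\<^sub>R v)) = (*) (v \<bullet> G (x + s *\<^sub>R v))"
    by (simp add: fun_eq_iff)
  show ?thesis
    using has_derivative_compose[OF 2 1] unfolding 3 has_field_derivative_def .
qed

lemma GDERIV_increment:
  fixes q :: "'a::euclidean_space \<Rightarrow> real"
  assumes "\<And>x. GDERIV q x :> G x" and "continuous_on UNIV G"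
  shows "has_bochner_integral lborel (\<lambda>s. (v \<bullet> G (x + s *\<^sub>R v)) * indicator {0..1} s) (q (x + v) - q x)"
proof -
  have "continuous_on UNIV (\<lambda>s. v \<bullet> G (x + s *\<^sub>R v))"
    by (intro continuous_intros continuous_on_compose2[OF assms(2)]) auto
  then have "isCont (\<lambda>s. v \<bullet> G (x + s *\<^sub>R v)) s" for s
    using continuous_on_eq_continuous_at[OF open_UNIV] by blast
  then have "has_bochner_integral lborel (\<lambda>s. (v \<bullet> G (x + s *\<^sub>R v)) * indicator {0..1} s)
      (q (x + 1 *\<^sub>R v) - q (x + 0 *\<^sub>R v))"
    by (intro has_bochner_integral_FTC_Icc_real GDERIV_line assms(1)) auto
  then show ?thesis by simp
qed

lemma GDERIV_lipschitz:
  fixes q :: "'a::euclidean_space \<Rightarrow> real"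
  assumes "\<And>x. GDERIV q x :> G x" and "\<And>x. norm (G x) \<le> L"
  shows "\<bar>q x - q y\<bar> \<le> L * norm (x - y)"
proof -
  have "norm (q x - q y) \<le> L * norm (x - y)"
  proof (rule differentiable_bound[where S=UNIV and f'="\<lambda>x h. h \<bullet> G x"])
    show "(q has_derivative (\<lambda>h. h \<bullet> G x)) (at x within UNIV)" for x
      using assms(1)[of x] by (simp add: gderiv_def)
    show "onorm (\<lambda>h. h \<bullet> G x) \<le> L" for x
    proof (rule onorm_le)
      fix h show "norm (h \<bullet> G x) \<le> L * norm h"
        using Cauchy_Schwarz_ineq2[of h "G x"] mult_left_mono[OF assms(2)[of x], of "norm h"]
        by (simp add: mult.commute)
    qed
  qed auto
  then show ?thesis by simp
qed

section \<open>Translation invariance and integration by parts\<close>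

lemma nn_integral_lborel_translate:
  fixes g :: "'a::euclidean_space \<Rightarrow> ennreal"
  assumes [measurable]: "g \<in> borel_measurable borel"
  shows "(\<integral>\<^sup>+x. g (x + c) \<partial>lborel) = (\<integral>\<^sup>+x. g x \<partial>lborel)"
  by (subst (2) lborel_distr_plus[of c, symmetric]) (simp add: nn_integral_distr add.commute)

lemma lborel_integrable_translate:
  fixes g :: "'a::euclidean_space \<Rightarrow> 'b::{banach, second_countable_topology}"
  assumes "integrable lborel g"
  shows "integrable lborel (\<lambda>x. g (x + c))"
proof -
  have "integrable (distr lborel borel ((+) c)) g"
    using assms by (simp only: lborel_distr_plus)
  moreover have "g \<in> borel_measurable borel" using assms by simp
  ultimately show ?thesis by (simp add: integrable_distr_eq add.commute)
qed

lemma lborel_integral_translate: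
  fixes g :: "'a::euclidean_space \<Rightarrow> 'b::{banach, second_countable_topology}"
  assumes "g \<in> borel_measurable borel"
  shows "(LINT x|lborel. g (x + c)) = (LINT x|lborel. g x)"
  using assms by (subst (2) lborel_distr_plus[of c, symmetric]) (simp add: integral_distr add.commute)

text \<open>Translation by \<open>v\<close> preserves the integral of \<open>q\<close>, and the increment of \<open>q\<close> along \<open>v\<close> is
  the average of the directional derivative over the segment.\<close>

lemma integral_directional_derivative_eq_0:
  fixes q :: "'a::euclidean_space \<Rightarrow> real"
  assumes q: "\<And>x. GDERIV q x :> G x" and G: "continuous_on UNIV G"
    and int: "integrable lborel q" "integrable lborel (\<lambda>x. v \<bullet> G x)"
  shows "(LINT x|lborel. v \<bullet> G x) = 0"
proof -
  have [measurable]: "G \<in> borel_measurable borel" by (rule borel_measurable_continuous_onI[OF G])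
  have m [measurable]: "q \<in> borel_measurable borel" using int(1) by simp
  \<comment> \<open>Up to the indicator of \<open>{0..1}\<close>, the integral of \<open>H s\<close>
    over \<open>x\<close>, with or without the norm, does not depend on \<open>s\<close>, by
    translation. This supplies both the integrability on the product and the value after the
    swap.\<close>
  define H where "H s x = (v \<bullet> G (x + s *\<^sub>R v)) * indicator {0..1} s" for s x
  have H [measurable]: "case_prod H \<in> borel_measurable (lborel \<Otimes>\<^sub>M lborel)"
    unfolding H_def by measurable
  have Hs: "integrable lborel (H s)" "(LINT x|lborel. H s x) = indicator {0..1} s * (LINT x|lborel. v \<bullet> G x)"
    "(LINT x|lborel. norm (H s x)) = indicator {0..1} s * (LINT x|lborel. norm (v \<bullet> G x))" for s
    unfolding H_def
    using lborel_integrable_translate[OF int(2), of "s *\<^sub>R v"]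
      lborel_integral_translate[of "\<lambda>x. v \<bullet> G x" "s *\<^sub>R v"]
      lborel_integral_translate[of "\<lambda>x. norm (v \<bullet> G x)" "s *\<^sub>R v"]
    by (auto simp: abs_mult)
  have I: "integrable (lborel \<Otimes>\<^sub>M lborel) (case_prod H)"
  proof (rule lborel_pair.Fubini_integrable)
    show "integrable lborel (\<lambda>s. LINT x|lborel. norm (case (s, x) of (s, x) \<Rightarrow> H s x))"
      by (simp add: Hs(3)[simplified])
  qed (use Hs in auto)
  have "0 = (LINT x|lborel. q (x + v)) - (LINT x|lborel. q x)"
    by (simp add: lborel_integral_translate)
  also have "\<dots> = (LINT x|lborel. q (x + v) - q x)"
    by (simp add: int lborel_integrable_translate)
  also have "\<dots> = (LINT x|lborel. (LINT s|lborel. H s x))"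
    by (simp add: H_def has_bochner_integral_integral_eq[OF GDERIV_increment[OF q G, of v]])
  also have "\<dots> = (LINT s|lborel. (LINT x|lborel. H s x))"
    using I by (rule lborel_pair.Fubini_integral)
  also have "\<dots> = (LINT x|lborel. v \<bullet> G x)"
    by (simp add: Hs)
  finally show ?thesis by simp
qed

lemma Cc_infinityD:
  fixes f :: "'a::euclidean_space \<Rightarrow> real"
  assumes "f \<in> Cc_infinity"
  shows Cc_infinity_smooth: "smooth f"
    and Cc_infinity_bounded: "\<exists>K. \<forall>x. \<bar>f x\<bar> \<le> K"
    and Cc_infinity_lipschitz: "\<exists>L. \<forall>x y. \<bar>f x - f y\<bar> \<le> L * norm (x - y)"
    and Cc_infinity_integrable: "integrable lborel f"
proof -
  define S where "S = closure {x. f x \<noteq> 0}"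
  show sm: "smooth f" using assms by (simp add: Cc_infinity_def)
  have S: "compact S" using assms by (simp add: Cc_infinity_def S_def)
  note g = smooth_gradient[OF sm]
  have f0: "f x = 0" if "x \<notin> S" for x
    using that closure_subset[of "{x. f x \<noteq> 0}"] by (auto simp: S_def)
  have g0: "gradient f x = 0" if "x \<notin> S" for x
  proof (rule gradient_eqI)
    have "open (- S)" using S by (simp add: compact_imp_closed open_Compl)
    then have "(f has_derivative (\<lambda>h. h \<bullet> 0)) (at x)"
      using that f0 by (rule_tac has_derivative_transform_within_open[of "\<lambda>_. 0" _ x UNIV "- S"]) auto
    then show "GDERIV f x :> 0" by (simp add: gderiv_def)
  qed
  have bdd: "\<exists>K. \<forall>x. norm (h x) \<le> K" if "continuous_on UNIV h" "\<And>x. x \<notin> S \<Longrightarrow> h x = 0"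
    for h :: "'a \<Rightarrow> 'b::real_normed_vector"
  proof -
    have "compact (h ` S)" using S that by (intro compact_continuous_image continuous_on_subset[OF that(1)]) auto
    then obtain K where K: "\<forall>y\<in>h ` S. norm y \<le> K" using compact_imp_bounded bounded_iff by metis
    have "norm (h x) \<le> max K 0" for x using K that(2)[of x] by (cases "x \<in> S") (auto simp: le_max_iff_disj)
    then show ?thesis by blast
  qed
  show K: "\<exists>K. \<forall>x. \<bar>f x\<bar> \<le> K" using bdd[OF g(3) f0] by simp
  obtain L where "\<forall>x. norm (gradient f x) \<le> L" using bdd[OF g(2) g0] by blast
  then show "\<exists>L. \<forall>x y. \<bar>f x - f y\<bar> \<le> L * norm (x - y)"
    using GDERIV_lipschitz[OF g(1)] by blast
  have "integrable lborel (\<lambda>x. indicator S x *\<^sub>R f x)"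
    using S g(3) by (intro borel_integrable_compact continuous_on_subset[OF g(3)]) auto
  also have "(\<lambda>x. indicator S x *\<^sub>R f x) = f" using f0 by (auto simp: fun_eq_iff indicator_def)
  finally show "integrable lborel f" .
qed

section \<open>The integral of \<open>sin r / r powr \<alpha>\<close>\<close>

lemma nn_integral_Gamma_scaled:
  fixes s c :: real
  assumes "0 < s" "0 < c"
  shows "(\<integral>\<^sup>+v. ennreal (indicator {0<..} v * (v powr (s - 1) * exp (- (c * v)))) \<partial>lborel)
       = ennreal (Gamma s * c powr (- s))"
proof -
  let ?g = "\<lambda>t. ennreal (indicator {0..} t * t powr (s - 1) / exp t)"
  have "ennreal (Gamma s) = (\<integral>\<^sup>+t. ?g t \<partial>lborel)"
    using Gamma_conv_nn_integral_real[OF assms(1)] .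
  also have "\<dots> = ennreal c * (\<integral>\<^sup>+v. ?g (0 + c * v) \<partial>lborel)"
    using assms by (subst nn_integral_real_affine[where c=c and t=0]) auto
  also have "(\<integral>\<^sup>+v. ?g (0 + c * v) \<partial>lborel)
      = (\<integral>\<^sup>+v. ennreal (c powr (s - 1)) * ennreal (indicator {0<..} v * (v powr (s - 1) * exp (- (c * v)))) \<partial>lborel)"
    using assms by (intro nn_integral_cong) (auto simp: indicator_def powr_mult exp_minus divide_simps zero_le_mult_iff simp flip: ennreal_mult)
  also have "\<dots> = ennreal (c powr (s - 1)) * (\<integral>\<^sup>+v. ennreal (indicator {0<..} v * (v powr (s - 1) * exp (- (c * v)))) \<partial>lborel)"
    by (rule nn_integral_cmult) measurable
  finally have *: "ennreal (Gamma s) = ennreal (c powr s) * (\<integral>\<^sup>+v. ennreal (indicator {0<..} v * (v powr (s - 1) * exp (- (c * v)))) \<partial>lborel)"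
    (is "_ = _ * ?I")
    using assms by (simp add: mult.assoc[symmetric] powr_diff flip: ennreal_mult)
  have "ennreal (Gamma s * c powr (- s)) = ennreal (c powr (- s)) * (ennreal (c powr s) * ?I)"
    using assms by (subst *[symmetric]) (simp add: ennreal_mult'' mult.commute)
  also have "\<dots> = ?I"
    using assms by (simp add: mult.assoc[symmetric] powr_add[symmetric] flip: ennreal_mult)
  finally show ?thesis by simp
qed

text \<open>The Beta integral at \<open>(s, 1 - s)\<close>: with \<open>1 / (1 + u)\<close> written
  as the integral of \<open>exp (- ((1 + u) * w))\<close> over \<open>w > 0\<close>, Tonelli factors
  it into \<open>Gamma s * Gamma (1 - s)\<close>, which Euler's reflection formula
  evaluates.\<close>

lemma nn_integral_powr_div_1_plus:
  fixes s :: real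
  assumes "0 < s" "s < 1"
  shows "(\<integral>\<^sup>+u. ennreal (indicator {0<..} u * (u powr (s - 1) / (1 + u))) \<partial>lborel)
       = ennreal (pi / sin (pi * s))"
proof -
  let ?i = "\<lambda>x. indicator {0<..} x :: real"
  let ?J = "\<lambda>u w. ennreal (?i u * (?i w * (u powr (s - 1) * exp (- (w * u)) * exp (- w))))"
  have 1: "ennreal (?i u * (u powr (s - 1) / (1 + u))) = (\<integral>\<^sup>+w. ?J u w \<partial>lborel)" for u
  proof -
    have "(\<integral>\<^sup>+w. ?J u w \<partial>lborel) = (\<integral>\<^sup>+w. ennreal (?i u * u powr (s - 1)) *
        ennreal (?i w * (w powr (1 - 1) * exp (- ((1 + u) * w)))) \<partial>lborel)"
      by (intro nn_integral_cong)
        (auto simp: indicator_def algebra_simps exp_add exp_diff exp_minus divide_inverse simp flip: ennreal_mult)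
    also have "\<dots> = ennreal (?i u * u powr (s - 1)) *
       (\<integral>\<^sup>+w. ennreal (?i w * (w powr (1 - 1) * exp (- ((1 + u) * w)))) \<partial>lborel)"
      by (rule nn_integral_cmult) measurable
    also have "\<dots> = ennreal (?i u * (u powr (s - 1) / (1 + u)))"
      by (cases "0 < u")
        (subst nn_integral_Gamma_scaled, auto simp: powr_minus divide_inverse simp flip: ennreal_mult)
    finally show ?thesis ..
  qed
  have 2: "(\<integral>\<^sup>+u. ?J u w \<partial>lborel) = ennreal (Gamma s) * ennreal (?i w * (w powr ((1 - s) - 1) * exp (- (1 * w))))" for w
  proof -
    have "(\<integral>\<^sup>+u. ?J u w \<partial>lborel) = (\<integral>\<^sup>+u. ennreal (?i w * exp (- w)) *
        ennreal (?i u * (u powr (s - 1) * exp (- (w * u)))) \<partial>lborel)"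
      by (intro nn_integral_cong) (auto simp: indicator_def mult_ac simp flip: ennreal_mult)
    also have "\<dots> = ennreal (?i w * exp (- w)) * (\<integral>\<^sup>+u. ennreal (?i u * (u powr (s - 1) * exp (- (w * u)))) \<partial>lborel)"
      by (rule nn_integral_cmult) measurable
    also have "\<dots> = ennreal (Gamma s) * ennreal (?i w * (w powr ((1 - s) - 1) * exp (- (1 * w))))"
      using assms by (cases "0 < w")
        (subst nn_integral_Gamma_scaled, auto simp: mult_ac Gamma_real_pos less_imp_le simp flip: ennreal_mult)
    finally show ?thesis .
  qed
  have "(\<integral>\<^sup>+u. ennreal (?i u * (u powr (s - 1) / (1 + u))) \<partial>lborel) = (\<integral>\<^sup>+u. (\<integral>\<^sup>+w. ?J u w \<partial>lborel) \<partial>lborel)"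
    by (simp only: 1)
  also have "\<dots> = (\<integral>\<^sup>+w. (\<integral>\<^sup>+u. ?J u w \<partial>lborel) \<partial>lborel)"
    by (rule lborel_pair.Fubini') measurable
  also have "\<dots> = ennreal (Gamma s) * (\<integral>\<^sup>+w. ennreal (?i w * (w powr ((1 - s) - 1) * exp (- (1 * w)))) \<partial>lborel)"
    unfolding 2 by (rule nn_integral_cmult) measurable
  also have "\<dots> = ennreal (Gamma s * Gamma (1 - s))"
    using assms by (subst nn_integral_Gamma_scaled) (auto simp: ennreal_mult Gamma_real_pos less_imp_le)
  also have "Gamma s * Gamma (1 - s) = pi / sin (pi * s)"
  proof -
    have "complex_of_real (Gamma s * Gamma (1 - s)) = of_real (pi / sin (pi * s))"
      using Gamma_reflection_complex[of "of_real s"]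
      by (simp add: Gamma_complex_of_real[symmetric] sin_of_real[symmetric])
    then show ?thesis by (simp only: of_real_eq_iff)
  qed
  finally show ?thesis .
qed

lemma integral_exp_sin:
  fixes v :: real
  assumes "0 < v"
  shows "set_integrable lborel {0<..} (\<lambda>r. exp (- (r * v)) * sin r)"
    and "(LINT r:{0<..}|lborel. exp (- (r * v)) * sin r) = 1 / (1 + v\<^sup>2)"
proof -
  show int: "set_integrable lborel {0<..} (\<lambda>r. exp (- (r * v)) * sin r)"
    by (rule set_integrable_bound[OF integrable_I0i_exp_mscale[OF assms]])
      (auto simp: set_borel_measurable_def abs_mult mult_le_cancel_left1)
  \<comment> \<open>An antiderivative normalised to vanish at 0, so that its limit at infinity is
    the integral.\<close>
  let ?F = "\<lambda>t. 1 / (1 + v\<^sup>2) * (1 - exp (- (v * t)) * (v * sin t + cos t))"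
  have pos: "1 + v\<^sup>2 > 0" by (simp add: add_pos_nonneg)
  have ne: "1 + v\<^sup>2 \<noteq> 0" using pos by simp
  have bnd: "\<bar>v * sin t + cos t\<bar> \<le> v + 1" for t
    using abs_triangle_ineq[of "v * sin t" "cos t"] abs_sin_le_one[of t] abs_cos_le_one[of t] assms
      mult_left_mono[OF abs_sin_le_one[of t], of v]
    unfolding abs_mult by linarith
  have D: "((\<lambda>t. k * (1 - exp (- (v * t)) * (v * sin t + cos t))) has_real_derivative
      k * ((1 + v\<^sup>2) * (exp (- (x * v)) * sin x))) (at x)" for k x
    by (auto intro!: derivative_eq_intros simp: algebra_simps power2_eq_square)
  have "(LBINT r=0..\<infinity>. exp (- (r * v)) * sin r) = 1 / (1 + v\<^sup>2) - 0"
  proof (rule interval_integral_FTC_integrable)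
    show "(?F has_vector_derivative exp (- (x * v)) * sin x) (at x)" for x
      unfolding has_real_derivative_iff_has_vector_derivative[symmetric]
    proof (rule DERIV_cong)
      show "(?F has_real_derivative 1 / (1 + v\<^sup>2) * ((1 + v\<^sup>2) * (exp (- (x * v)) * sin x))) (at x)"
        by (rule D)
      show "1 / (1 + v\<^sup>2) * ((1 + v\<^sup>2) * (exp (- (x * v)) * sin x)) = exp (- (x * v)) * sin x"
        using pos by simp
    qed
    show "isCont (\<lambda>r. exp (- (r * v)) * sin r) x" for x by (intro continuous_intros)
    show "set_integrable lborel (einterval 0 \<infinity>) (\<lambda>r. exp (- (r * v)) * sin r)"
      using int by (simp add: zero_ereal_def)
    show "((?F \<circ> real_of_ereal) \<longlongrightarrow> 0) (at_right 0)"
      using ne by (auto simp: zero_ereal_def ereal_tendsto_simps intro!: tendsto_eq_intros)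
    have "((\<lambda>t. exp (- (v * t)) * (v * sin t + cos t)) \<longlongrightarrow> 0) at_top"
    proof (rule Lim_null_comparison)
      show "\<forall>\<^sub>F t in at_top. norm (exp (- (v * t)) * (v * sin t + cos t)) \<le> exp (- (v * t)) * (v + 1)"
        using bnd by (auto simp: abs_mult)
      show "((\<lambda>t. exp (- (v * t)) * (v + 1)) \<longlongrightarrow> 0) at_top"
        using assms by real_asymp
    qed
    then have "((\<lambda>t. 1 / (1 + v\<^sup>2) * (1 - exp (- (v * t)) * (v * sin t + cos t))) \<longlongrightarrow> 1 / (1 + v\<^sup>2) * (1 - 0)) at_top"
      by (intro tendsto_mult tendsto_diff tendsto_const)
    then show "((?F \<circ> real_of_ereal) \<longlongrightarrow> 1 / (1 + v\<^sup>2)) (at_left \<infinity>)"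
      unfolding ereal_tendsto_simps by simp
  qed simp
  then show "(LINT r:{0<..}|lborel. exp (- (r * v)) * sin r) = 1 / (1 + v\<^sup>2)"
    by (simp add: interval_integral_to_infinity_eq zero_ereal_def)
qed

lemma has_bochner_integral_Gamma_scaled:
  fixes s c :: real
  assumes "0 < s" "0 < c"
  shows "has_bochner_integral lborel (\<lambda>v. indicator {0<..} v * (v powr (s - 1) * exp (- (c * v)))) (Gamma s * c powr (- s))"
  using assms by (intro has_bochner_integral_nn_integral nn_integral_Gamma_scaled)
    (auto simp: Gamma_real_pos less_imp_le)

lemma nn_integral_powr_from_0:
  fixes a c :: real
  assumes "-1 < a" "0 \<le> c"
  shows "(\<integral>\<^sup>+x. ennreal (indicator {0..c} x * x powr a) \<partial>lborel) = ennreal (c powr (a + 1) / (a + 1))"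
  using nn_integral_has_integral_lebesgue[OF _ has_integral_powr_from_0[OF assms]] by simp

lemma nn_integral_powr_to_inf:
  fixes e a :: real
  assumes "e < -1" "0 < a"
  shows "(\<integral>\<^sup>+x. ennreal (indicator {a..} x * x powr e) \<partial>lborel) = ennreal (- (a powr (e + 1)) / (e + 1))"
  using nn_integral_has_integral_lebesgue[OF _ has_integral_powr_to_inf[OF assms]] by simp

text \<open>Near 0 the integrand is \<open>r powr (1 - \<alpha>)\<close>, integrable for
  \<open>\<alpha> < 2\<close>; beyond 1 it is \<open>r powr (- \<alpha>)\<close>, integrable for
  \<open>1 < \<alpha>\<close>. Integrability of increments under \<open>\<nu>\<close> rests on
  this.\<close>

lemma nn_integral_min_powr:
  fixes \<alpha> :: real
  assumes "1 < \<alpha>" "\<alpha> < 2"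
  shows "(\<integral>\<^sup>+r. ennreal (indicator {0<..} r * (min 1 r * r powr (- \<alpha>))) \<partial>lborel) < \<infinity>"
proof -
  have "(\<integral>\<^sup>+r. ennreal (indicator {0<..} r * (min 1 r * r powr (- \<alpha>))) \<partial>lborel)
      \<le> (\<integral>\<^sup>+r. ennreal (indicator {0..1} r * r powr (1 - \<alpha>)) + ennreal (indicator {1..} r * r powr (- \<alpha>)) \<partial>lborel)"
  proof (rule nn_integral_mono)
    fix r :: real
    have "indicator {0<..} r * (min 1 r * r powr (- \<alpha>)) \<le> indicator {0..1} r * r powr (1 - \<alpha>) + indicator {1..} r * r powr (- \<alpha>)"
      by (auto simp: indicator_def min_def powr_diff powr_minus divide_inverse)
    then show "ennreal (indicator {0<..} r * (min 1 r * r powr (- \<alpha>)))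
        \<le> ennreal (indicator {0..1} r * r powr (1 - \<alpha>)) + ennreal (indicator {1..} r * r powr (- \<alpha>))"
      by (auto dest: ennreal_leI)
  qed
  also have "\<dots> = ennreal (1 powr (1 - \<alpha> + 1) / (1 - \<alpha> + 1)) + ennreal (- (1 powr (- \<alpha> + 1)) / (- \<alpha> + 1))"
    using assms by (subst nn_integral_add) (auto simp only: nn_integral_powr_from_0 nn_integral_powr_to_inf, auto)
  also have "\<dots> < \<infinity>" by simp
  finally show ?thesis .
qed

text \<open>Substituting \<open>u = v\<^sup>2\<close> gives half the Beta integral with
  \<open>s = \<alpha> / 2\<close>. Integrability is a hypothesis because the caller obtains it from
  Fubini.\<close>

lemma integral_powr_div_1_plus_square:
  fixes \<alpha> :: real
  assumes \<alpha>: "0 < \<alpha>" "\<alpha> < 2"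
    and int: "set_integrable lborel {0<..} (\<lambda>v. v powr (\<alpha> - 1) / (1 + v\<^sup>2))"
  shows "(LINT v:{0<..}|lborel. v powr (\<alpha> - 1) / (1 + v\<^sup>2)) = pi / (2 * sin (pi * \<alpha> / 2))"
proof -
  define f where "f u = u powr (\<alpha> / 2 - 1) * inverse (1 + u) * (1 / 2)" for u :: real
  have f: "f (v\<^sup>2) * (2 * v) = v powr (\<alpha> - 1) / (1 + v\<^sup>2)" if "0 < v" for v
  proof -
    have "(v\<^sup>2) powr (\<alpha> / 2 - 1) * v = v powr (2 * (\<alpha> / 2 - 1)) * v powr 1"
      using that by (simp add: powr_powr flip: powr_numeral)
    also have "\<dots> = v powr (\<alpha> - 1)" unfolding powr_add[symmetric] by simp
    finally have *: "(v\<^sup>2) powr (\<alpha> / 2 - 1) * v = v powr (\<alpha> - 1)" .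
    have "f (v\<^sup>2) * (2 * v) = ((v\<^sup>2) powr (\<alpha> / 2 - 1) * v) * inverse (1 + v\<^sup>2)"
      by (simp add: f_def)
    then show ?thesis unfolding * by (simp only: divide_inverse)
  qed
  have ind: "indicator {0<..} v *\<^sub>R (f (v\<^sup>2) * (2 * v)) = indicator {0<..} v *\<^sub>R (v powr (\<alpha> - 1) / (1 + v\<^sup>2))" for v
    by (cases "0 < v") (simp_all only: f, simp)
  have eq: "set_integrable lborel {0<..} (\<lambda>v. f (v\<^sup>2) * (2 * v)) \<longleftrightarrow> set_integrable lborel {0<..} (\<lambda>v. v powr (\<alpha> - 1) / (1 + v\<^sup>2))"
    "(LINT v:{0<..}|lborel. f (v\<^sup>2) * (2 * v)) = (LINT v:{0<..}|lborel. v powr (\<alpha> - 1) / (1 + v\<^sup>2))"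
    unfolding set_integrable_def set_lebesgue_integral_def ind by (rule refl)+
  have "(LBINT u=0..\<infinity>. f u) = (LBINT v=0..\<infinity>. f (v\<^sup>2) * (2 * v))"
  proof (rule interval_integral_substitution_nonneg(2))
    show "((\<lambda>v. v\<^sup>2) has_real_derivative 2 * x) (at x)" for x :: real
      by (auto intro!: derivative_eq_intros)
    show "isCont f (x\<^sup>2)" if "0 < ereal x" for x
    proof -
      have "0 < x\<^sup>2" using that by (simp add: zero_ereal_def)
      moreover from this have "1 + x\<^sup>2 \<noteq> 0" by linarith
      ultimately show ?thesis unfolding f_def by (intro continuous_intros) auto
    qed
    show "0 \<le> f (x\<^sup>2)" for x by (simp add: f_def)
    show "((ereal \<circ> (\<lambda>v. v\<^sup>2) \<circ> real_of_ereal) \<longlongrightarrow> 0) (at_right 0)"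
      by (auto simp: zero_ereal_def ereal_tendsto_simps intro!: tendsto_eq_intros)
    have "filterlim (\<lambda>v::real. v\<^sup>2) at_top at_top" by real_asymp
    then show "((ereal \<circ> (\<lambda>v. v\<^sup>2) \<circ> real_of_ereal) \<longlongrightarrow> \<infinity>) (at_left \<infinity>)"
      by (simp add: ereal_tendsto_simps tendsto_PInfty_eq_at_top)
    show "set_integrable lborel (einterval 0 \<infinity>) (\<lambda>v. f (v\<^sup>2) * (2 * v))"
      using int eq(1) by (simp add: zero_ereal_def)
  qed (auto simp: zero_ereal_def)
  then have "(LINT v:{0<..}|lborel. v powr (\<alpha> - 1) / (1 + v\<^sup>2)) = (LINT u:{0<..}|lborel. f u)"
    by (simp add: interval_integral_to_infinity_eq zero_ereal_def eq(2))
  also have "\<dots> = (LINT u|lborel. (indicator {0<..} u * (u powr (\<alpha> / 2 - 1) / (1 + u))) * (1 / 2))"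
    unfolding set_lebesgue_integral_def f_def
    by (simp only: real_scaleR_def divide_inverse mult.assoc mult_1_left)
  also have "\<dots> = (LINT u|lborel. indicator {0<..} u * (u powr (\<alpha> / 2 - 1) / (1 + u))) * (1 / 2)"
    by (rule integral_mult_left_zero)
  also have "(LINT u|lborel. indicator {0<..} u * (u powr (\<alpha> / 2 - 1) / (1 + u))) = pi / sin (pi * (\<alpha> / 2))"
    using nn_integral_powr_div_1_plus[of "\<alpha> / 2"] \<alpha> sin_gt_zero[of "pi * (\<alpha> / 2)"]
    by (intro has_bochner_integral_integral_eq has_bochner_integral_nn_integral)
      (auto simp: indicator_def intro!: divide_nonneg_pos)
  finally show ?thesis by simp
qed

text \<open>Reflection at \<open>\<alpha>\<close>, the shift from
  \<open>Gamma (1 - \<alpha>)\<close> to \<open>Gamma (2 - \<alpha>)\<close>, and the double angle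
  formula. The right side is arranged so that cancelling \<open>Gamma \<alpha>\<close> leaves
  \<open>\<alpha>\<close> times the factor in \<open>spectral_measure\<close>.\<close>

lemma Gamma_reflection_half:
  fixes \<alpha> :: real
  assumes "1 < \<alpha>" "\<alpha> < 2"
  shows "pi / (2 * sin (pi * \<alpha> / 2)) = Gamma \<alpha> * (- cos (\<alpha> * pi / 2) * Gamma (2 - \<alpha>) / (\<alpha> - 1))"
proof -
  have "complex_of_real (Gamma \<alpha> * Gamma (1 - \<alpha>)) = of_real (pi / sin (pi * \<alpha>))"
    using Gamma_reflection_complex[of "of_real \<alpha>"]
    by (simp add: Gamma_complex_of_real[symmetric] sin_of_real[symmetric])
  then have 1: "Gamma \<alpha> * Gamma (1 - \<alpha>) = pi / sin (pi * \<alpha>)" by (simp only: of_real_eq_iff)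
  \<comment> \<open>\<open>1 - \<alpha>\<close> lies strictly between -1 and 0, so it is not a pole
    and the functional equation applies.\<close>
  have "1 - \<alpha> \<notin> \<int>\<^sub>\<le>\<^sub>0"
  proof
    assume "1 - \<alpha> \<in> \<int>\<^sub>\<le>\<^sub>0"
    then obtain n where "1 - \<alpha> = of_int n" by (elim nonpos_Ints_cases)
    with assms have "- 1 < (of_int n :: real)" "of_int n < (0::real)" by linarith+
    then show False by simp
  qed
  then have 2: "Gamma (2 - \<alpha>) = (1 - \<alpha>) * Gamma (1 - \<alpha>)"
    using Gamma_plus1[of "1 - \<alpha>"] by simp
  have s: "sin (pi * \<alpha> / 2) > 0" using assms by (intro sin_gt_zero) auto
  have "cos (pi - pi * \<alpha> / 2) > 0" using assms by (intro cos_gt_zero_pi) (auto simp: field_simps)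
  then have c: "cos (pi * \<alpha> / 2) < 0" by (simp add: cos_diff)
  have 3: "sin (pi * \<alpha>) = 2 * sin (pi * \<alpha> / 2) * cos (pi * \<alpha> / 2)"
    using sin_double[of "pi * \<alpha> / 2"] by simp
  have "Gamma \<alpha> * (- cos (\<alpha> * pi / 2) * Gamma (2 - \<alpha>) / (\<alpha> - 1)) = cos (pi * \<alpha> / 2) * (Gamma \<alpha> * Gamma (1 - \<alpha>))"
    unfolding 2 using assms by (simp add: field_simps)
  also have "\<dots> = pi / (2 * sin (pi * \<alpha> / 2))"
    unfolding 1 3 using c s by (simp add: field_simps)
  finally show ?thesis ..
qed

text \<open>Writing \<open>r powr (- \<alpha>)\<close> as a mixture of the exponentials \<open>exp (- (r * v))\<close> turns the integral
  into \<open>\<integral> v powr (\<alpha> - 1) / (1 + v\<^sup>2)\<close>.\<close>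

lemma integral_powr_sin:
  fixes \<alpha> :: real
  assumes \<alpha>: "1 < \<alpha>" "\<alpha> < 2"
  shows "set_integrable lborel {0<..} (\<lambda>r. r powr (- \<alpha>) * sin r)"
    and "(LINT r:{0<..}|lborel. r powr (- \<alpha>) * sin r) = - cos (\<alpha> * pi / 2) * Gamma (2 - \<alpha>) / (\<alpha> - 1)"
proof -
  let ?i = "\<lambda>x. indicator {0<..} x :: real"
  have "integrable lborel (\<lambda>r. ?i r * (min 1 r * r powr (- \<alpha>)))"
    by (rule integrableI_nonneg) (use nn_integral_min_powr[OF \<alpha>] in \<open>auto simp: indicator_def\<close>)
  then have int: "integrable lborel (\<lambda>r. ?i r * (r powr (- \<alpha>) * sin r))"
  proof (rule Bochner_Integration.integrable_bound)
    have "r powr (- \<alpha>) * \<bar>sin r\<bar> \<le> min 1 r * r powr (- \<alpha>)" if "0 < r" for r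
      using mult_right_mono[of "\<bar>sin r\<bar>" "min 1 r" "r powr (- \<alpha>)"] that abs_sin_x_le_abs_x[of r]
      by (simp add: mult.commute)
    then show "AE r in lborel. norm (?i r * (r powr (- \<alpha>) * sin r)) \<le> norm (?i r * (min 1 r * r powr (- \<alpha>)))"
      by (auto simp: indicator_def abs_mult)
  qed measurable
  then show "set_integrable lborel {0<..} (\<lambda>r. r powr (- \<alpha>) * sin r)"
    by (simp add: set_integrable_def)
  \<comment> \<open>Integrating out \<open>v\<close> returns
    \<open>Gamma \<alpha> * r powr (- \<alpha>) * sin r\<close>, and gives absolute integrability
    because the mixing weights are nonnegative. Integrating out \<open>r\<close> leaves the Laplace
    transform of the sine.\<close>
  define H where "H r v = ?i r * sin r * (?i v * (v powr (\<alpha> - 1) * exp (- (r * v))))" for r v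
  have [measurable]: "case_prod H \<in> borel_measurable (lborel \<Otimes>\<^sub>M lborel)"
    unfolding H_def by measurable
  have Hv: "integrable lborel (H r)" "(LINT v|lborel. H r v) = Gamma \<alpha> * (?i r * (r powr (- \<alpha>) * sin r))"
    "(LINT v|lborel. norm (H r v)) = Gamma \<alpha> * \<bar>?i r * (r powr (- \<alpha>) * sin r)\<bar>" for r
  proof -
    consider "r \<le> 0" | "0 < r" by linarith
    then have "integrable lborel (H r) \<and> (LINT v|lborel. H r v) = Gamma \<alpha> * (?i r * (r powr (- \<alpha>) * sin r))
      \<and> (LINT v|lborel. norm (H r v)) = Gamma \<alpha> * \<bar>?i r * (r powr (- \<alpha>) * sin r)\<bar>"
    proof cases
      case 1
      then have "H r = (\<lambda>_. 0)" by (auto simp: H_def)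
      then show ?thesis using 1 by simp
    next
      case 2
      have G: "has_bochner_integral lborel (\<lambda>v. ?i v * (v powr (\<alpha> - 1) * exp (- (r * v)))) (Gamma \<alpha> * r powr (- \<alpha>))"
        using \<alpha> 2 by (intro has_bochner_integral_Gamma_scaled) auto
      then have G: "integrable lborel (\<lambda>v. ?i v * (v powr (\<alpha> - 1) * exp (- (r * v))))"
        "(LINT v|lborel. ?i v * (v powr (\<alpha> - 1) * exp (- (r * v)))) = Gamma \<alpha> * r powr (- \<alpha>)"
        by (simp_all only: has_bochner_integral_iff)
      have H: "H r = (\<lambda>v. sin r * (?i v * (v powr (\<alpha> - 1) * exp (- (r * v)))))"
        using 2 by (simp add: H_def fun_eq_iff)
      have N: "norm (sin r * (?i v * (v powr (\<alpha> - 1) * exp (- (r * v)))))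
          = \<bar>sin r\<bar> * (?i v * (v powr (\<alpha> - 1) * exp (- (r * v))))" for v
        by (auto simp: abs_mult indicator_def)
      have "integrable lborel (H r)"
        unfolding H by (intro integrable_mult_right G)
      moreover have "(LINT v|lborel. H r v) = Gamma \<alpha> * (?i r * (r powr (- \<alpha>) * sin r))"
        unfolding H integral_mult_right_zero G using 2 by simp
      moreover have "(LINT v|lborel. norm (H r v)) = Gamma \<alpha> * \<bar>?i r * (r powr (- \<alpha>) * sin r)\<bar>"
        unfolding H N integral_mult_right_zero G using 2 by (simp add: abs_mult)
      ultimately show ?thesis by blast
    qed
    then show "integrable lborel (H r)" "(LINT v|lborel. H r v) = Gamma \<alpha> * (?i r * (r powr (- \<alpha>) * sin r))"
      "(LINT v|lborel. norm (H r v)) = Gamma \<alpha> * \<bar>?i r * (r powr (- \<alpha>) * sin r)\<bar>" by auto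
  qed
  have I: "integrable (lborel \<Otimes>\<^sub>M lborel) (case_prod H)"
  proof (rule lborel_pair.Fubini_integrable)
    show "integrable lborel (\<lambda>r. LINT v|lborel. norm (case (r, v) of (r, v) \<Rightarrow> H r v))"
      using int by (simp add: Hv(3)[simplified])
  qed (use Hv in auto)
  have Hr: "(LINT r|lborel. H r v) = ?i v *\<^sub>R (v powr (\<alpha> - 1) / (1 + v\<^sup>2))" for v
  proof (cases "0 < v")
    case True
    have "(LINT r|lborel. H r v) = (LINT r|lborel. v powr (\<alpha> - 1) * (?i r *\<^sub>R (exp (- (r * v)) * sin r)))"
      using True by (intro Bochner_Integration.integral_cong refl) (simp add: H_def mult_ac)
    also have "\<dots> = v powr (\<alpha> - 1) * (LINT r:{0<..}|lborel. exp (- (r * v)) * sin r)"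
      by (simp add: set_lebesgue_integral_def)
    finally show ?thesis using True by (simp add: integral_exp_sin)
  qed (simp add: H_def)
  \<comment> \<open>The integrability hypothesis of the rational integral is that of the marginal of
    \<open>H\<close>.\<close>
  have J: "set_integrable lborel {0<..} (\<lambda>v. v powr (\<alpha> - 1) / (1 + v\<^sup>2))"
    using lborel_pair.integrable_snd[OF I] by (simp add: Hr set_integrable_def)
  have "Gamma \<alpha> * (LINT r:{0<..}|lborel. r powr (- \<alpha>) * sin r) = (LINT r|lborel. (LINT v|lborel. H r v))"
    by (simp add: Hv(2) set_lebesgue_integral_def)
  also have "\<dots> = (LINT v|lborel. (LINT r|lborel. H r v))"
    using I by (rule lborel_pair.Fubini_integral[symmetric])
  also have "\<dots> = pi / (2 * sin (pi * \<alpha> / 2))"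
    using integral_powr_div_1_plus_square[OF _ _ J] \<alpha> by (simp add: Hr set_lebesgue_integral_def)
  also have "\<dots> = Gamma \<alpha> * (- cos (\<alpha> * pi / 2) * Gamma (2 - \<alpha>) / (\<alpha> - 1))"
    by (rule Gamma_reflection_half[OF \<alpha>])
  finally have "Gamma \<alpha> * (LINT r:{0<..}|lborel. r powr (- \<alpha>) * sin r)
      = Gamma \<alpha> * (- cos (\<alpha> * pi / 2) * Gamma (2 - \<alpha>) / (\<alpha> - 1))" .
  moreover have "0 < Gamma \<alpha>" using \<alpha> by (intro Gamma_real_pos) auto
  then have "Gamma \<alpha> \<noteq> 0" by simp
  ultimately show "(LINT r:{0<..}|lborel. r powr (- \<alpha>) * sin r) = - cos (\<alpha> * pi / 2) * Gamma (2 - \<alpha>) / (\<alpha> - 1)"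
    by (simp only: mult_cancel_left simp_thms)
qed

section \<open>The stable Levy measure\<close>

text \<open>The radial factor of \<open>\<nu>\<close>, made a measure on the whole line so that
  \<open>\<nu>\<close> becomes the image of a product measure with \<open>\<sigma>\<close> and
  Fubini applies.\<close>

definition radial_measure :: "real \<Rightarrow> real measure" where
  "radial_measure \<alpha> = density lborel (\<lambda>r. ennreal (indicator {0<..} r * (1 / r powr (\<alpha> + 1))))"

lemma sets_radial_measure [measurable_cong, simp]: "sets (radial_measure \<alpha>) = sets borel"
  by (simp add: radial_measure_def)

lemma sigma_finite_radial_measure: "sigma_finite_measure (radial_measure \<alpha>)"
  unfolding radial_measure_def by (subst sigma_finite_measure.sigma_finite_iff_density_finite[OF sigma_finite_lborel]) auto

text \<open>\<open>\<sigma>\<close> carries the trace sets of the sphere, so even the inclusion into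
  the ambient space needs a measurability statement. Symmetry is recast as invariance under an image
  measure, the form used in changes of variables.\<close>

lemma spherical_componentD:
  fixes \<sigma> :: "'a::euclidean_space measure"
  assumes "spherical_component \<sigma>"
  shows spherical_component_space: "space \<sigma> = sphere 0 1"
    and spherical_component_measurable: "(\<lambda>y. y) \<in> borel_measurable \<sigma>"
    and spherical_component_uminus: "distr \<sigma> \<sigma> uminus = \<sigma>" "uminus \<in> measurable \<sigma> \<sigma>"
proof -
  have s: "sets \<sigma> = sets (restrict_space borel (sphere 0 1))"
    and sym: "\<And>B. B \<in> sets \<sigma> \<Longrightarrow> emeasure \<sigma> B = emeasure \<sigma> (uminus ` B)"
    using assms by (auto simp: spherical_component_def)
  show sp: "space \<sigma> = sphere 0 1" using sets_eq_imp_space_eq[OF s] by (simp add: space_restrict_space)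
  have "(\<lambda>y. y) \<in> borel_measurable (restrict_space borel (sphere 0 1))"
    by (rule measurable_restrict_space1) simp
  then show m: "(\<lambda>y. y) \<in> borel_measurable \<sigma>" by (simp add: measurable_cong_sets[OF s refl])
  have "uminus \<in> borel_measurable \<sigma>" using borel_measurable_uminus[OF m] by simp
  then have "uminus \<in> measurable \<sigma> (restrict_space borel (sphere 0 1))"
    by (intro measurable_restrict_space2) (auto simp: sp)
  then show u: "uminus \<in> measurable \<sigma> \<sigma>" by (simp add: measurable_cong_sets[OF refl s])
  show "distr \<sigma> \<sigma> uminus = \<sigma>"
  proof (rule measure_eqI)
    fix B assume "B \<in> sets (distr \<sigma> \<sigma> uminus)"
    then have B: "B \<in> sets \<sigma>" by simp
    then have "B \<subseteq> sphere 0 1" using sets.sets_into_space[OF B] sp by simp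
    then have "uminus -` B \<inter> space \<sigma> = uminus ` B"
      by (auto simp: sp image_iff) (metis minus_minus)+
    then show "emeasure (distr \<sigma> \<sigma> uminus) B = emeasure \<sigma> B"
      using B u sym by (simp add: emeasure_distr)
  qed simp
qed

locale stable_levy =
  fixes \<alpha> :: real and \<sigma> \<nu> :: "'a::euclidean_space measure"
  assumes \<alpha>: "1 < \<alpha>" "\<alpha> < 2" and levy: "symmetric_stable_levy_measure \<alpha> \<sigma> \<nu>"
begin

lemma spherical: "spherical_component \<sigma>"
  using levy by (simp add: symmetric_stable_levy_measure_def)

lemma sets_levy [measurable_cong, simp]: "sets \<nu> = sets borel"
  using levy by (simp add: symmetric_stable_levy_measure_def)

lemma space_levy [simp]: "space \<nu> = UNIV"
  using sets_eq_imp_space_eq[OF sets_levy] by simp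

lemma finite_sigma: "finite_measure \<sigma>"
  using spherical by (simp add: spherical_component_def)

lemma measurable_polar: "(\<lambda>(y, r). r *\<^sub>R y) \<in> borel_measurable (\<sigma> \<Otimes>\<^sub>M radial_measure \<alpha>)"
proof -
  note spherical_component_measurable[OF spherical, measurable]
  have [measurable]: "fst \<in> borel_measurable (\<sigma> \<Otimes>\<^sub>M radial_measure \<alpha>)"
    using measurable_compose[OF measurable_fst spherical_component_measurable[OF spherical]] by simp
  show ?thesis unfolding split_beta' by measurable
qed

lemma levy_emeasure_polar:
  assumes [measurable]: "B \<in> sets borel"
  shows "emeasure \<nu> B = (\<integral>\<^sup>+y. (\<integral>\<^sup>+r. indicator B (r *\<^sub>R y) \<partial>radial_measure \<alpha>) \<partial>\<sigma>)"
proof -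
  have "(\<integral>\<^sup>+r. indicator B (r *\<^sub>R y) \<partial>radial_measure \<alpha>)
      = (\<integral>\<^sup>+r\<in>{0<..}. indicator B (r *\<^sub>R y) * ennreal (1 / r powr (\<alpha> + 1)) \<partial>lborel)" for y
    unfolding radial_measure_def
    by (subst nn_integral_density) (auto intro!: nn_integral_cong simp: indicator_def)
  then show ?thesis
    using levy assms by (simp add: symmetric_stable_levy_measure_def)
qed

text \<open>Replaces the iterated integral that defines \<open>\<nu>\<close> on sets by an image
  measure, from which the polar formulas for nonnegative and for Bochner integrals both
  follow.\<close>

lemma levy_polar: "\<nu> = distr (\<sigma> \<Otimes>\<^sub>M radial_measure \<alpha>) borel (\<lambda>(y, r). r *\<^sub>R y)"
proof (rule measure_eqI)
  fix B assume "B \<in> sets \<nu>"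
  then have [measurable]: "B \<in> sets borel" by simp
  note measurable_polar [measurable]
  interpret R: sigma_finite_measure "radial_measure \<alpha>" by (rule sigma_finite_radial_measure)
  have "emeasure (distr (\<sigma> \<Otimes>\<^sub>M radial_measure \<alpha>) borel (\<lambda>(y, r). r *\<^sub>R y)) B
      = (\<integral>\<^sup>+z. indicator B z \<partial>distr (\<sigma> \<Otimes>\<^sub>M radial_measure \<alpha>) borel (\<lambda>(y, r). r *\<^sub>R y))"
    by simp
  also have "\<dots> = (\<integral>\<^sup>+z. indicator B (case z of (y, r) \<Rightarrow> r *\<^sub>R y) \<partial>(\<sigma> \<Otimes>\<^sub>M radial_measure \<alpha>))"
    by (subst nn_integral_distr) auto
  also have "\<dots> = (\<integral>\<^sup>+y. (\<integral>\<^sup>+r. indicator B (r *\<^sub>R y) \<partial>radial_measure \<alpha>) \<partial>\<sigma>)"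
    by (subst R.nn_integral_fst[symmetric]) auto
  finally show "emeasure \<nu> B = emeasure (distr (\<sigma> \<Otimes>\<^sub>M radial_measure \<alpha>) borel (\<lambda>(y, r). r *\<^sub>R y)) B"
    by (simp add: levy_emeasure_polar)
qed simp

lemma levy_nn_integral_polar:
  assumes [measurable]: "h \<in> borel_measurable borel"
  shows "(\<integral>\<^sup>+u. h u \<partial>\<nu>) = (\<integral>\<^sup>+y. (\<integral>\<^sup>+r. h (r *\<^sub>R y) \<partial>radial_measure \<alpha>) \<partial>\<sigma>)"
proof -
  note measurable_polar [measurable]
  interpret R: sigma_finite_measure "radial_measure \<alpha>" by (rule sigma_finite_radial_measure)
  have "(\<integral>\<^sup>+u. h u \<partial>\<nu>) = (\<integral>\<^sup>+z. h (case z of (y, r) \<Rightarrow> r *\<^sub>R y) \<partial>(\<sigma> \<Otimes>\<^sub>M radial_measure \<alpha>))"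
    by (subst levy_polar, subst nn_integral_distr) auto
  also have "\<dots> = (\<integral>\<^sup>+y. (\<integral>\<^sup>+r. h (r *\<^sub>R y) \<partial>radial_measure \<alpha>) \<partial>\<sigma>)"
    by (subst R.nn_integral_fst[symmetric]) auto
  finally show ?thesis .
qed

lemma levy_integral_polar:
  fixes h :: "'a \<Rightarrow> real"
  assumes h: "integrable \<nu> h"
  shows "(LINT u|\<nu>. h u) = (LINT y|\<sigma>. (LINT r|radial_measure \<alpha>. h (r *\<^sub>R y)))"
proof -
  note measurable_polar [measurable]
  have [measurable]: "h \<in> borel_measurable borel" using h by auto
  interpret S: finite_measure \<sigma> by (rule finite_sigma)
  interpret R: sigma_finite_measure "radial_measure \<alpha>" by (rule sigma_finite_radial_measure)
  interpret SR: pair_sigma_finite \<sigma> "radial_measure \<alpha>" ..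
  have "integrable (\<sigma> \<Otimes>\<^sub>M radial_measure \<alpha>) (\<lambda>z. h (case z of (y, r) \<Rightarrow> r *\<^sub>R y))"
    using h by (subst (asm) levy_polar, subst (asm) integrable_distr_eq) auto
  then have I: "integrable (\<sigma> \<Otimes>\<^sub>M radial_measure \<alpha>) (\<lambda>(y, r). h (r *\<^sub>R y))"
    by (simp add: split_beta')
  have "(LINT u|\<nu>. h u) = (LINT z|(\<sigma> \<Otimes>\<^sub>M radial_measure \<alpha>). h (case z of (y, r) \<Rightarrow> r *\<^sub>R y))"
    by (subst levy_polar, subst integral_distr) auto
  also have "\<dots> = (LINT y|\<sigma>. (LINT r|radial_measure \<alpha>. h (r *\<^sub>R y)))"
    using SR.integral_fst[OF I] by (simp add: split_beta')
  finally show ?thesis .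
qed

text \<open>The weight is the size of \<open>(f (x + u) - f x) *\<^sub>R u\<close> for bounded
  Lipschitz \<open>f\<close>. As directions have norm 1, the radial integral is the same finite
  constant for all of them, and \<open>\<sigma>\<close> is finite.\<close>

lemma levy_nn_integral_finite: "(\<integral>\<^sup>+u. ennreal (min 1 (norm u) * norm u) \<partial>\<nu>) < \<infinity>"
proof -
  let ?K = "\<integral>\<^sup>+r. ennreal (indicator {0<..} r * (min 1 r * r powr (- \<alpha>))) \<partial>lborel"
  have "(\<integral>\<^sup>+r. ennreal (min 1 (norm (r *\<^sub>R y)) * norm (r *\<^sub>R y)) \<partial>radial_measure \<alpha>) = ?K" if "y \<in> space \<sigma>" for y
  proof -
    have "norm y = 1" using that spherical_component_space[OF spherical] by simp
    have "ennreal (indicator {0<..} r * (1 / r powr (\<alpha> + 1))) * ennreal (min 1 (norm (r *\<^sub>R y)) * norm (r *\<^sub>R y))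
        = ennreal (indicator {0<..} r * (min 1 r * r powr (- \<alpha>)))" for r :: real
      using \<open>norm y = 1\<close> by (cases "0 < r") (auto simp: powr_add powr_minus divide_inverse simp flip: ennreal_mult)
    then show ?thesis
      unfolding radial_measure_def by (subst nn_integral_density) auto
  qed
  note K = this
  have "(\<integral>\<^sup>+u. ennreal (min 1 (norm u) * norm u) \<partial>\<nu>)
      = (\<integral>\<^sup>+y. (\<integral>\<^sup>+r. ennreal (min 1 (norm (r *\<^sub>R y)) * norm (r *\<^sub>R y)) \<partial>radial_measure \<alpha>) \<partial>\<sigma>)"
    by (rule levy_nn_integral_polar) measurable
  also have "\<dots> = (\<integral>\<^sup>+y. ?K \<partial>\<sigma>)"
    by (rule nn_integral_cong) (rule K)
  also have "\<dots> = ?K * emeasure \<sigma> (space \<sigma>)" by simp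
  also have "\<dots> < \<infinity>"
    using nn_integral_min_powr[OF \<alpha>] finite_measure.emeasure_finite[OF finite_sigma, of "space \<sigma>"]
    by (simp add: ennreal_mult_less_top top.not_eq_extremum)
  finally show ?thesis .
qed

lemma levy_integrable: "integrable \<nu> (\<lambda>u. min 1 (norm u) * norm u)"
  using levy_nn_integral_finite by (intro integrableI_nonneg) auto

lemma sigma_finite_levy: "sigma_finite_measure \<nu>"
proof
  \<comment> \<open>The sets with positive index exhaust the punctured space and have finite mass by
    Markov's inequality, the weight being at least \<open>1 / n\<^sup>2\<close> there. Index 0 adds
    the origin, which is null because \<open>r *\<^sub>R y = 0\<close> on the sphere forces
    \<open>r = 0\<close>.\<close>
  define A where "A n = (if n = 0 then {0} else {u::'a. 1 / real n < norm u})" for n :: nat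
  have [measurable]: "A n \<in> sets borel" for n unfolding A_def by auto
  have "emeasure \<nu> (A n) \<noteq> \<infinity>" for n
  proof (cases "n = 0")
    case True
    have "emeasure \<nu> {0} = (\<integral>\<^sup>+y. (\<integral>\<^sup>+r. indicator {0} (r *\<^sub>R y) \<partial>radial_measure \<alpha>) \<partial>\<sigma>)"
      by (rule levy_emeasure_polar) simp
    also have "\<dots> = (\<integral>\<^sup>+y. 0 \<partial>\<sigma>)"
    proof (rule nn_integral_cong)
      fix y assume "y \<in> space \<sigma>"
      then have "y \<noteq> 0" using spherical_component_space[OF spherical] by auto
      then show "(\<integral>\<^sup>+r. indicator {0} (r *\<^sub>R y) \<partial>radial_measure \<alpha>) = 0"
        unfolding radial_measure_def
        by (subst nn_integral_density) (auto simp: indicator_def cong: nn_integral_cong_simp intro!: nn_integral_zero')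
    qed
    finally show ?thesis using True by (simp add: A_def)
  next
    case False
    have "emeasure \<nu> (A n) = (\<integral>\<^sup>+u. indicator (A n) u \<partial>\<nu>)" by simp
    also have "\<dots> \<le> (\<integral>\<^sup>+u. ennreal (real n ^ 2) * ennreal (min 1 (norm u) * norm u) \<partial>\<nu>)"
    proof (rule nn_integral_mono)
      fix u
      show "indicator (A n) u \<le> ennreal (real n ^ 2) * ennreal (min 1 (norm u) * norm u)"
      proof (cases "u \<in> A n")
        case True
        then have "1 / real n \<le> norm u" "1 / real n \<le> min 1 (norm u)" using False by (auto simp: A_def)
        then have "(1 / real n) * (1 / real n) \<le> min 1 (norm u) * norm u"
          by (intro mult_mono) auto
        then have "1 \<le> real n ^ 2 * (min 1 (norm u) * norm u)"
          using False by (simp add: field_simps power2_eq_square)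
        then show ?thesis using True by (simp flip: ennreal_mult)
      qed simp
    qed
    also have "\<dots> = ennreal (real n ^ 2) * (\<integral>\<^sup>+u. ennreal (min 1 (norm u) * norm u) \<partial>\<nu>)"
      by (rule nn_integral_cmult) auto
    also have "\<dots> < \<infinity>" using levy_nn_integral_finite by (simp add: ennreal_mult_less_top)
    finally show ?thesis by simp
  qed
  moreover have "(\<Union>n. A n) = UNIV"
  proof (intro set_eqI iffI UNIV_I)
    fix u :: 'a
    show "u \<in> (\<Union>n. A n)"
    proof (cases "u = 0")
      case True then show ?thesis by (auto simp: A_def intro!: exI[of _ 0])
    next
      case False
      then obtain n where "inverse (real (Suc n)) < norm u" using reals_Archimedean[of "norm u"] by auto
      then have "u \<in> A (Suc n)" by (simp add: A_def inverse_eq_divide)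
      then show ?thesis by blast
    qed
  qed
  ultimately show "\<exists>A. countable A \<and> A \<subseteq> sets \<nu> \<and> \<Union>A = space \<nu> \<and> (\<forall>a\<in>A. emeasure \<nu> a \<noteq> \<infinity>)"
    by (intro exI[of _ "range A"]) auto
qed

lemma levy_uminus: "distr \<nu> borel uminus = \<nu>"
proof (rule measure_eqI)
  fix B assume "B \<in> sets (distr \<nu> borel uminus)"
  then have [measurable]: "B \<in> sets borel" by simp
  note measurable_polar [measurable]
  interpret R: sigma_finite_measure "radial_measure \<alpha>" by (rule sigma_finite_radial_measure)
  define g where "g y = (\<integral>\<^sup>+r. indicator B (r *\<^sub>R y) \<partial>radial_measure \<alpha>)" for y
  have g: "g \<in> borel_measurable \<sigma>" unfolding g_def
    using R.borel_measurable_nn_integral_fst[of "\<lambda>z. indicator B (case z of (y, r) \<Rightarrow> r *\<^sub>R y)" \<sigma>] by simp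
  have "emeasure (distr \<nu> borel uminus) B = emeasure \<nu> (uminus -` B)"
    by (subst emeasure_distr) auto
  also have "\<dots> = (\<integral>\<^sup>+y. (\<integral>\<^sup>+r. indicator (uminus -` B) (r *\<^sub>R y) \<partial>radial_measure \<alpha>) \<partial>\<sigma>)"
    by (rule levy_emeasure_polar) (simp add: measurable_sets_borel[of uminus borel])
  also have "\<dots> = (\<integral>\<^sup>+y. g (- y) \<partial>\<sigma>)"
    by (simp add: g_def indicator_def)
  also have "\<dots> = (\<integral>\<^sup>+y. g y \<partial>distr \<sigma> \<sigma> uminus)"
    using g spherical_component_uminus(2)[OF spherical] by (subst nn_integral_distr) auto
  also have "\<dots> = emeasure \<nu> B"
    by (simp add: spherical_component_uminus(1)[OF spherical] g_def levy_emeasure_polar)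
  finally show "emeasure (distr \<nu> borel uminus) B = emeasure \<nu> B" .
qed simp

text \<open>Reflection turns the integral into its own negative; a non-integrable \<open>h\<close>
  is covered by the default value 0 of the Bochner integral.\<close>

lemma levy_integral_odd:
  fixes h :: "'a \<Rightarrow> real"
  assumes "h \<in> borel_measurable borel" "\<And>u. h (- u) = - h u"
  shows "(LINT u|\<nu>. h u) = 0"
proof -
  have "(LINT u|\<nu>. h u) = (LINT u|distr \<nu> borel uminus. h u)" by (simp only: levy_uminus)
  also have "\<dots> = (LINT u|\<nu>. h (- u))" using assms(1) by (subst integral_distr) auto
  also have "\<dots> = - (LINT u|\<nu>. h u)" by (simp add: assms(2))
  finally show ?thesis by simp
qed

text \<open>For \<open>c > 0\<close> rescaling the radius by \<open>c\<close> gives homogeneity of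
  degree \<open>\<alpha>\<close>. The integrand is even in \<open>c\<close>, and at
  \<open>c = 0\<close> both sides vanish since \<open>0 powr \<alpha> = 0\<close>.\<close>

lemma integral_radial_sin:
  "(LINT r|radial_measure \<alpha>. sin (r * c) * (r * c)) = \<bar>c\<bar> powr \<alpha> * (- cos (\<alpha> * pi / 2) * Gamma (2 - \<alpha>) / (\<alpha> - 1))"
proof -
  have pos: "(LINT r|radial_measure \<alpha>. sin (r * c) * (r * c)) = c powr \<alpha> * (- cos (\<alpha> * pi / 2) * Gamma (2 - \<alpha>) / (\<alpha> - 1))"
    if "0 < c" for c :: real
  proof -
    have "(LINT r|radial_measure \<alpha>. sin (r * c) * (r * c))
        = (LINT r|lborel. (indicator {0<..} r * (1 / r powr (\<alpha> + 1))) * (sin (r * c) * (r * c)))"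
      unfolding radial_measure_def by (subst integral_density) auto
    \<comment> \<open>For \<open>r > 0\<close>, \<open>r powr (- \<alpha> - 1) * (r * c)\<close>
      equals \<open>c powr (\<alpha> + 1) * (c * r) powr (- \<alpha>)\<close>; one of these factors
      \<open>c\<close> is the Jacobian.\<close>
    also have "\<dots> = (LINT r|lborel. (c powr \<alpha> * c) * (indicator {0<..} (0 + c * r) *\<^sub>R ((0 + c * r) powr (- \<alpha>) * sin (0 + c * r))))"
    proof (intro Bochner_Integration.integral_cong refl)
      fix r :: real
      show "(indicator {0<..} r * (1 / r powr (\<alpha> + 1))) * (sin (r * c) * (r * c))
          = (c powr \<alpha> * c) * (indicator {0<..} (0 + c * r) *\<^sub>R ((0 + c * r) powr (- \<alpha>) * sin (0 + c * r)))"
        using that by (cases "0 < r")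
          (auto simp: powr_mult powr_add powr_minus field_simps zero_less_mult_iff indicator_def)
    qed
    also have "\<dots> = c powr \<alpha> * (\<bar>c\<bar> *\<^sub>R (LINT r|lborel. indicator {0<..} (0 + c * r) *\<^sub>R ((0 + c * r) powr (- \<alpha>) * sin (0 + c * r))))"
      using that by simp
    also have "\<bar>c\<bar> *\<^sub>R (LINT r|lborel. indicator {0<..} (0 + c * r) *\<^sub>R ((0 + c * r) powr (- \<alpha>) * sin (0 + c * r)))
        = (LINT r:{0<..}|lborel. r powr (- \<alpha>) * sin r)"
      unfolding set_lebesgue_integral_def using that by (subst (2) lborel_integral_real_affine[of c _ 0]) auto
    finally show ?thesis unfolding integral_powr_sin(2)[OF \<alpha>] .
  qed
  consider "c = 0" | "0 < c" | "c < 0" by linarith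
  then show ?thesis
  proof cases
    case 3
    then show ?thesis using pos[of "- c"] by simp
  qed (use pos in auto)
qed

lemma levy_integrable_bound:
  fixes h :: "'a \<Rightarrow> 'b::{banach, second_countable_topology}"
  assumes [measurable]: "h \<in> borel_measurable borel" and "\<And>u. norm (h u) \<le> C * (min 1 (norm u) * norm u)"
  shows "integrable \<nu> h"
  by (rule Bochner_Integration.integrable_bound[OF integrable_mult_right[OF levy_integrable, of C]])
    (use assms(2) in \<open>auto intro: order_trans[OF _ abs_ge_self]\<close>)

lemma abs_sin_inner_le: "\<bar>sin (u \<bullet> \<xi>)\<bar> \<le> (1 + norm \<xi>) * min 1 (norm u)" for u \<xi> :: 'a
proof -
  have "\<bar>sin (u \<bullet> \<xi>)\<bar> \<le> norm \<xi> * norm u"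
    using abs_sin_x_le_abs_x[of "u \<bullet> \<xi>"] Cauchy_Schwarz_ineq2[of u \<xi>] by (simp add: mult.commute)
  moreover have "norm \<xi> * norm u \<le> (1 + norm \<xi>) * norm u" by (intro mult_right_mono) auto
  moreover have "\<bar>sin (u \<bullet> \<xi>)\<bar> \<le> 1 + norm \<xi>"
    using abs_sin_le_one[of "u \<bullet> \<xi>"] norm_ge_zero[of \<xi>] by linarith
  ultimately show ?thesis
    by (cases "norm u \<le> 1") (simp_all add: min_def)
qed

lemma levy_integrable_sin: "integrable \<nu> (\<lambda>u. sin (u \<bullet> \<xi>) *\<^sub>R u)"
proof (rule levy_integrable_bound)
  show "norm (sin (u \<bullet> \<xi>) *\<^sub>R u) \<le> (1 + norm \<xi>) * (min 1 (norm u) * norm u)" for u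
    using mult_right_mono[OF abs_sin_inner_le[of u \<xi>], of "norm u"] by (simp add: mult.assoc)
qed measurable

text \<open>The drift vector \<open>\<integral> sin (u \<bullet> \<xi>) u d\<nu>\<close> is, up to sign, \<open>\<i>\<close> times the Fourier symbol of the
  fractional gradient; this is the homogeneity relation between it and the symbol of the generator.\<close>

lemma levy_integral_sin_inner:
  assumes lam: "lam = spectral_measure \<alpha> \<sigma>"
  shows "(LINT u|\<nu>. sin (u \<bullet> \<xi>) *\<^sub>R u) \<bullet> \<xi> = \<alpha> * stable_scale \<alpha> lam \<xi> powr \<alpha>"
proof -
  define k where "k = - cos (\<alpha> * pi / 2) * (Gamma (2 - \<alpha>) / (\<alpha> * (\<alpha> - 1)))"
  have k: "\<alpha> * k = - cos (\<alpha> * pi / 2) * Gamma (2 - \<alpha>) / (\<alpha> - 1)" using \<alpha> by (simp add: k_def)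
  \<comment> \<open>The factor enters \<open>spectral_measure\<close> through
    \<open>ennreal\<close>, which sends negative numbers to 0. It is nonnegative because
    \<open>\<alpha> * pi / 2\<close> lies between \<open>pi / 2\<close> and \<open>pi\<close>, where
    the cosine is negative.\<close>
  have "0 < cos (pi - \<alpha> * pi / 2)" using \<alpha> by (intro cos_gt_zero_pi) (auto simp: field_simps)
  then have "cos (\<alpha> * pi / 2) < 0" by (simp add: cos_diff)
  moreover have "0 < Gamma (2 - \<alpha>)" using \<alpha> by (intro Gamma_real_pos) auto
  ultimately have k0: "0 \<le> k" using \<alpha>
    by (auto simp: k_def intro!: divide_nonpos_pos mult_nonpos_nonneg)
  note spherical_component_measurable[OF spherical, measurable]
  define I where "I = (LINT y|\<sigma>. \<bar>y \<bullet> \<xi>\<bar> powr \<alpha>)"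
  have m: "(\<lambda>y. \<bar>y \<bullet> \<xi>\<bar> powr \<alpha>) \<in> borel_measurable \<sigma>" by measurable
  have m': "(\<lambda>y. \<bar>y \<bullet> \<xi>\<bar> powr \<alpha>) \<in> borel_measurable lam"
    using m by (simp add: lam spectral_measure_def measurable_cong_sets[OF sets_scale_measure refl])
  have "(LINT y|lam. \<bar>y \<bullet> \<xi>\<bar> powr \<alpha>) = enn2real (\<integral>\<^sup>+y. ennreal (\<bar>y \<bullet> \<xi>\<bar> powr \<alpha>) \<partial>lam)"
    by (rule integral_eq_nn_integral[OF m']) simp
  also have "\<dots> = enn2real (ennreal k * (\<integral>\<^sup>+y. ennreal (\<bar>y \<bullet> \<xi>\<bar> powr \<alpha>) \<partial>\<sigma>))"
    using m by (simp add: lam spectral_measure_def nn_integral_scale_measure k_def)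
  also have "\<dots> = k * I"
    unfolding I_def integral_eq_nn_integral[OF m AE_I2, simplified] using k0 by (simp add: enn2real_mult)
  finally have L: "(LINT y|lam. \<bar>y \<bullet> \<xi>\<bar> powr \<alpha>) = k * I" .
  have I0: "0 \<le> I" unfolding I_def by simp
  have "(LINT u|\<nu>. sin (u \<bullet> \<xi>) *\<^sub>R u) \<bullet> \<xi> = (LINT u|\<nu>. (sin (u \<bullet> \<xi>) *\<^sub>R u) \<bullet> \<xi>)"
    by (rule integral_inner_left[symmetric]) (rule levy_integrable_sin)
  also have "\<dots> = (LINT y|\<sigma>. (LINT r|radial_measure \<alpha>. ((sin ((r *\<^sub>R y) \<bullet> \<xi>) *\<^sub>R (r *\<^sub>R y)) \<bullet> \<xi>)))"
    by (rule levy_integral_polar) (intro integrable_inner_left levy_integrable_sin)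
  also have "\<dots> = (LINT y|\<sigma>. (LINT r|radial_measure \<alpha>. sin (r * (y \<bullet> \<xi>)) * (r * (y \<bullet> \<xi>))))"
    by (simp only: inner_scaleR_left)
  \<comment> \<open>Each direction contributes the radial constant \<open>\<alpha> * k\<close>,
    while \<open>lam\<close> carries only \<open>k\<close>: the origin of the factor
    \<open>\<alpha>\<close>.\<close>
  also have "\<dots> = I * (\<alpha> * k)"
    unfolding integral_radial_sin k[symmetric] I_def by (rule integral_mult_left_zero)
  also have "\<dots> = \<alpha> * stable_scale \<alpha> lam \<xi> powr \<alpha>"
    unfolding stable_scale_def L using \<alpha> k0 I0 by (simp add: powr_powr)
  finally show ?thesis .
qed

end

section \<open>Gaussian kernels on Euclidean space\<close>

lemma
  fixes F :: "'a::euclidean_space \<Rightarrow> real \<Rightarrow> 'b::{real_normed_field, banach, second_countable_topology}"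
  assumes F: "\<And>b. b \<in> Basis \<Longrightarrow> integrable lborel (F b)"
  shows lborel_integrable_prod: "integrable lborel (\<lambda>x::'a. \<Prod>b\<in>Basis. F b (x \<bullet> b))"
    and lborel_integral_prod: "(LINT x|lborel. (\<Prod>b\<in>Basis. F b (x \<bullet> b))) = (\<Prod>b\<in>Basis. LINT t|lborel. F b t)"
proof -
  interpret P: product_sigma_finite "\<lambda>_::'a. lborel :: real measure" ..
  have [measurable]: "\<And>b. b \<in> Basis \<Longrightarrow> F b \<in> borel_measurable borel"
    using F by (auto dest!: borel_measurable_integrable)
  have [measurable]: "(\<lambda>x::'a. \<Prod>b\<in>Basis. F b (x \<bullet> b)) \<in> borel_measurable borel"
    by (intro borel_measurable_prod) (auto intro!: measurable_compose[OF borel_measurable_inner])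
  have eq: "(\<Prod>b\<in>Basis. F b ((\<Sum>b\<in>Basis. f b *\<^sub>R b) \<bullet> b)) = (\<Prod>b\<in>Basis. F b (f b))" for f
    by (intro prod.cong refl) simp
  have "integrable (\<Pi>\<^sub>M b\<in>Basis. lborel) (\<lambda>f. \<Prod>b\<in>Basis. F b (f b))"
    by (intro P.product_integrable_prod F) auto
  then show "integrable lborel (\<lambda>x::'a. \<Prod>b\<in>Basis. F b (x \<bullet> b))"
    by (subst lborel_eq) (simp add: integrable_distr_eq eq)
  have "(LINT x|lborel. (\<Prod>b\<in>Basis. F b (x \<bullet> b))) = (LINT f|(\<Pi>\<^sub>M b\<in>Basis. lborel). (\<Prod>b\<in>Basis. F b (f b)))"
    by (subst lborel_eq) (simp add: integral_distr eq)
  also have "\<dots> = (\<Prod>b\<in>Basis. LINT t|lborel. F b t)"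
    by (intro P.product_integral_prod F) auto
  finally show "(LINT x|lborel. (\<Prod>b\<in>Basis. F b (x \<bullet> b))) = (\<Prod>b\<in>Basis. LINT t|lborel. F b t)" .
qed

lemma norm_power2_Basis: "(norm x)\<^sup>2 = (\<Sum>b\<in>Basis. (x \<bullet> b)\<^sup>2)"
  for x :: "'a::euclidean_space"
proof -
  have "(norm x)\<^sup>2 = x \<bullet> x" by (rule power2_norm_eq_inner)
  also have "\<dots> = (\<Sum>b\<in>Basis. (x \<bullet> b)\<^sup>2)"
    by (subst euclidean_inner) (simp only: power2_eq_square)
  finally show ?thesis .
qed

text \<open>The standard Gaussian density in product form, so that integrals factor over
  coordinates; \<open>gauss_eq\<close> recovers the radial form.\<close>

definition gauss :: "'a::euclidean_space \<Rightarrow> real" where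
  "gauss x = (\<Prod>b\<in>Basis. std_normal_density (x \<bullet> b))"

lemma gauss_pos: "0 < gauss x"
  unfolding gauss_def by (intro prod_pos normal_density_pos) auto

lemma borel_measurable_gauss [measurable]: "gauss \<in> borel_measurable borel"
  unfolding gauss_def by measurable

lemma gauss_eq: "gauss x = (1 / sqrt (2 * pi)) ^ DIM('a) * exp (- (norm x)\<^sup>2 / 2)"
  for x :: "'a::euclidean_space"
proof -
  have "exp (- (norm x)\<^sup>2 / 2) = (\<Prod>b\<in>Basis. exp (- (x \<bullet> b)\<^sup>2 / 2))"
    by (simp add: norm_power2_Basis exp_sum[symmetric] sum_negf sum_divide_distrib[symmetric])
  then show ?thesis
    by (simp add: gauss_def std_normal_density_def prod_dividef power_one_over)
qed

lemma integrable_gauss: "integrable lborel (gauss :: 'a::euclidean_space \<Rightarrow> real)"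
  unfolding gauss_def by (rule lborel_integrable_prod) simp

lemma integrable_norm_gauss: "integrable lborel (\<lambda>x::'a::euclidean_space. norm x * gauss x)"
proof (rule Bochner_Integration.integrable_bound)
  \<comment> \<open>One coordinate factor is replaced by its absolute first moment; summing over
    \<open>c\<close> dominates the norm.\<close>
  let ?F = "\<lambda>c b t. if b = c then std_normal_density t * \<bar>t\<bar> ^ 1 else std_normal_density t"
  have eq: "\<bar>x \<bullet> c\<bar> * gauss x = (\<Prod>b\<in>Basis. ?F c b (x \<bullet> b))" if "c \<in> Basis" for c x :: 'a
  proof -
    have "(\<Prod>b\<in>Basis. ?F c b (x \<bullet> b)) = (\<Prod>b\<in>Basis. (if b = c then \<bar>x \<bullet> b\<bar> else 1) * std_normal_density (x \<bullet> b))"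
      by (intro prod.cong refl) auto
    also have "\<dots> = \<bar>x \<bullet> c\<bar> * gauss x"
      using that by (simp add: prod.distrib gauss_def)
    finally show ?thesis ..
  qed
  have "integrable lborel (?F c b)" for b c :: 'a
    by (cases "b = c") (use integrable_std_normal_moment_abs[of 1] in simp_all)
  then have int: "integrable lborel (\<lambda>x::'a. \<Prod>b\<in>Basis. ?F c b (x \<bullet> b))" for c
    by (rule lborel_integrable_prod)
  have "integrable lborel (\<lambda>x::'a. \<bar>x \<bullet> c\<bar> * gauss x)" if "c \<in> Basis" for c
    unfolding eq[OF that] by (rule int)
  then show "integrable lborel (\<lambda>x::'a. \<Sum>c\<in>Basis. \<bar>x \<bullet> c\<bar> * gauss x)" by simp
  show "AE x::'a in lborel. norm (norm x * gauss x) \<le> norm (\<Sum>c\<in>Basis. \<bar>x \<bullet> c\<bar> * gauss x)"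
  proof (rule AE_I2)
    fix x :: 'a
    have "norm x * gauss x \<le> (\<Sum>c\<in>Basis. \<bar>x \<bullet> c\<bar>) * gauss x"
      by (intro mult_right_mono norm_le_l1 less_imp_le gauss_pos)
    then show "norm (norm x * gauss x) \<le> norm (\<Sum>c\<in>Basis. \<bar>x \<bullet> c\<bar> * gauss x)"
      using gauss_pos[of x] by (simp add: abs_mult sum_distrib_right)
  qed
qed measurable

text \<open>The self-duality of the Gaussian under the Fourier transform, one coordinate at a time.
  It presents a Gaussian bump as a mixture of plane waves.\<close>

lemma integral_gauss_cos:
  fixes v :: "'a::euclidean_space"
  shows "(LINT \<xi>|lborel. gauss \<xi> * cos (v \<bullet> \<xi>)) = exp (- (norm v)\<^sup>2 / 2)"
proof -
  let ?F = "\<lambda>b t. std_normal_density t *\<^sub>R iexp ((v \<bullet> b) * t)"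
  have int: "integrable lborel (?F b)" for b
    by (rule Bochner_Integration.integrable_bound[OF integrable_normal_density[of 1 0]])
      (auto simp: norm_mult)
  have val: "(LINT t|lborel. ?F b t) = of_real (exp (- (v \<bullet> b)\<^sup>2 / 2))" for b
  proof -
    have "(LINT t|lborel. ?F b t) = char std_normal_distribution (v \<bullet> b)"
      unfolding char_def by (subst integral_density) (auto simp: mult_ac)
    then show ?thesis by (simp add: char_std_normal_distribution)
  qed
  have prod: "(\<Prod>b\<in>Basis. ?F b (\<xi> \<bullet> b)) = of_real (gauss \<xi>) * iexp (v \<bullet> \<xi>)" for \<xi>
  proof -
    have "(\<Prod>b\<in>Basis. ?F b (\<xi> \<bullet> b)) = of_real (gauss \<xi>) * (\<Prod>b\<in>Basis. iexp ((v \<bullet> b) * (\<xi> \<bullet> b)))"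
      by (simp add: scaleR_conv_of_real prod.distrib gauss_def)
    also have "(\<Prod>b\<in>Basis. iexp ((v \<bullet> b) * (\<xi> \<bullet> b))) = iexp (v \<bullet> \<xi>)"
      by (simp add: exp_sum[symmetric] euclidean_inner[of v \<xi>] sum_distrib_left)
    finally show ?thesis .
  qed
  have "integrable lborel (\<lambda>\<xi>::'a. \<Prod>b\<in>Basis. ?F b (\<xi> \<bullet> b))"
    by (rule lborel_integrable_prod) (rule int)
  then have int': "integrable lborel (\<lambda>\<xi>. of_real (gauss \<xi>) * iexp (v \<bullet> \<xi>))"
    by (simp only: prod)
  have "(LINT \<xi>|lborel. gauss \<xi> * cos (v \<bullet> \<xi>)) = (LINT \<xi>|lborel. Re (of_real (gauss \<xi>) * iexp (v \<bullet> \<xi>)))"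
    by (intro Bochner_Integration.integral_cong refl) (simp add: Re_exp)
  also have "\<dots> = Re (LINT \<xi>|lborel. of_real (gauss \<xi>) * iexp (v \<bullet> \<xi>))"
    by (rule integral_Re[OF int'])
  also have "(LINT \<xi>|lborel. of_real (gauss \<xi>) * iexp (v \<bullet> \<xi>)) = (\<Prod>b\<in>Basis. LINT t|lborel. ?F b t)"
    unfolding prod[symmetric] by (rule lborel_integral_prod) (rule int)
  also have "\<dots> = of_real (\<Prod>b\<in>Basis. exp (- (v \<bullet> b)\<^sup>2 / 2))"
    by (simp only: val of_real_prod)
  also have "(\<Prod>b\<in>Basis. exp (- (v \<bullet> b)\<^sup>2 / 2)) = exp (- (norm v)\<^sup>2 / 2)"
    by (simp add: exp_sum[symmetric] sum_negf sum_divide_distrib[symmetric]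
        norm_power2_Basis)
  finally show ?thesis by simp
qed

section \<open>Pairings with increments\<close>

lemma integrable_pair_mult:
  fixes f :: "'x \<Rightarrow> real" and g :: "'y \<Rightarrow> real"
  assumes "sigma_finite_measure M" "sigma_finite_measure N"
    and f: "integrable M f" and g: "integrable N g"
  shows "integrable (M \<Otimes>\<^sub>M N) (\<lambda>(x, y). f x * g y)"
proof -
  interpret M: sigma_finite_measure M by fact
  interpret N: sigma_finite_measure N by fact
  interpret MN: pair_sigma_finite M N ..
  have [measurable]: "f \<in> borel_measurable M" "g \<in> borel_measurable N" using f g by auto
  show ?thesis
  proof (rule MN.Fubini_integrable)
    show "integrable M (\<lambda>x. LINT y|N. norm (case (x, y) of (x, y) \<Rightarrow> f x * g y))"
      using f by (simp add: abs_mult)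
  qed (use g in auto)
qed

text \<open>A common form for the two sides of the representation formula: the semigroup increment
  moves \<open>x\<close> to \<open>x + R y\<close> with weight 1, the generator side moves
  \<open>x + r y\<close> by \<open>u\<close> with a signed weight.\<close>

definition increment_pairing :: "'w measure \<Rightarrow> ('w \<Rightarrow> 'a) \<Rightarrow> ('w \<Rightarrow> 'a) \<Rightarrow> ('w \<Rightarrow> real) \<Rightarrow> ('a::euclidean_space \<Rightarrow> real) \<Rightarrow> real" where
  "increment_pairing M a b w f = (LINT \<omega>|M. (f (a \<omega>) - f (b \<omega>)) * w \<omega>)"

text \<open>The condition under which bounded Lipschitz functions can be paired. Neither
  \<open>M\<close> nor \<open>w\<close> need be finite or integrable, as small displacements
  compensate.\<close>

definition admissible_pairing :: "'w measure \<Rightarrow> ('w \<Rightarrow> 'a::euclidean_space) \<Rightarrow> ('w \<Rightarrow> 'a) \<Rightarrow> ('w \<Rightarrow> real) \<Rightarrow> bool" where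
  "admissible_pairing M a b w \<longleftrightarrow> sigma_finite_measure M \<and> a \<in> borel_measurable M \<and> b \<in> borel_measurable M
     \<and> w \<in> borel_measurable M \<and> integrable M (\<lambda>\<omega>. min 1 (norm (a \<omega> - b \<omega>)) * w \<omega>)"

text \<open>Fubini with a dominating function that factors into a part in the pairing and a part in
  \<open>l\<close>. The constant \<open>C l\<close> varies with \<open>l\<close> because the
  Lipschitz constant of a wave grows with its frequency.\<close>

lemma increment_pairing_mixture:
  fixes g :: "'l \<Rightarrow> 'a::euclidean_space \<Rightarrow> real"
  assumes adm: "admissible_pairing M a b w" and L: "sigma_finite_measure L"
    and [measurable]: "case_prod g \<in> borel_measurable (L \<Otimes>\<^sub>M borel)" "k \<in> borel_measurable L"
    and bound: "\<And>l x y. \<bar>g l x - g l y\<bar> \<le> C l * min 1 (norm (x - y))"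
    and C: "integrable L (\<lambda>l. k l * C l)" and int: "\<And>x. integrable L (\<lambda>l. k l * g l x)"
  shows "increment_pairing M a b w (\<lambda>x. LINT l|L. k l * g l x) = (LINT l|L. k l * increment_pairing M a b w (g l))"
proof -
  interpret M: sigma_finite_measure M using adm by (simp add: admissible_pairing_def)
  interpret L: sigma_finite_measure L by fact
  interpret WL: pair_sigma_finite M L ..
  have [measurable]: "a \<in> borel_measurable M" "b \<in> borel_measurable M" "w \<in> borel_measurable M"
    and iw: "integrable M (\<lambda>\<omega>. min 1 (norm (a \<omega> - b \<omega>)) * w \<omega>)"
    using adm by (auto simp: admissible_pairing_def)
  define H where "H \<omega> l = k l * ((g l (a \<omega>) - g l (b \<omega>)) * w \<omega>)" for \<omega> l
  have ga: "(\<lambda>(\<omega>, l). g l (a \<omega>)) \<in> borel_measurable (M \<Otimes>\<^sub>M L)"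
    "(\<lambda>(\<omega>, l). g l (b \<omega>)) \<in> borel_measurable (M \<Otimes>\<^sub>M L)"
    using measurable_compose[of "\<lambda>(\<omega>, l). (l, a \<omega>)" "M \<Otimes>\<^sub>M L" "L \<Otimes>\<^sub>M borel" "case_prod g" borel]
      measurable_compose[of "\<lambda>(\<omega>, l). (l, b \<omega>)" "M \<Otimes>\<^sub>M L" "L \<Otimes>\<^sub>M borel" "case_prod g" borel]
    by (simp_all add: split_beta')
  have [measurable]: "case_prod H \<in> borel_measurable (M \<Otimes>\<^sub>M L)"
    using ga unfolding H_def split_beta' by measurable
  have I: "integrable (M \<Otimes>\<^sub>M L) (case_prod H)"
  proof (rule Bochner_Integration.integrable_bound)
    show "integrable (M \<Otimes>\<^sub>M L) (\<lambda>(\<omega>, l). (min 1 (norm (a \<omega> - b \<omega>)) * w \<omega>) * (k l * C l))"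
      by (intro integrable_pair_mult iw C) unfold_locales
    have "\<bar>H \<omega> l\<bar> \<le> \<bar>(min 1 (norm (a \<omega> - b \<omega>)) * w \<omega>) * (k l * C l)\<bar>" for \<omega> l
    proof -
      have "\<bar>H \<omega> l\<bar> = \<bar>g l (a \<omega>) - g l (b \<omega>)\<bar> * (\<bar>w \<omega>\<bar> * \<bar>k l\<bar>)"
        by (simp add: H_def abs_mult mult_ac)
      also have "\<dots> \<le> \<bar>C l * min 1 (norm (a \<omega> - b \<omega>))\<bar> * (\<bar>w \<omega>\<bar> * \<bar>k l\<bar>)"
        by (intro mult_right_mono order_trans[OF bound abs_ge_self]) auto
      also have "\<dots> = \<bar>(min 1 (norm (a \<omega> - b \<omega>)) * w \<omega>) * (k l * C l)\<bar>"
        by (simp add: abs_mult mult_ac)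
      finally show ?thesis .
    qed
    then show "AE x in M \<Otimes>\<^sub>M L. norm (case_prod H x)
        \<le> norm (case x of (\<omega>, l) \<Rightarrow> (min 1 (norm (a \<omega> - b \<omega>)) * w \<omega>) * (k l * C l))"
      by (intro AE_I2) (auto simp: split_beta')
  qed measurable
  have "increment_pairing M a b w (\<lambda>x. LINT l|L. k l * g l x) = (LINT \<omega>|M. (LINT l|L. H \<omega> l))"
  proof -
    have "((LINT l|L. k l * g l (a \<omega>)) - (LINT l|L. k l * g l (b \<omega>))) * w \<omega> = (LINT l|L. H \<omega> l)" for \<omega>
    proof -
      have "((LINT l|L. k l * g l (a \<omega>)) - (LINT l|L. k l * g l (b \<omega>))) * w \<omega>
          = (LINT l|L. (k l * g l (a \<omega>) - k l * g l (b \<omega>)) * w \<omega>)"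
        by (simp add: int)
      also have "\<dots> = (LINT l|L. H \<omega> l)"
        by (intro Bochner_Integration.integral_cong refl) (simp add: H_def algebra_simps)
      finally show ?thesis .
    qed
    then show ?thesis by (simp add: increment_pairing_def)
  qed
  also have "\<dots> = (LINT l|L. (LINT \<omega>|M. H \<omega> l))"
    by (rule WL.Fubini_integral[OF I, symmetric])
  also have "\<dots> = (LINT l|L. k l * increment_pairing M a b w (g l))"
    by (simp add: H_def increment_pairing_def)
  finally show ?thesis .
qed

lemma increment_pairing_tendsto:
  fixes f :: "'a::euclidean_space \<Rightarrow> real" and h :: "nat \<Rightarrow> 'a \<Rightarrow> real"
  assumes adm: "admissible_pairing M a b w"
    and h: "\<And>x. (\<lambda>n. h n x) \<longlonglongrightarrow> f x"
    and bound: "\<And>n x y. \<bar>h n x - h n y\<bar> \<le> C * min 1 (norm (x - y))"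
    and [measurable]: "f \<in> borel_measurable borel" "\<And>n. h n \<in> borel_measurable borel"
  shows "(\<lambda>n. increment_pairing M a b w (h n)) \<longlonglongrightarrow> increment_pairing M a b w f"
  unfolding increment_pairing_def
proof (rule integral_dominated_convergence)
  have [measurable]: "a \<in> borel_measurable M" "b \<in> borel_measurable M" "w \<in> borel_measurable M"
    and iw: "integrable M (\<lambda>\<omega>. min 1 (norm (a \<omega> - b \<omega>)) * w \<omega>)"
    using adm by (auto simp: admissible_pairing_def)
  show "integrable M (\<lambda>\<omega>. C * \<bar>min 1 (norm (a \<omega> - b \<omega>)) * w \<omega>\<bar>)"
    using iw by auto
  show "AE \<omega> in M. (\<lambda>n. (h n (a \<omega>) - h n (b \<omega>)) * w \<omega>) \<longlonglongrightarrow> (f (a \<omega>) - f (b \<omega>)) * w \<omega>"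
    by (intro AE_I2 tendsto_intros h)
  show "AE \<omega> in M. norm ((h n (a \<omega>) - h n (b \<omega>)) * w \<omega>) \<le> C * \<bar>min 1 (norm (a \<omega> - b \<omega>)) * w \<omega>\<bar>" for n
    using mult_right_mono[OF bound] by (auto simp: abs_mult mult.assoc[symmetric])
  show "(\<lambda>\<omega>. (f (a \<omega>) - f (b \<omega>)) * w \<omega>) \<in> borel_measurable M" by measurable
  show "(\<lambda>\<omega>. (h n (a \<omega>) - h n (b \<omega>)) * w \<omega>) \<in> borel_measurable M" for n by measurable
qed

text \<open>The phase \<open>\<theta>\<close> covers cosine waves, sine waves and waves recentred at
  another point together.\<close>

lemma abs_cos_diff_le:
  fixes x y \<xi> :: "'a::euclidean_space"
  shows "\<bar>cos (x \<bullet> \<xi> - \<theta>) - cos (y \<bullet> \<xi> - \<theta>)\<bar> \<le> (2 + norm \<xi>) * min 1 (norm (x - y))"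
proof -
  have lip: "\<bar>cos s - cos t\<bar> \<le> \<bar>s - t\<bar>" for s t :: real
  proof -
    have "norm (cos s - cos t) \<le> 1 * norm (s - t)"
      by (rule field_differentiable_bound[where S=UNIV and f'="\<lambda>x. - sin x"])
        (auto intro!: derivative_eq_intros)
    then show ?thesis by simp
  qed
  have 1: "\<bar>cos (x \<bullet> \<xi> - \<theta>) - cos (y \<bullet> \<xi> - \<theta>)\<bar> \<le> norm \<xi> * norm (x - y)"
  proof -
    have "\<bar>cos (x \<bullet> \<xi> - \<theta>) - cos (y \<bullet> \<xi> - \<theta>)\<bar> \<le> \<bar>(x - y) \<bullet> \<xi>\<bar>"
      using lip[of "x \<bullet> \<xi> - \<theta>" "y \<bullet> \<xi> - \<theta>"] by (simp add: inner_diff_left)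
    also have "\<dots> \<le> norm \<xi> * norm (x - y)"
      using Cauchy_Schwarz_ineq2[of "x - y" \<xi>] by (simp add: mult.commute)
    finally show ?thesis .
  qed
  have 2: "\<bar>cos (x \<bullet> \<xi> - \<theta>) - cos (y \<bullet> \<xi> - \<theta>)\<bar> \<le> 2"
    using abs_triangle_ineq4[of "cos (x \<bullet> \<xi> - \<theta>)" "cos (y \<bullet> \<xi> - \<theta>)"]
      abs_cos_le_one[of "x \<bullet> \<xi> - \<theta>"] abs_cos_le_one[of "y \<bullet> \<xi> - \<theta>"] by linarith
  show ?thesis
  proof (cases "norm (x - y) \<le> 1")
    case True
    have "norm \<xi> * norm (x - y) \<le> (2 + norm \<xi>) * norm (x - y)"
      by (intro mult_right_mono) auto
    with 1 True show ?thesis by (simp add: min_def)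
  next
    case False
    then have "min 1 (norm (x - y)) = 1" by simp
    then show ?thesis using 2 norm_ge_zero[of \<xi>] by (simp del: norm_ge_zero)
  qed
qed

text \<open>The agreement on plane waves passes to Gaussians by Fourier inversion, then to Gaussian mollifications,
  and finally to \<open>f\<close> by dominated convergence.\<close>

lemma increment_pairing_eqI:
  fixes f :: "'a::euclidean_space \<Rightarrow> real"
  assumes adm: "admissible_pairing M a b w" "admissible_pairing M' a' b' w'"
    and waves: "\<And>\<xi> \<theta>. increment_pairing M a b w (\<lambda>x. cos (x \<bullet> \<xi> - \<theta>)) = increment_pairing M' a' b' w' (\<lambda>x. cos (x \<bullet> \<xi> - \<theta>))"
    and f: "integrable lborel f" "\<And>x. \<bar>f x\<bar> \<le> K" "\<And>x y. \<bar>f x - f y\<bar> \<le> B * norm (x - y)"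
  shows "increment_pairing M a b w f = increment_pairing M' a' b' w' f"
proof -
  have [measurable]: "f \<in> borel_measurable borel" using f(1) by simp
  have ig: "integrable lborel (\<lambda>\<xi>::'a. gauss \<xi> * (2 + norm (s *\<^sub>R \<xi>)))" for s
  proof -
    have "integrable lborel (\<lambda>\<xi>::'a. 2 * gauss \<xi> + \<bar>s\<bar> * (norm \<xi> * gauss \<xi>))"
      by (intro Bochner_Integration.integrable_add integrable_mult_right integrable_gauss integrable_norm_gauss)
    then show ?thesis by (simp add: algebra_simps)
  qed
  have igc: "integrable lborel (\<lambda>\<xi>::'a. gauss \<xi> * cos (x \<bullet> (s *\<^sub>R \<xi>) - z \<bullet> (s *\<^sub>R \<xi>)))" for s x z
    by (rule Bochner_Integration.integrable_bound[OF integrable_gauss])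
      (auto simp: abs_mult intro!: AE_I2 mult_left_le)
  \<comment> \<open>An unnormalised Gaussian bump around \<open>z\<close>, of width
    \<open>1 / s\<close> for \<open>s > 0\<close>; by \<open>integral_gauss_cos\<close> it is a
    mixture of waves recentred at \<open>z\<close>.\<close>
  define E where "E s z x = exp (- (norm (s *\<^sub>R (x - z)))\<^sup>2 / 2)" for s :: real and z x :: 'a
  have E: "E s z x = (LINT \<xi>|lborel. gauss \<xi> * cos (x \<bullet> (s *\<^sub>R \<xi>) - z \<bullet> (s *\<^sub>R \<xi>)))" for s z x
    unfolding E_def integral_gauss_cos[symmetric] by (simp add: inner_diff_left algebra_simps)
  have mixE: "increment_pairing N c d v (E s z) =
      (LINT \<xi>|lborel. gauss \<xi> * increment_pairing N c d v (\<lambda>x. cos (x \<bullet> (s *\<^sub>R \<xi>) - z \<bullet> (s *\<^sub>R \<xi>))))"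
    if "admissible_pairing N c d v" for N :: "'z measure" and c d v s z
    unfolding E[abs_def]
    by (rule increment_pairing_mixture[OF that sigma_finite_lborel _ _ abs_cos_diff_le ig igc]) measurable
  have PE: "increment_pairing M a b w (E s z) = increment_pairing M' a' b' w' (E s z)" for s z
    unfolding mixE[OF adm(1)] mixE[OF adm(2)] waves ..
  define C where "C s = (LINT \<xi>::'a|lborel. gauss \<xi> * (2 + norm (s *\<^sub>R \<xi>)))" for s
  have EC: "\<bar>E s z x - E s z y\<bar> \<le> C s * min 1 (norm (x - y))" for s z x y
  proof -
    let ?c = "\<lambda>x \<xi>. cos (x \<bullet> (s *\<^sub>R \<xi>) - z \<bullet> (s *\<^sub>R \<xi>))"
    have "\<bar>E s z x - E s z y\<bar> = \<bar>LINT \<xi>|lborel. gauss \<xi> * (?c x \<xi> - ?c y \<xi>)\<bar>"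
      unfolding E by (simp only: Bochner_Integration.integral_diff[OF igc igc, symmetric] right_diff_distrib)
    also have "\<dots> \<le> (LINT \<xi>::'a|lborel. (gauss \<xi> * (2 + norm (s *\<^sub>R \<xi>))) * min 1 (norm (x - y)))"
    proof (rule integral_abs_bound_integral)
      show "integrable lborel (\<lambda>\<xi>. gauss \<xi> * (?c x \<xi> - ?c y \<xi>))"
        unfolding right_diff_distrib by (intro Bochner_Integration.integrable_diff igc)
      show "integrable lborel (\<lambda>\<xi>::'a. (gauss \<xi> * (2 + norm (s *\<^sub>R \<xi>))) * min 1 (norm (x - y)))"
        by (intro integrable_mult_left ig)
      show "\<bar>gauss \<xi> * (?c x \<xi> - ?c y \<xi>)\<bar> \<le> (gauss \<xi> * (2 + norm (s *\<^sub>R \<xi>))) * min 1 (norm (x - y))" for \<xi>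
        unfolding abs_mult abs_of_pos[OF gauss_pos] mult.assoc
        by (intro mult_left_mono abs_cos_diff_le less_imp_le[OF gauss_pos])
    qed
    also have "\<dots> = C s * min 1 (norm (x - y))"
      unfolding C_def by (rule integral_mult_left_zero)
    finally show ?thesis .
  qed
  \<comment> \<open>A mixture of bumps with signed weight \<open>f z\<close>. The constant
    \<open>C s\<close> in \<open>EC\<close> does not depend on \<open>z\<close>, so integrability of
    \<open>f\<close> justifies the swap.\<close>
  define F where "F s x = (LINT z|lborel. f z * E s z x)" for s x
  have [measurable]: "case_prod (E s) \<in> borel_measurable (lborel \<Otimes>\<^sub>M borel)" for s
    unfolding E_def by measurable
  have E1: "\<bar>E s z x\<bar> \<le> 1" for s z x by (simp add: E_def)
  have iE: "integrable lborel (\<lambda>z. f z * E s z x)" for s x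
    by (rule Bochner_Integration.integrable_bound[OF f(1)])
      (use E1 in \<open>auto simp: abs_mult E_def intro!: AE_I2 mult_left_le\<close>)
  have mixF: "increment_pairing N c d v (F s) = (LINT z|lborel. f z * increment_pairing N c d v (E s z))"
    if "admissible_pairing N c d v" for N :: "'z measure" and c d v s
    unfolding F_def[abs_def]
    by (rule increment_pairing_mixture[OF that sigma_finite_lborel _ _ EC _ iE]) (use f(1) in auto)
  have PF: "increment_pairing M a b w (F s) = increment_pairing M' a' b' w' (F s)" for s
    unfolding mixF[OF adm(1)] mixF[OF adm(2)] PE ..
  define \<kappa> where "\<kappa> = (1 / sqrt (2 * pi)) ^ DIM('a)"
  \<comment> \<open>The normalised convolution, rescaled so that the Gaussian is fixed and the shift
    shrinks. In this form the bounds of \<open>f\<close> pass to \<open>h n\<close> uniformly in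
    \<open>n\<close>, whereas \<open>C s\<close> grows with \<open>s\<close>.\<close>
  define h where "h n x = (LINT z|lborel. f (x + (1 / real (Suc n)) *\<^sub>R z) * gauss z)" for n x
  have hF: "h n x = (\<kappa> * real (Suc n) ^ DIM('a)) * F (real (Suc n)) x" for n x
  proof -
    let ?s = "1 / real (Suc n)"
    have "F (real (Suc n)) x = (LINT z|density (distr lborel borel (\<lambda>z. x + ?s *\<^sub>R z)) (\<lambda>_. \<bar>?s\<bar> ^ DIM('a)). f z * E (real (Suc n)) z x)"
      unfolding F_def by (subst lborel_affine[of ?s x, symmetric]) auto
    also have "\<dots> = (LINT z|lborel. ?s ^ DIM('a) * (f (x + ?s *\<^sub>R z) * E (real (Suc n)) (x + ?s *\<^sub>R z) x))"
      by (subst integral_density) (auto simp: integral_distr E_def)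
    also have "\<dots> = (LINT z|lborel. (?s ^ DIM('a) / \<kappa>) * (f (x + ?s *\<^sub>R z) * gauss z))"
      by (intro Bochner_Integration.integral_cong refl) (simp add: E_def gauss_eq \<kappa>_def)
    also have "\<dots> = (?s ^ DIM('a) / \<kappa>) * h n x"
      unfolding h_def by (rule integral_mult_right_zero)
    finally show ?thesis by (simp add: \<kappa>_def power_divide field_simps)
  qed
  have Ph: "increment_pairing M a b w (h n) = increment_pairing M' a' b' w' (h n)" for n
  proof -
    have cm: "increment_pairing N c d v (\<lambda>x. k * F s x) = k * increment_pairing N c d v (F s)"
      for N :: "'z measure" and c d v k s
      unfolding increment_pairing_def integral_mult_right_zero[symmetric] by (simp add: algebra_simps)
    have "h n = (\<lambda>x. (\<kappa> * real (Suc n) ^ DIM('a)) * F (real (Suc n)) x)"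
      by (rule ext) (rule hF)
    then show ?thesis by (simp only: cm PF)
  qed
  have g1: "(LINT z::'a|lborel. gauss z) = 1"
    using integral_gauss_cos[of "0::'a"] by simp
  have ih: "integrable lborel (\<lambda>z. f (x + c *\<^sub>R z) * gauss z)" for x c
    by (rule Bochner_Integration.integrable_bound[OF integrable_mult_right[OF integrable_gauss, of K]])
      (use f(2) gauss_pos in \<open>auto simp: abs_mult less_imp_le intro!: mult_right_mono order_trans[OF f(2) abs_ge_self]\<close>)
  \<comment> \<open>A basis vector and 0 are at distance 1, so \<open>B\<close> dominates an
    absolute value.\<close>
  have B0: "0 \<le> B" using f(3)[of "SOME b. b \<in> Basis" 0] abs_ge_zero[of "f (SOME b. b \<in> Basis) - f 0"]
    by (metis (full_types) SOME_Basis norm_Basis diff_zero mult.right_neutral order_trans)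
  have fK: "\<bar>f x - f y\<bar> \<le> (2 * K + B) * min 1 (norm (x - y))" for x y
  proof (cases "norm (x - y) \<le> 1")
    case True
    have "0 \<le> K" using f(2)[of x] by linarith
    then have "B * norm (x - y) \<le> (2 * K + B) * norm (x - y)" by (intro mult_right_mono) auto
    then show ?thesis using f(3)[of x y] True by (simp add: min_def)
  next
    case False
    then show ?thesis using f(2)[of x] f(2)[of y] B0 by (simp add: min_def)
  qed
  have hb: "\<bar>h n x - h n y\<bar> \<le> (2 * K + B) * min 1 (norm (x - y))" for n x y
  proof -
    let ?s = "1 / real (Suc n)"
    have "\<bar>h n x - h n y\<bar> = \<bar>LINT z|lborel. (f (x + ?s *\<^sub>R z) - f (y + ?s *\<^sub>R z)) * gauss z\<bar>"
      unfolding h_def by (simp only: Bochner_Integration.integral_diff[OF ih ih, symmetric] left_diff_distrib)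
    also have "\<dots> \<le> (LINT z|lborel. ((2 * K + B) * min 1 (norm (x - y))) * gauss (z::'a))"
    proof (rule integral_abs_bound_integral)
      show "integrable lborel (\<lambda>z. (f (x + ?s *\<^sub>R z) - f (y + ?s *\<^sub>R z)) * gauss z)"
        unfolding left_diff_distrib by (intro Bochner_Integration.integrable_diff ih)
      show "integrable lborel (\<lambda>z::'a. ((2 * K + B) * min 1 (norm (x - y))) * gauss z)"
        by (intro integrable_mult_right integrable_gauss)
      show "\<bar>(f (x + ?s *\<^sub>R z) - f (y + ?s *\<^sub>R z)) * gauss z\<bar> \<le> ((2 * K + B) * min 1 (norm (x - y))) * gauss z" for z
        using mult_right_mono[OF fK[of "x + ?s *\<^sub>R z" "y + ?s *\<^sub>R z"] less_imp_le[OF gauss_pos[of z]]]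
        unfolding abs_mult abs_of_pos[OF gauss_pos] by simp
    qed
    also have "\<dots> = (2 * K + B) * min 1 (norm (x - y))"
      by (simp add: g1)
    finally show ?thesis .
  qed
  have cf: "isCont f x" for x
  proof -
    have "B-lipschitz_on UNIV f"
      using f(3) B0 by (intro lipschitz_onI) (auto simp: dist_norm)
    then show ?thesis
      using lipschitz_on_continuous_on continuous_on_eq_continuous_at[OF open_UNIV] by blast
  qed
  have hlim: "(\<lambda>n. h n x) \<longlonglongrightarrow> f x" for x
  proof -
    have "(\<lambda>n. h n x) \<longlonglongrightarrow> (LINT z|lborel. f x * gauss (z::'a))"
      unfolding h_def
    proof (rule integral_dominated_convergence)
      show "integrable lborel (\<lambda>z::'a. K * gauss z)" by (intro integrable_mult_right integrable_gauss)
      have "(\<lambda>n. f (x + (1 / real (Suc n)) *\<^sub>R z)) \<longlonglongrightarrow> f x" for z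
      proof (rule isCont_tendsto_compose[OF cf])
        have "(\<lambda>n. x + (1 / real (Suc n)) *\<^sub>R z) \<longlonglongrightarrow> x + 0 *\<^sub>R z"
          by (intro tendsto_intros LIMSEQ_Suc[OF lim_1_over_n])
        then show "(\<lambda>n. x + (1 / real (Suc n)) *\<^sub>R z) \<longlonglongrightarrow> x" by simp
      qed
      then show "AE z in lborel. (\<lambda>n. f (x + (1 / real (Suc n)) *\<^sub>R z) * gauss z) \<longlonglongrightarrow> f x * gauss z"
        by (intro AE_I2 tendsto_mult tendsto_const)
      show "AE z in lborel. norm (f (x + (1 / real (Suc n)) *\<^sub>R z) * gauss z) \<le> K * gauss z" for n
        unfolding real_norm_def abs_mult abs_of_pos[OF gauss_pos]
        by (intro AE_I2 mult_right_mono f(2) less_imp_le[OF gauss_pos])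
    qed measurable
    then show ?thesis by (simp add: g1)
  qed
  have hm: "h n \<in> borel_measurable borel" for n
    unfolding h_def by measurable
  have "(\<lambda>n. increment_pairing M a b w (h n)) \<longlonglongrightarrow> increment_pairing M a b w f"
    by (rule increment_pairing_tendsto[OF adm(1) hlim hb _ hm]) measurable
  moreover have "(\<lambda>n. increment_pairing M' a' b' w' (h n)) \<longlonglongrightarrow> increment_pairing M' a' b' w' f"
    by (rule increment_pairing_tendsto[OF adm(2) hlim hb _ hm]) measurable
  ultimately show ?thesis
    unfolding Ph by (rule LIMSEQ_unique)
qed

section \<open>The semigroup and the fractional gradient\<close>

lemma stable_scale_powr:
  assumes "0 < \<alpha>"
  shows "stable_scale \<alpha> lam \<xi> powr \<alpha> = (LINT y|lam. \<bar>y \<bullet> \<xi>\<bar> powr \<alpha>)"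
  using assms by (simp add: stable_scale_def powr_powr)

lemma stable_scale_powr_scaleR:
  assumes "0 < \<alpha>"
  shows "stable_scale \<alpha> lam (r *\<^sub>R \<xi>) powr \<alpha> = \<bar>r\<bar> powr \<alpha> * stable_scale \<alpha> lam \<xi> powr \<alpha>"
  unfolding stable_scale_powr[OF assms] by (simp add: abs_mult powr_mult)

lemma stable_law_cos:
  fixes \<mu> :: "'a::euclidean_space measure"
  assumes law: "stable_law \<alpha> lam \<mu>"
  shows "(LINT y|\<mu>. cos (c + y \<bullet> \<xi>)) = cos c * exp (- (stable_scale \<alpha> lam \<xi> powr \<alpha>))"
proof -
  interpret prob_space \<mu> using law by (simp add: stable_law_def)
  have [measurable_cong]: "sets \<mu> = sets borel" using law by (simp add: stable_law_def)
  have int: "integrable \<mu> (\<lambda>y. iexp c * iexp (y \<bullet> \<xi>))"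
    by (rule integrable_const_bound[of _ 1]) (auto simp: norm_mult)
  have "(LINT y|\<mu>. cos (c + y \<bullet> \<xi>)) = (LINT y|\<mu>. Re (iexp c * iexp (y \<bullet> \<xi>)))"
    by (intro Bochner_Integration.integral_cong refl) (simp add: exp_add[symmetric] distrib_left[symmetric] Re_exp)
  also have "\<dots> = Re (iexp c * (CLINT y|\<mu>. iexp (y \<bullet> \<xi>)))"
    by (subst integral_Re[OF int]) simp
  also have "\<dots> = cos c * exp (- (stable_scale \<alpha> lam \<xi> powr \<alpha>))"
    using law by (simp add: stable_law_def Re_exp)
  finally show ?thesis .
qed

lemma positive_smooth_density_integrable:
  fixes p :: "'a::euclidean_space \<Rightarrow> real"
  assumes dens: "positive_smooth_density \<mu> p" and "prob_space \<mu>"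
  shows "integrable lborel p"
proof (rule integrableI_nonneg)
  interpret prob_space \<mu> by fact
  have [measurable]: "p \<in> borel_measurable borel"
    using dens smooth_gradient(3) by (auto simp: positive_smooth_density_def intro: borel_measurable_continuous_onI)
  show "p \<in> borel_measurable lborel" by measurable
  show "AE x in lborel. 0 \<le> p x" using dens by (simp add: positive_smooth_density_def less_imp_le)
  have "(\<integral>\<^sup>+x. ennreal (p x) \<partial>lborel) = emeasure \<mu> (space \<mu>)"
    using dens by (simp add: positive_smooth_density_def emeasure_density)
  then show "(\<integral>\<^sup>+x. ennreal (p x) \<partial>lborel) < \<infinity>" by (simp add: emeasure_space_1)
qed

text \<open>Integrating against \<open>\<mu>\<close> cancels the denominator of the score, so its
  first \<open>\<mu>\<close>-norm is the Lebesgue integral of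
  \<open>norm (gradient p x)\<close>.\<close>

lemma score_integrable:
  fixes p :: "'a::euclidean_space \<Rightarrow> real"
  assumes dens: "positive_smooth_density \<mu> p" and fin: "Lp_norm 1 \<mu> (\<lambda>x. gradient p x /\<^sub>R p x) < \<infinity>"
  shows "integrable lborel (gradient p)"
proof (rule integrableI_bounded)
  have [measurable]: "p \<in> borel_measurable borel" "gradient p \<in> borel_measurable borel"
    using dens smooth_gradient(2,3) by (auto simp: positive_smooth_density_def intro: borel_measurable_continuous_onI)
  show "gradient p \<in> borel_measurable lborel" by measurable
  have pos: "0 < p x" for x using dens by (simp add: positive_smooth_density_def)
  have "(\<integral>\<^sup>+x. ennreal (norm (gradient p x)) \<partial>lborel) = (\<integral>\<^sup>+x. ennreal (p x) * ennreal (norm (gradient p x /\<^sub>R p x)) \<partial>lborel)"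
    using pos by (intro nn_integral_cong) (simp add: less_imp_le less_imp_neq[THEN not_sym] flip: ennreal_mult)
  also have "\<dots> = (\<integral>\<^sup>+x. ennreal (norm (gradient p x /\<^sub>R p x) powr 1) \<partial>\<mu>)"
    using dens by (simp add: positive_smooth_density_def nn_integral_density)
  also have "\<dots> < \<infinity>"
    using fin by (auto simp: Lp_norm_def enn_powr_def top.not_eq_extremum split: if_splits)
  finally show "(\<integral>\<^sup>+x. ennreal (norm (gradient p x)) \<partial>lborel) < \<infinity>" .
qed

text \<open>The derivative of \<open>sin (A y) * p y\<close> along \<open>v\<close> has integral 0.
  This turns \<open>gradient p\<close> back into the law itself, whose cosine transform is
  known.\<close>

lemma integral_sin_gradient:
  fixes p :: "'a::euclidean_space \<Rightarrow> real"
  assumes p: "smooth p" "integrable lborel p" "integrable lborel (gradient p)"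
  shows "(LINT y|lborel. sin ((x + r *\<^sub>R y) \<bullet> \<xi> - \<theta>) * (v \<bullet> gradient p y))
       = - (r * (v \<bullet> \<xi>)) * (LINT y|lborel. p y * cos ((x + r *\<^sub>R y) \<bullet> \<xi> - \<theta>))"
proof -
  note g = smooth_gradient[OF p(1)]
  have [measurable]: "p \<in> borel_measurable borel" "gradient p \<in> borel_measurable borel"
    using p by auto
  define A where "A y = (x + r *\<^sub>R y) \<bullet> \<xi> - \<theta>" for y
  have [measurable]: "A \<in> borel_measurable borel" unfolding A_def by measurable
  have A: "GDERIV A y :> r *\<^sub>R \<xi>" for y
    unfolding gderiv_def A_def by (auto intro!: derivative_eq_intros simp: inner_scaleR_right)
  have contA: "continuous_on UNIV A" unfolding A_def by (intro continuous_intros)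
  define G where "G y = sin (A y) *\<^sub>R gradient p y + p y *\<^sub>R (cos (A y) *\<^sub>R (r *\<^sub>R \<xi>))" for y
  have q: "GDERIV (\<lambda>y. sin (A y) * p y) y :> G y" for y
    unfolding G_def by (intro GDERIV_mult GDERIV_DERIV_compose[OF A] g(1) DERIV_sin)
  have contG: "continuous_on UNIV G"
    unfolding G_def by (intro continuous_intros g contA)
  have i1: "integrable lborel (\<lambda>y. sin (A y) * p y)"
    by (rule Bochner_Integration.integrable_bound[OF p(2)]) (auto simp: abs_mult intro!: AE_I2 mult_left_le_one_le)
  have i2: "integrable lborel (\<lambda>y. sin (A y) * (v \<bullet> gradient p y))"
    by (rule Bochner_Integration.integrable_bound[OF integrable_inner_right[OF p(3)], of _ v])
      (auto simp: abs_mult intro!: AE_I2 mult_left_le_one_le)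
  have i3: "integrable lborel (\<lambda>y. p y * cos (A y))"
    by (rule Bochner_Integration.integrable_bound[OF p(2)]) (auto simp: abs_mult intro!: AE_I2 mult_left_le)
  have vG: "v \<bullet> G y = sin (A y) * (v \<bullet> gradient p y) + (r * (v \<bullet> \<xi>)) * (p y * cos (A y))" for y
    by (simp add: G_def inner_add_right mult_ac)
  have "0 = (LINT y|lborel. v \<bullet> G y)"
    by (rule integral_directional_derivative_eq_0[OF q contG i1, symmetric])
      (simp only: vG, intro Bochner_Integration.integrable_add i2 integrable_mult_right i3)
  also have "\<dots> = (LINT y|lborel. sin (A y) * (v \<bullet> gradient p y)) + (LINT y|lborel. (r * (v \<bullet> \<xi>)) * (p y * cos (A y)))"
    unfolding vG by (intro Bochner_Integration.integral_add i2 integrable_mult_right i3)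
  also have "(LINT y|lborel. (r * (v \<bullet> \<xi>)) * (p y * cos (A y))) = (r * (v \<bullet> \<xi>)) * (LINT y|lborel. p y * cos (A y))"
    by (rule integral_mult_right_zero)
  finally show ?thesis by (simp add: A_def)
qed

text \<open>With time equal to \<open>r powr \<alpha>\<close>, the differential contributes
  \<open>\<alpha> * r powr (\<alpha> - 1)\<close>, the generator \<open>1 / \<alpha>\<close>, and
  moving the divergence from \<open>x\<close> to \<open>y\<close> a factor \<open>1 / r\<close>; the
  product is \<open>r powr (\<alpha> - 2)\<close>, integrable at 0 since
  \<open>1 < \<alpha>\<close>.\<close>

definition time_measure :: "real \<Rightarrow> real \<Rightarrow> real measure" where
  "time_measure \<alpha> R = density lborel (\<lambda>r. ennreal (indicator {0..R} r * r powr (\<alpha> - 2)))"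

lemma sets_time_measure [measurable_cong, simp]: "sets (time_measure \<alpha> R) = sets borel"
  by (simp add: time_measure_def)

lemma space_time_measure [simp]: "space (time_measure \<alpha> R) = UNIV"
  by (simp add: time_measure_def)

lemma emeasure_time_measure:
  assumes "1 < \<alpha>" "0 \<le> R"
  shows "emeasure (time_measure \<alpha> R) UNIV = ennreal (R powr (\<alpha> - 1) / (\<alpha> - 1))"
proof -
  have "emeasure (time_measure \<alpha> R) UNIV = (\<integral>\<^sup>+r. ennreal (indicator {0..R} r * r powr (\<alpha> - 2)) \<partial>lborel)"
    by (simp add: time_measure_def emeasure_density)
  also have "\<dots> = ennreal (R powr (\<alpha> - 2 + 1) / (\<alpha> - 2 + 1))"
    using assms by (intro nn_integral_powr_from_0) auto
  finally show ?thesis by simp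
qed

lemma finite_time_measure: "1 < \<alpha> \<Longrightarrow> 0 \<le> R \<Longrightarrow> finite_measure (time_measure \<alpha> R)"
  by (rule finite_measureI) (simp add: emeasure_time_measure)

text \<open>Times the density of \<open>time_measure\<close>, the integrand is the derivative of
  \<open>- exp (- (r powr \<alpha> * s))\<close>. The absolute value matches
  \<open>stable_scale_powr_scaleR\<close> and changes nothing on \<open>{0..R}\<close>.\<close>

lemma integral_time_measure_exp:
  assumes "1 < \<alpha>" "0 \<le> R" "0 \<le> s"
  shows "(LINT r|time_measure \<alpha> R. (r * (\<alpha> * s)) * exp (- (\<bar>r\<bar> powr \<alpha> * s))) = 1 - exp (- (R powr \<alpha> * s))"
proof -
  define g where "g r = \<alpha> * s * r powr (\<alpha> - 1) * exp (- (r powr \<alpha> * s))" for r :: real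
  have "(g has_integral (- exp (- (R powr \<alpha> * s)) - (- exp (- (0 powr \<alpha> * s))))) {0..R}"
  \<comment> \<open>The derivative of \<open>powr\<close> is taken only at positive
    \<open>r\<close>; at the endpoint 0 continuity is enough.\<close>
  proof (rule fundamental_theorem_of_calculus_interior)
    show "continuous_on {0..R} (\<lambda>r. - exp (- (r powr \<alpha> * s)))"
      using assms by (intro continuous_intros continuous_on_powr') auto
    show "((\<lambda>r. - exp (- (r powr \<alpha> * s))) has_vector_derivative g r) (at r)" if "r \<in> {0<..<R}" for r
      unfolding has_real_derivative_iff_has_vector_derivative[symmetric] g_def
      using that assms by (auto intro!: derivative_eq_intros simp: powr_diff)
  qed (use assms in auto)
  then have "(\<integral>\<^sup>+r. ennreal (indicator {0..R} r * g r) \<partial>lborel) = ennreal (1 - exp (- (R powr \<alpha> * s)))"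
    using assms by (subst nn_integral_has_integral_lebesgue) (auto simp: g_def)
  then have 1: "(LINT r|lborel. indicator {0..R} r * g r) = 1 - exp (- (R powr \<alpha> * s))"
    using assms by (intro has_bochner_integral_integral_eq has_bochner_integral_nn_integral)
      (auto simp: g_def)
  have 2: "(LINT r|time_measure \<alpha> R. (r * (\<alpha> * s)) * exp (- (\<bar>r\<bar> powr \<alpha> * s)))
      = (LINT r|lborel. (indicator {0..R} r * r powr (\<alpha> - 2)) *\<^sub>R ((r * (\<alpha> * s)) * exp (- (\<bar>r\<bar> powr \<alpha> * s))))"
    unfolding time_measure_def by (rule integral_density) auto
  have 3: "(indicator {0..R} r * r powr (\<alpha> - 2)) *\<^sub>R ((r * (\<alpha> * s)) * exp (- (\<bar>r\<bar> powr \<alpha> * s))) = indicator {0..R} r * g r" for r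
  proof (cases "0 < r")
    case True
    have "r powr (\<alpha> - 2) * r = r powr (\<alpha> - 2) * r powr 1" using True by simp
    also have "\<dots> = r powr (\<alpha> - 1)" unfolding powr_add[symmetric] by simp
    finally have "r powr (\<alpha> - 1) = r powr (\<alpha> - 2) * r" ..
    then show ?thesis using True by (simp add: g_def)
  qed (auto simp: indicator_def g_def)
  show ?thesis unfolding 2 3 1 ..
qed

section \<open>The representation formula for semigroup increments\<close>

locale stable_density = stable_levy \<alpha> \<sigma> \<nu>
  for \<alpha> :: real and \<sigma> \<nu> :: "'a::euclidean_space measure" +
  fixes lam \<mu> :: "'a measure" and p :: "'a \<Rightarrow> real"
  assumes lam: "lam = spectral_measure \<alpha> \<sigma>" and law: "stable_law \<alpha> lam \<mu>"
    and dens: "positive_smooth_density \<mu> p" and grad_int: "integrable lborel (gradient p)"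
begin

lemma smooth_p: "smooth p" and p_pos: "0 < p x" and mu_eq: "\<mu> = density lborel (\<lambda>x. ennreal (p x))"
  using dens by (auto simp: positive_smooth_density_def)

lemma prob_mu: "prob_space \<mu>" and sets_mu [measurable_cong, simp]: "sets \<mu> = sets borel"
  using law by (auto simp: stable_law_def)

lemma space_mu [simp]: "space \<mu> = UNIV"
  using sets_eq_imp_space_eq[OF sets_mu] by simp

lemma p_int: "integrable lborel p"
  by (rule positive_smooth_density_integrable[OF dens prob_mu])

lemma p_measurable [measurable]: "p \<in> borel_measurable borel" "gradient p \<in> borel_measurable borel"
  using p_int grad_int by auto

lemma integral_mu: "g \<in> borel_measurable borel \<Longrightarrow> (LINT y|\<mu>. g y) = (LINT y|lborel. p y * g y)" for g :: "'a \<Rightarrow> real"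
  unfolding mu_eq using p_pos by (subst integral_density) (auto simp: less_imp_le)

text \<open>After the addition formula the part with \<open>cos (u \<bullet> \<xi>) - 1\<close> is
  odd once multiplied by \<open>u\<close>, so it vanishes by symmetry of \<open>\<nu>\<close>; only
  the sine part survives.\<close>

lemma levy_integral_wave:
  fixes v z \<xi> :: 'a
  shows "(LINT u|\<nu>. (cos ((z + u) \<bullet> \<xi> - \<theta>) - cos (z \<bullet> \<xi> - \<theta>)) * (u \<bullet> v))
       = - (sin (z \<bullet> \<xi> - \<theta>) * ((LINT u|\<nu>. sin (u \<bullet> \<xi>) *\<^sub>R u) \<bullet> v))"
proof -
  let ?B = "z \<bullet> \<xi> - \<theta>"
  have i: "integrable \<nu> (\<lambda>u. (cos (u \<bullet> \<xi>) - 1) *\<^sub>R u)"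
  proof (rule levy_integrable_bound)
    show "norm ((cos (u \<bullet> \<xi>) - 1) *\<^sub>R u) \<le> (2 + norm \<xi>) * (min 1 (norm u) * norm u)" for u
      using mult_right_mono[OF abs_cos_diff_le[of u \<xi> 0 0], of "norm u"] by (simp add: mult.assoc)
  qed measurable
  have eq: "(cos ((z + u) \<bullet> \<xi> - \<theta>) - cos ?B) * (u \<bullet> v)
      = cos ?B * (((cos (u \<bullet> \<xi>) - 1) *\<^sub>R u) \<bullet> v) - sin ?B * ((sin (u \<bullet> \<xi>) *\<^sub>R u) \<bullet> v)" for u
  proof -
    have "cos ((z + u) \<bullet> \<xi> - \<theta>) = cos (?B + u \<bullet> \<xi>)" by (simp add: inner_add_left algebra_simps)
    then show ?thesis by (simp only: cos_add inner_scaleR_left) (simp add: algebra_simps)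
  qed
  have "(LINT u|\<nu>. (cos ((z + u) \<bullet> \<xi> - \<theta>) - cos ?B) * (u \<bullet> v))
      = (LINT u|\<nu>. cos ?B * (((cos (u \<bullet> \<xi>) - 1) *\<^sub>R u) \<bullet> v)) - (LINT u|\<nu>. sin ?B * ((sin (u \<bullet> \<xi>) *\<^sub>R u) \<bullet> v))"
    unfolding eq by (intro Bochner_Integration.integral_diff integrable_mult_right integrable_inner_left i levy_integrable_sin)
  also have "(LINT u|\<nu>. cos ?B * (((cos (u \<bullet> \<xi>) - 1) *\<^sub>R u) \<bullet> v)) = 0"
    by (rule levy_integral_odd) auto
  also have "(LINT u|\<nu>. sin ?B * ((sin (u \<bullet> \<xi>) *\<^sub>R u) \<bullet> v)) = sin ?B * ((LINT u|\<nu>. sin (u \<bullet> \<xi>) *\<^sub>R u) \<bullet> v)"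
    unfolding integral_mult_right_zero integral_inner_left[OF levy_integrable_sin] ..
  finally show ?thesis by simp
qed

text \<open>The pairing whose value at \<open>f\<close> is \<open>- \<integral> \<langle>D f (x + r y); \<nabla> p y\<rangle> dy\<close>, integrated against
  \<open>r powr (\<alpha> - 2)\<close> over \<open>0 < r \<le> R\<close>.\<close>

abbreviation "generator_measure R \<equiv> (time_measure \<alpha> R \<Otimes>\<^sub>M lborel) \<Otimes>\<^sub>M \<nu>"

abbreviation "generator_pairing x R \<equiv> increment_pairing (generator_measure R)
  (\<lambda>w. x + fst (fst w) *\<^sub>R snd (fst w) + snd w) (\<lambda>w. x + fst (fst w) *\<^sub>R snd (fst w)) (\<lambda>w. - (snd w \<bullet> gradient p (snd (fst w))))"

text \<open>The displacement is \<open>u\<close> alone, so by Cauchy-Schwarz the dominating function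
  factors into 1 in \<open>r\<close>, \<open>norm (gradient p y)\<close> in \<open>y\<close> and
  \<open>min 1 (norm u) * norm u\<close> in \<open>u\<close>.\<close>

lemma admissible_generator_pairing:
  assumes "0 \<le> R"
  shows "admissible_pairing (generator_measure R) (\<lambda>w. x + fst (fst w) *\<^sub>R snd (fst w) + snd w) (\<lambda>w. x + fst (fst w) *\<^sub>R snd (fst w))
    (\<lambda>w. - (snd w \<bullet> gradient p (snd (fst w))))"
proof -
  interpret T: finite_measure "time_measure \<alpha> R" using \<alpha> assms by (intro finite_time_measure) auto
  interpret N: sigma_finite_measure \<nu> by (rule sigma_finite_levy)
  interpret TL: pair_sigma_finite "time_measure \<alpha> R" "lborel :: 'a measure" ..
  interpret G: pair_sigma_finite "time_measure \<alpha> R \<Otimes>\<^sub>M (lborel :: 'a measure)" \<nu> ..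
  have "integrable (time_measure \<alpha> R \<Otimes>\<^sub>M lborel) (\<lambda>(r, y). 1 * norm (gradient p y))"
    by (rule integrable_pair_mult[OF T.sigma_finite_measure_axioms sigma_finite_lborel])
      (simp_all add: grad_int)
  then have "integrable (generator_measure R) (\<lambda>(ry, u). (case ry of (r, y) \<Rightarrow> 1 * norm (gradient p y)) * (min 1 (norm u) * norm u))"
    by (rule integrable_pair_mult[OF TL.sigma_finite_measure_axioms N.sigma_finite_measure_axioms _ levy_integrable])
  then have dom: "integrable (generator_measure R) (\<lambda>w. norm (gradient p (snd (fst w))) * (min 1 (norm (snd w)) * norm (snd w)))"
    by (simp add: split_beta')
  have le: "\<bar>min 1 (norm u) * - (u \<bullet> v)\<bar> \<le> \<bar>norm v * (min 1 (norm u) * norm u)\<bar>" for u v :: 'a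
    using mult_left_mono[OF Cauchy_Schwarz_ineq2[of u v], of "min 1 (norm u)"] by (simp add: abs_mult mult_ac)
  have "integrable (generator_measure R) (\<lambda>w. min 1 (norm (snd w)) * - (snd w \<bullet> gradient p (snd (fst w))))"
    by (rule Bochner_Integration.integrable_bound[OF dom]) (auto simp only: real_norm_def intro!: AE_I2 le, measurable)
  then show ?thesis
    unfolding admissible_pairing_def
    by (intro conjI) (simp_all add: G.sigma_finite_measure_axioms)
qed

text \<open>Fubini with the integral over \<open>u\<close> innermost: at fixed \<open>r\<close> and
  \<open>y\<close> it is the fractional gradient at \<open>x + r y\<close>, tested against
  \<open>- gradient p y\<close>.\<close>

lemma
  assumes "0 \<le> R" and bound: "\<And>x y. \<bar>f x - f y\<bar> \<le> C * min 1 (norm (x - y))" and [measurable]: "f \<in> borel_measurable borel"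
  shows generator_pairing_iterated: "generator_pairing x R f = (LINT w|(time_measure \<alpha> R \<Otimes>\<^sub>M lborel). (LINT u|\<nu>. (f (x + fst w *\<^sub>R snd w + u) - f (x + fst w *\<^sub>R snd w)) * - (u \<bullet> gradient p (snd w))))"
    and generator_pairing_integrable: "integrable (time_measure \<alpha> R \<Otimes>\<^sub>M lborel) (\<lambda>w. LINT u|\<nu>. (f (x + fst w *\<^sub>R snd w + u) - f (x + fst w *\<^sub>R snd w)) * - (u \<bullet> gradient p (snd w)))"
proof -
  interpret T: finite_measure "time_measure \<alpha> R" using \<alpha> assms by (intro finite_time_measure) auto
  interpret N: sigma_finite_measure \<nu> by (rule sigma_finite_levy)
  interpret TL: pair_sigma_finite "time_measure \<alpha> R" "lborel :: 'a measure" ..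
  interpret G: pair_sigma_finite "time_measure \<alpha> R \<Otimes>\<^sub>M (lborel :: 'a measure)" \<nu> ..
  let ?z = "\<lambda>w. x + fst (fst w) *\<^sub>R snd (fst w)"
  let ?h = "\<lambda>w. (f (?z w + snd w) - f (?z w)) * - (snd w \<bullet> gradient p (snd (fst w)))"
  have "integrable (generator_measure R) (\<lambda>w. C * (min 1 (norm (?z w + snd w - ?z w)) * - (snd w \<bullet> gradient p (snd (fst w)))))"
    using admissible_generator_pairing[OF \<open>0 \<le> R\<close>, of x] unfolding admissible_pairing_def by (intro integrable_mult_right) blast
  then have I: "integrable (generator_measure R) ?h"
  proof (rule Bochner_Integration.integrable_bound)
    show "AE w in generator_measure R. norm (?h w) \<le> norm (C * (min 1 (norm (?z w + snd w - ?z w)) * - (snd w \<bullet> gradient p (snd (fst w)))))"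
    proof (rule AE_I2)
      fix w
      show "norm (?h w) \<le> norm (C * (min 1 (norm (?z w + snd w - ?z w)) * - (snd w \<bullet> gradient p (snd (fst w)))))"
        unfolding real_norm_def abs_mult mult.assoc[symmetric]
        by (rule mult_right_mono[OF _ abs_ge_zero], rule order_trans[OF bound]) (metis abs_ge_self abs_mult)
    qed
  qed measurable
  show "integrable (time_measure \<alpha> R \<Otimes>\<^sub>M lborel) (\<lambda>w. LINT u|\<nu>. (f (x + fst w *\<^sub>R snd w + u) - f (x + fst w *\<^sub>R snd w)) * - (u \<bullet> gradient p (snd w)))"
    using G.integrable_fst'[OF I] by simp
  have "generator_pairing x R f = (LINT w|generator_measure R. ?h w)"
    unfolding increment_pairing_def ..
  also have "\<dots> = (LINT w|(time_measure \<alpha> R \<Otimes>\<^sub>M lborel). (LINT u|\<nu>. (f (x + fst w *\<^sub>R snd w + u) - f (x + fst w *\<^sub>R snd w)) * - (u \<bullet> gradient p (snd w))))"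
    using G.integral_fst'[OF I] by simp
  finally show "generator_pairing x R f = (LINT w|(time_measure \<alpha> R \<Otimes>\<^sub>M lborel). (LINT u|\<nu>. (f (x + fst w *\<^sub>R snd w + u) - f (x + fst w *\<^sub>R snd w)) * - (u \<bullet> gradient p (snd w))))" .
qed

text \<open>Plane waves are eigenfunctions: the identity reduces to
  \<open>\<integral>\<^sub>0\<^sup>R \<alpha> s r powr (\<alpha> - 1) exp (- s r powr \<alpha>) dr = 1 - exp (- s R powr \<alpha>)\<close>.\<close>

lemma generator_pairing_wave:
  assumes "0 \<le> R"
  shows "generator_pairing x R (\<lambda>z. cos (z \<bullet> \<xi> - \<theta>))
       = increment_pairing \<mu> (\<lambda>y. x + R *\<^sub>R y) (\<lambda>_. x) (\<lambda>_. 1) (\<lambda>z. cos (z \<bullet> \<xi> - \<theta>))"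
proof -
  interpret T: finite_measure "time_measure \<alpha> R" using \<alpha> assms by (intro finite_time_measure) auto
  interpret TL: pair_sigma_finite "time_measure \<alpha> R" "lborel :: 'a measure" ..
  interpret M: prob_space \<mu> by (rule prob_mu)
  define T where "T = (LINT u|\<nu>. sin (u \<bullet> \<xi>) *\<^sub>R u)"
  define s where "s = stable_scale \<alpha> lam \<xi> powr \<alpha>"
  have Ts: "T \<bullet> \<xi> = \<alpha> * s"
    unfolding T_def s_def by (rule levy_integral_sin_inner[OF lam])
  have cosmu: "(LINT y|\<mu>. cos ((x + r *\<^sub>R y) \<bullet> \<xi> - \<theta>)) = cos (x \<bullet> \<xi> - \<theta>) * exp (- (\<bar>r\<bar> powr \<alpha> * s))" for r
  proof -
    have "(LINT y|\<mu>. cos ((x + r *\<^sub>R y) \<bullet> \<xi> - \<theta>)) = (LINT y|\<mu>. cos ((x \<bullet> \<xi> - \<theta>) + y \<bullet> (r *\<^sub>R \<xi>)))"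
      by (simp add: inner_add_left algebra_simps)
    also have "\<dots> = cos (x \<bullet> \<xi> - \<theta>) * exp (- (\<bar>r\<bar> powr \<alpha> * s))"
      using \<alpha> by (simp only: stable_law_cos[OF law]) (simp add: stable_scale_powr_scaleR s_def)
    finally show ?thesis .
  qed
  have inner: "(LINT u|\<nu>. (cos ((z + u) \<bullet> \<xi> - \<theta>) - cos (z \<bullet> \<xi> - \<theta>)) * - (u \<bullet> v))
      = sin (z \<bullet> \<xi> - \<theta>) * (T \<bullet> v)" for z v
    unfolding mult_minus_right Bochner_Integration.integral_minus levy_integral_wave T_def by simp
  have int: "integrable (time_measure \<alpha> R \<Otimes>\<^sub>M lborel) (\<lambda>w. sin ((x + fst w *\<^sub>R snd w) \<bullet> \<xi> - \<theta>) * (T \<bullet> gradient p (snd w)))"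
    using generator_pairing_integrable[OF assms abs_cos_diff_le, of \<xi> \<theta> x] unfolding inner by simp
  have "generator_pairing x R (\<lambda>z. cos (z \<bullet> \<xi> - \<theta>)) = (LINT w|(time_measure \<alpha> R \<Otimes>\<^sub>M lborel). sin ((x + fst w *\<^sub>R snd w) \<bullet> \<xi> - \<theta>) * (T \<bullet> gradient p (snd w)))"
    using generator_pairing_iterated[OF assms abs_cos_diff_le, of \<xi> \<theta> x] unfolding inner by simp
  also have "\<dots> = (LINT r|time_measure \<alpha> R. (LINT y|lborel. sin ((x + r *\<^sub>R y) \<bullet> \<xi> - \<theta>) * (T \<bullet> gradient p y)))"
    using TL.integral_fst'[OF int] by simp
  also have "\<dots> = (LINT r|time_measure \<alpha> R. (- cos (x \<bullet> \<xi> - \<theta>)) * ((r * (\<alpha> * s)) * exp (- (\<bar>r\<bar> powr \<alpha> * s))))"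
  \<comment> \<open>Integration by parts contributes
    \<open>r * (T \<bullet> \<xi>) = r * (\<alpha> * s)\<close> and the law of \<open>r y\<close>
    the exponential, so only the integral in \<open>r\<close> is left.\<close>
  proof (intro Bochner_Integration.integral_cong refl)
    fix r
    have "(LINT y|lborel. sin ((x + r *\<^sub>R y) \<bullet> \<xi> - \<theta>) * (T \<bullet> gradient p y))
        = - (r * (\<alpha> * s)) * (LINT y|\<mu>. cos ((x + r *\<^sub>R y) \<bullet> \<xi> - \<theta>))"
      unfolding integral_sin_gradient[OF smooth_p p_int grad_int] Ts by (subst integral_mu) auto
    then show "(LINT y|lborel. sin ((x + r *\<^sub>R y) \<bullet> \<xi> - \<theta>) * (T \<bullet> gradient p y))
        = (- cos (x \<bullet> \<xi> - \<theta>)) * ((r * (\<alpha> * s)) * exp (- (\<bar>r\<bar> powr \<alpha> * s)))"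
      unfolding cosmu by simp
  qed
  also have "\<dots> = (- cos (x \<bullet> \<xi> - \<theta>)) * (1 - exp (- (R powr \<alpha> * s)))"
    unfolding integral_mult_right_zero
    using \<alpha> assms by (subst integral_time_measure_exp) (auto simp: s_def)
  also have "\<dots> = (LINT y|\<mu>. cos ((x + R *\<^sub>R y) \<bullet> \<xi> - \<theta>)) - (LINT y|\<mu>. cos (x \<bullet> \<xi> - \<theta>))"
    unfolding cosmu using assms by (simp add: M.prob_space[simplified] algebra_simps)
  also have "\<dots> = increment_pairing \<mu> (\<lambda>y. x + R *\<^sub>R y) (\<lambda>_. x) (\<lambda>_. 1) (\<lambda>z. cos (z \<bullet> \<xi> - \<theta>))"
    unfolding increment_pairing_def
    by (subst Bochner_Integration.integral_diff[symmetric]) (auto intro!: M.integrable_const_bound[of _ 1])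
  finally show ?thesis .
qed

lemma semigroup_increment:
  assumes f: "f \<in> Cc_infinity" and R: "0 \<le> R"
  shows "(LINT y|\<mu>. f (x + R *\<^sub>R y)) - f x
      = - (LINT w|(time_measure \<alpha> R \<Otimes>\<^sub>M lborel). frac_gradient \<nu> f (x + fst w *\<^sub>R snd w) \<bullet> gradient p (snd w))"
proof -
  interpret M: prob_space \<mu> by (rule prob_mu)
  obtain K where K: "\<And>x. \<bar>f x\<bar> \<le> K" using Cc_infinity_bounded[OF f] by blast
  obtain B where B: "\<And>x y. \<bar>f x - f y\<bar> \<le> B * norm (x - y)" using Cc_infinity_lipschitz[OF f] by blast
  have [measurable]: "f \<in> borel_measurable borel" using Cc_infinity_integrable[OF f] by simp
  \<comment> \<open>One constant for both regimes of the minimum: \<open>B\<close> at distances up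
    to 1, the oscillation \<open>2 * K\<close> beyond.\<close>
  define C where "C = max B (2 * K)"
  have C: "\<bar>f x - f y\<bar> \<le> C * min 1 (norm (x - y))" for x y
  proof (cases "norm (x - y) \<le> 1")
    case True
    have "B * norm (x - y) \<le> C * norm (x - y)" by (intro mult_right_mono) (auto simp: C_def)
    then show ?thesis using B[of x y] True by (simp add: min_def)
  next
    case False
    have "2 * K \<le> C" by (simp add: C_def)
    then show ?thesis using K[of x] K[of y] False by (simp add: min_def)
  qed
  have adm: "admissible_pairing \<mu> (\<lambda>y. x + R *\<^sub>R y) (\<lambda>_. x) (\<lambda>_. 1)"
    unfolding admissible_pairing_def
    by (auto intro!: M.integrable_const_bound[of _ 1] M.sigma_finite_measure_axioms)
  have "(LINT y|\<mu>. f (x + R *\<^sub>R y)) - f x = increment_pairing \<mu> (\<lambda>y. x + R *\<^sub>R y) (\<lambda>_. x) (\<lambda>_. 1) f"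
  proof -
    have "integrable \<mu> (\<lambda>y. f (x + R *\<^sub>R y))"
      by (rule M.integrable_const_bound[of _ K]) (use K in auto)
    then show ?thesis by (simp add: increment_pairing_def M.prob_space[simplified])
  qed
  also have "\<dots> = generator_pairing x R f"
    by (rule increment_pairing_eqI[OF adm admissible_generator_pairing[OF R] generator_pairing_wave[OF R, symmetric]
        Cc_infinity_integrable[OF f] K B])
  also have "\<dots> = (LINT w|(time_measure \<alpha> R \<Otimes>\<^sub>M lborel). - (frac_gradient \<nu> f (x + fst w *\<^sub>R snd w) \<bullet> gradient p (snd w)))"
  proof -
    have i: "integrable \<nu> (\<lambda>u. (f (z + u) - f z) *\<^sub>R u)" for z
    proof (rule levy_integrable_bound)
      show "norm ((f (z + u) - f z) *\<^sub>R u) \<le> C * (min 1 (norm u) * norm u)" for u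
        using mult_right_mono[OF C[of "z + u" z], of "norm u"] by (simp add: mult.assoc)
    qed measurable
    have "(LINT u|\<nu>. (f (z + u) - f z) * - (u \<bullet> v)) = - (frac_gradient \<nu> f z \<bullet> v)" for z v
      unfolding frac_gradient_def integral_inner_left[OF i, symmetric] by simp
    then show ?thesis
      unfolding generator_pairing_iterated[OF R C \<open>f \<in> borel_measurable borel\<close>] by simp
  qed
  also have "\<dots> = - (LINT w|(time_measure \<alpha> R \<Otimes>\<^sub>M lborel). frac_gradient \<nu> f (x + fst w *\<^sub>R snd w) \<bullet> gradient p (snd w))"
    by (rule Bochner_Integration.integral_minus)
  finally show ?thesis .
qed

section \<open>The bound by the fractional gradient\<close>

lemma frac_gradient_measurable [measurable]:
  assumes [measurable]: "f \<in> borel_measurable borel"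
  shows "frac_gradient \<nu> f \<in> borel_measurable borel"
proof -
  interpret N: sigma_finite_measure \<nu> by (rule sigma_finite_levy)
  show ?thesis unfolding frac_gradient_def by measurable
qed

text \<open>Trading \<open>gradient p\<close> against Lebesgue measure for the score against
  \<open>\<mu>\<close> makes the mixing measure finite, as Jensen's inequality requires.\<close>

lemma semigroup_increment_bound:
  assumes f: "f \<in> Cc_infinity" and R: "0 \<le> R"
  shows "ennreal \<bar>(LINT y|\<mu>. f (x + R *\<^sub>R y)) - f x\<bar>
      \<le> (\<integral>\<^sup>+w. ennreal (norm (frac_gradient \<nu> f (x + fst w *\<^sub>R snd w)) * norm (gradient p (snd w) /\<^sub>R p (snd w))) \<partial>(time_measure \<alpha> R \<Otimes>\<^sub>M \<mu>))"
proof -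
  interpret T: finite_measure "time_measure \<alpha> R" using \<alpha> R by (intro finite_time_measure) auto
  interpret M: prob_space \<mu> by (rule prob_mu)
  have [measurable]: "f \<in> borel_measurable borel" using Cc_infinity_integrable[OF f] by simp
  let ?D = "\<lambda>r y. frac_gradient \<nu> f (x + r *\<^sub>R y)"
  have "ennreal \<bar>(LINT y|\<mu>. f (x + R *\<^sub>R y)) - f x\<bar>
      = ennreal (norm (LINT w|(time_measure \<alpha> R \<Otimes>\<^sub>M lborel). ?D (fst w) (snd w) \<bullet> gradient p (snd w)))"
    unfolding semigroup_increment[OF f R] by simp
  \<comment> \<open>If the integrand is not integrable, its Bochner integral is 0 and the bound is
    trivial.\<close>
  also have "\<dots> \<le> (\<integral>\<^sup>+w. ennreal (norm (?D (fst w) (snd w) \<bullet> gradient p (snd w))) \<partial>(time_measure \<alpha> R \<Otimes>\<^sub>M lborel))"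
    by (cases "integrable (time_measure \<alpha> R \<Otimes>\<^sub>M lborel) (\<lambda>w. ?D (fst w) (snd w) \<bullet> gradient p (snd w))")
      (rule integral_norm_bound_ennreal, assumption, simp add: not_integrable_integral_eq)
  also have "\<dots> \<le> (\<integral>\<^sup>+w. ennreal (norm (?D (fst w) (snd w)) * norm (gradient p (snd w))) \<partial>(time_measure \<alpha> R \<Otimes>\<^sub>M lborel))"
    by (intro nn_integral_mono) (auto intro!: ennreal_leI Cauchy_Schwarz_ineq2)
  also have "\<dots> = (\<integral>\<^sup>+r. (\<integral>\<^sup>+y. ennreal (norm (?D r y) * norm (gradient p y)) \<partial>lborel) \<partial>time_measure \<alpha> R)"
    by (subst lborel.nn_integral_fst[symmetric]) auto
  also have "\<dots> = (\<integral>\<^sup>+r. (\<integral>\<^sup>+y. ennreal (norm (?D r y) * norm (gradient p y /\<^sub>R p y)) \<partial>\<mu>) \<partial>time_measure \<alpha> R)"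
  proof (rule nn_integral_cong)
    fix r
    show "(\<integral>\<^sup>+y. ennreal (norm (?D r y) * norm (gradient p y)) \<partial>lborel)
        = (\<integral>\<^sup>+y. ennreal (norm (?D r y) * norm (gradient p y /\<^sub>R p y)) \<partial>\<mu>)"
      unfolding mu_eq using p_pos
      by (subst nn_integral_density)
        (auto intro!: nn_integral_cong simp: less_imp_le less_imp_neq[THEN not_sym] mult_ac simp flip: ennreal_mult)
  qed
  also have "\<dots> = (\<integral>\<^sup>+w. ennreal (norm (?D (fst w) (snd w)) * norm (gradient p (snd w) /\<^sub>R p (snd w))) \<partial>(time_measure \<alpha> R \<Otimes>\<^sub>M \<mu>))"
    by (subst M.nn_integral_fst[symmetric]) auto
  finally show ?thesis .
qed

lemma semigroup_Lp_bound:
  assumes f: "f \<in> Cc_infinity" and q: "1 \<le> q" and t: "0 < t"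
  shows "Lp_norm q lborel (\<lambda>x. stable_semigroup \<alpha> \<mu> t f x - f x)
          \<le> ennreal (t powr (1 - 1 / \<alpha>) / (\<alpha> - 1))
             * Lp_norm q \<mu> (\<lambda>x. gradient p x /\<^sub>R p x) * Lp_norm q lborel (frac_gradient \<nu> f)"
proof -
  define R where "R = t powr (1 / \<alpha>)"
  \<comment> \<open>The total mass of the mixing measure; as
    \<open>R = t powr (1 / \<alpha>)\<close>, it is the constant of the claim.\<close>
  define W where "W = R powr (\<alpha> - 1) / (\<alpha> - 1)"
  have R: "0 < R" using t by (simp add: R_def)
  have W: "0 < W" using R \<alpha> by (simp add: W_def)
  have W': "t powr (1 - 1 / \<alpha>) / (\<alpha> - 1) = W"
    unfolding W_def R_def powr_powr using \<alpha> by (simp add: field_simps)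
  interpret T: finite_measure "time_measure \<alpha> R" using \<alpha> R by (intro finite_time_measure) auto
  interpret M: prob_space \<mu> by (rule prob_mu)
  interpret TM: pair_sigma_finite "time_measure \<alpha> R" \<mu> ..
  have [measurable]: "f \<in> borel_measurable borel" using Cc_infinity_integrable[OF f] by simp
  let ?M = "time_measure \<alpha> R \<Otimes>\<^sub>M \<mu>"
  let ?S = "\<lambda>y. norm (gradient p y /\<^sub>R p y)" and ?D = "\<lambda>x. norm (frac_gradient \<nu> f x)"
  let ?A = "\<integral>\<^sup>+y. ennreal (?S y powr q) \<partial>\<mu>" and ?B = "\<integral>\<^sup>+x. ennreal (?D x powr q) \<partial>lborel"
  define H where "H x w = ?D (x + fst w *\<^sub>R snd w) * ?S (snd w)" for x :: 'a and w :: "real \<times> 'a"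
  have EM: "emeasure ?M (space ?M) = ennreal W"
  proof -
    have "emeasure ?M (space ?M) = emeasure (time_measure \<alpha> R) UNIV * emeasure \<mu> UNIV"
      using M.emeasure_pair_measure_Times[of UNIV "time_measure \<alpha> R" UNIV] by (simp add: space_pair_measure)
    then show ?thesis
      using M.emeasure_space_1 emeasure_time_measure[of \<alpha> R] \<alpha> R by (simp add: W_def)
  qed
  have Hq: "(\<integral>\<^sup>+x. ennreal (H x w powr q) \<partial>lborel) = ennreal (?S (snd w) powr q) * ?B" for w
  proof -
    have "(\<integral>\<^sup>+x. ennreal (H x w powr q) \<partial>lborel)
        = (\<integral>\<^sup>+x. ennreal (?S (snd w) powr q) * ennreal (?D (x + fst w *\<^sub>R snd w) powr q) \<partial>lborel)"
      unfolding H_def by (intro nn_integral_cong) (simp add: powr_mult mult.commute flip: ennreal_mult)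
    also have "\<dots> = ennreal (?S (snd w) powr q) * (\<integral>\<^sup>+x. ennreal (?D (x + fst w *\<^sub>R snd w) powr q) \<partial>lborel)"
      by (rule nn_integral_cmult) measurable
    also have "(\<integral>\<^sup>+x. ennreal (?D (x + fst w *\<^sub>R snd w) powr q) \<partial>lborel) = ?B"
      by (rule nn_integral_lborel_translate) measurable
    finally show ?thesis .
  qed
  have "(\<integral>\<^sup>+x. ennreal (\<bar>stable_semigroup \<alpha> \<mu> t f x - f x\<bar> powr q) \<partial>lborel)
      \<le> ennreal (W powr (q - 1)) * (\<integral>\<^sup>+w. (\<integral>\<^sup>+x. ennreal (H x w powr q) \<partial>lborel) \<partial>?M)"
  proof (rule nn_integral_powr_mixture_le)
    show "sigma_finite_measure ?M" by unfold_locales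
    show "sigma_finite_measure lborel" by (rule sigma_finite_lborel)
    show "case_prod H \<in> borel_measurable (lborel \<Otimes>\<^sub>M ?M)" unfolding H_def by measurable
    show "ennreal \<bar>stable_semigroup \<alpha> \<mu> t f x - f x\<bar> \<le> (\<integral>\<^sup>+w. ennreal (H x w) \<partial>?M)" for x
      unfolding stable_semigroup_def H_def R_def[symmetric] using R by (intro semigroup_increment_bound f) auto
  qed (use EM W q in \<open>auto simp: H_def\<close>)
  also have "(\<integral>\<^sup>+w. (\<integral>\<^sup>+x. ennreal (H x w powr q) \<partial>lborel) \<partial>?M) = (\<integral>\<^sup>+w. ennreal (?S (snd w) powr q) \<partial>?M) * ?B"
    unfolding Hq by (rule nn_integral_multc) measurable
  also have "(\<integral>\<^sup>+w. ennreal (?S (snd w) powr q) \<partial>?M) = ennreal W * ?A"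
    using emeasure_time_measure[of \<alpha> R] \<alpha> R
    by (subst M.nn_integral_fst[symmetric]) (auto simp: W_def mult.commute)
  \<comment> \<open>Jensen gives \<open>W powr (q - 1)\<close> and the time integral one more
    \<open>W\<close>, so the root of order \<open>q\<close> leaves exactly \<open>W\<close>.\<close>
  also have "ennreal (W powr (q - 1)) * (ennreal W * ?A * ?B) = ennreal (W powr q) * ?A * ?B"
    using W by (simp add: mult.assoc[symmetric] powr_diff flip: ennreal_mult)
  finally have *: "(\<integral>\<^sup>+x. ennreal (\<bar>stable_semigroup \<alpha> \<mu> t f x - f x\<bar> powr q) \<partial>lborel) \<le> ennreal (W powr q) * ?A * ?B" .
  have "Lp_norm q lborel (\<lambda>x. stable_semigroup \<alpha> \<mu> t f x - f x) \<le> enn_powr (ennreal (W powr q) * ?A * ?B) (1 / q)"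
    unfolding Lp_norm_def real_norm_def using * q by (intro enn_powr_mono) auto
  also have "\<dots> = ennreal W * Lp_norm q \<mu> (\<lambda>x. gradient p x /\<^sub>R p x) * Lp_norm q lborel (frac_gradient \<nu> f)"
    unfolding Lp_norm_def using q W by (simp add: enn_powr_mult enn_powr_ennreal_powr)
  finally show ?thesis unfolding W' .
qed

end

section \<open>The semigroup and the gradient\<close>

text \<open>At frequency \<open>t\<close> both characteristic functions equal
  \<open>exp (- (\<bar>t\<bar> powr \<alpha> * s powr \<alpha>))\<close>, where \<open>s\<close> is
  the scale at \<open>\<xi>\<close>; uniqueness of characteristic functions identifies the
  laws.\<close>

lemma stable_law_projection:
  fixes \<mu> :: "'a::euclidean_space measure"
  assumes "0 < \<alpha>" and law: "stable_law \<alpha> lam \<mu>" and Y: "standard_stable_variable \<alpha> N Y"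
  shows "distr \<mu> borel (\<lambda>y. y \<bullet> \<xi>) = distr N borel (\<lambda>\<omega>. stable_scale \<alpha> lam \<xi> * Y \<omega>)"
proof (rule Levy_uniqueness)
  define s where "s = stable_scale \<alpha> lam \<xi>"
  have s: "0 \<le> s" by (simp add: s_def stable_scale_def)
  interpret M: prob_space \<mu> using law by (simp add: stable_law_def)
  interpret N: prob_space N using Y by (simp add: standard_stable_variable_def)
  have [measurable_cong]: "sets \<mu> = sets borel" using law by (simp add: stable_law_def)
  have [measurable]: "Y \<in> borel_measurable N" using Y by (simp add: standard_stable_variable_def)
  show "real_distribution (distr \<mu> borel (\<lambda>y. y \<bullet> \<xi>))"
    by (rule M.real_distribution_distr) measurable
  show "real_distribution (distr N borel (\<lambda>\<omega>. stable_scale \<alpha> lam \<xi> * Y \<omega>))"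
    by (rule N.real_distribution_distr) measurable
  show "char (distr \<mu> borel (\<lambda>y. y \<bullet> \<xi>)) = char (distr N borel (\<lambda>\<omega>. stable_scale \<alpha> lam \<xi> * Y \<omega>))"
  proof
    fix t :: real
    have "char (distr \<mu> borel (\<lambda>y. y \<bullet> \<xi>)) t = (CLINT y|\<mu>. iexp (y \<bullet> (t *\<^sub>R \<xi>)))"
      unfolding char_def by (subst integral_distr) auto
    also have "\<dots> = of_real (exp (- (\<bar>t\<bar> powr \<alpha> * s powr \<alpha>)))"
      using law unfolding stable_law_def s_def stable_scale_powr_scaleR[OF assms(1), symmetric] by blast
    also have "\<dots> = char (distr N borel Y) (t * s)"
      using Y s by (simp add: standard_stable_variable_def abs_mult powr_mult)
    also have "\<dots> = char (distr N borel (\<lambda>\<omega>. s * Y \<omega>)) t"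
      unfolding char_def by (subst (1 2) integral_distr) (auto simp: mult.assoc)
    finally show "char (distr \<mu> borel (\<lambda>y. y \<bullet> \<xi>)) t = char (distr N borel (\<lambda>\<omega>. stable_scale \<alpha> lam \<xi> * Y \<omega>)) t"
      unfolding s_def .
  qed
qed

lemma stable_law_projection_moment:
  fixes \<mu> :: "'a::euclidean_space measure"
  assumes "0 < \<alpha>" and law: "stable_law \<alpha> lam \<mu>" and Y: "standard_stable_variable \<alpha> N Y"
  shows "(\<integral>\<^sup>+y. ennreal (\<bar>y \<bullet> \<xi>\<bar> powr q) \<partial>\<mu>)
       = ennreal (stable_scale \<alpha> lam \<xi> powr q) * (\<integral>\<^sup>+\<omega>. ennreal (\<bar>Y \<omega>\<bar> powr q) \<partial>N)"
proof -
  have [measurable_cong]: "sets \<mu> = sets borel" using law by (simp add: stable_law_def)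
  have [measurable]: "Y \<in> borel_measurable N" using Y by (simp add: standard_stable_variable_def)
  have "0 \<le> stable_scale \<alpha> lam \<xi>" by (simp add: stable_scale_def)
  have "(\<integral>\<^sup>+y. ennreal (\<bar>y \<bullet> \<xi>\<bar> powr q) \<partial>\<mu>) = (\<integral>\<^sup>+s. ennreal (\<bar>s\<bar> powr q) \<partial>distr \<mu> borel (\<lambda>y. y \<bullet> \<xi>))"
    by (subst nn_integral_distr) auto
  also have "\<dots> = (\<integral>\<^sup>+\<omega>. ennreal (stable_scale \<alpha> lam \<xi> powr q) * ennreal (\<bar>Y \<omega>\<bar> powr q) \<partial>N)"
    unfolding stable_law_projection[OF assms] using \<open>0 \<le> stable_scale \<alpha> lam \<xi>\<close>
    by (subst nn_integral_distr) (auto simp: abs_mult powr_mult simp flip: ennreal_mult)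
  also have "\<dots> = ennreal (stable_scale \<alpha> lam \<xi> powr q) * (\<integral>\<^sup>+\<omega>. ennreal (\<bar>Y \<omega>\<bar> powr q) \<partial>N)"
    by (rule nn_integral_cmult) measurable
  finally show ?thesis .
qed

text \<open>The scale is read off the characteristic function as a power of \<open>- ln\<close> of a
  cosine integral, which is measurable in \<open>\<xi>\<close> because \<open>\<mu>\<close> is a
  probability measure on the Borel sets; \<open>lam\<close> enters only through the law.\<close>

lemma borel_measurable_stable_scale:
  fixes \<mu> :: "'a::euclidean_space measure"
  assumes "0 < \<alpha>" and law: "stable_law \<alpha> lam \<mu>"
  shows "stable_scale \<alpha> lam \<in> borel_measurable borel"
proof -
  interpret M: prob_space \<mu> using law by (simp add: stable_law_def)
  have [measurable_cong]: "sets \<mu> = sets borel" using law by (simp add: stable_law_def)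
  have "stable_scale \<alpha> lam \<xi> = (- ln (LINT y|\<mu>. cos (0 + y \<bullet> \<xi>))) powr (1 / \<alpha>)" for \<xi>
    unfolding stable_law_cos[OF law] using assms(1) by (simp add: powr_powr) (simp add: stable_scale_def)
  then have "stable_scale \<alpha> lam = (\<lambda>\<xi>. (- ln (LINT y|\<mu>. cos (0 + y \<bullet> \<xi>))) powr (1 / \<alpha>))"
    by (rule ext)
  then show ?thesis by simp
qed

text \<open>The increment along \<open>R y\<close> is averaged over the uniform law on the segment,
  so the mixing measure is a probability measure and Jensen costs no constant.\<close>

lemma stable_semigroup_increment_bound:
  fixes f :: "'a::euclidean_space \<Rightarrow> real"
  assumes f: "f \<in> Cc_infinity" and law: "stable_law \<alpha> lam \<mu>"
  shows "ennreal \<bar>stable_semigroup \<alpha> \<mu> t f x - f x\<bar>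
    \<le> (\<integral>\<^sup>+w. ennreal \<bar>(t powr (1 / \<alpha>) *\<^sub>R fst w) \<bullet> gradient f (x + snd w *\<^sub>R (t powr (1 / \<alpha>) *\<^sub>R fst w))\<bar>
          \<partial>(\<mu> \<Otimes>\<^sub>M density lborel (\<lambda>s. indicator {0..1} s)))"
proof -
  define R where "R = t powr (1 / \<alpha>)"
  interpret M: prob_space \<mu> using law by (simp add: stable_law_def)
  have [measurable_cong]: "sets \<mu> = sets borel" using law by (simp add: stable_law_def)
  note g = smooth_gradient[OF Cc_infinity_smooth[OF f]]
  have [measurable]: "f \<in> borel_measurable borel" "gradient f \<in> borel_measurable borel"
    using g by (auto intro: borel_measurable_continuous_onI)
  obtain K where K: "\<And>x. \<bar>f x\<bar> \<le> K" using Cc_infinity_bounded[OF f] by blast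
  interpret U: sigma_finite_measure "density lborel (\<lambda>s::real. indicator {0..1} s)"
    by (subst sigma_finite_measure.sigma_finite_iff_density_finite[OF sigma_finite_lborel])
      (auto simp: indicator_def)
  have int: "integrable \<mu> (\<lambda>y. f (x + R *\<^sub>R y))"
    by (rule M.integrable_const_bound[of _ K]) (use K in auto)
  have seg: "ennreal \<bar>f (x + v) - f x\<bar> \<le> (\<integral>\<^sup>+s. ennreal \<bar>v \<bullet> gradient f (x + s *\<^sub>R v)\<bar> \<partial>density lborel (\<lambda>s. indicator {0..1} s))" for v
  proof -
    note b = GDERIV_increment[OF g(1) g(2), of v x]
    have "ennreal \<bar>f (x + v) - f x\<bar> = ennreal (norm (LINT s|lborel. (v \<bullet> gradient f (x + s *\<^sub>R v)) * indicator {0..1} s))"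
      using has_bochner_integral_integral_eq[OF b] by simp
    also have "\<dots> \<le> (\<integral>\<^sup>+s. ennreal (norm ((v \<bullet> gradient f (x + s *\<^sub>R v)) * indicator {0..1} s)) \<partial>lborel)"
      using b by (intro integral_norm_bound_ennreal) (simp add: has_bochner_integral_iff)
    also have "\<dots> = (\<integral>\<^sup>+s. ennreal \<bar>v \<bullet> gradient f (x + s *\<^sub>R v)\<bar> \<partial>density lborel (\<lambda>s. indicator {0..1} s))"
      by (subst nn_integral_density) (auto intro!: nn_integral_cong simp: indicator_def)
    finally show ?thesis .
  qed
  have "ennreal \<bar>stable_semigroup \<alpha> \<mu> t f x - f x\<bar> = ennreal (norm (LINT y|\<mu>. f (x + R *\<^sub>R y) - f x))"
    using int by (simp add: stable_semigroup_def R_def M.prob_space)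
  also have "\<dots> \<le> (\<integral>\<^sup>+y. ennreal (norm (f (x + R *\<^sub>R y) - f x)) \<partial>\<mu>)"
    using int by (intro integral_norm_bound_ennreal) auto
  also have "\<dots> \<le> (\<integral>\<^sup>+y. (\<integral>\<^sup>+s. ennreal \<bar>(R *\<^sub>R y) \<bullet> gradient f (x + s *\<^sub>R (R *\<^sub>R y))\<bar> \<partial>density lborel (\<lambda>s. indicator {0..1} s)) \<partial>\<mu>)"
    unfolding real_norm_def by (intro nn_integral_mono seg)
  also have "\<dots> = (\<integral>\<^sup>+w. ennreal \<bar>(R *\<^sub>R fst w) \<bullet> gradient f (x + snd w *\<^sub>R (R *\<^sub>R fst w))\<bar> \<partial>(\<mu> \<Otimes>\<^sub>M density lborel (\<lambda>s. indicator {0..1} s)))"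
    by (subst U.nn_integral_fst[symmetric]) auto
  finally show ?thesis unfolding R_def .
qed

lemma stable_semigroup_Lp_bound:
  fixes f :: "'a::euclidean_space \<Rightarrow> real"
  assumes \<alpha>: "0 < \<alpha>" and law: "stable_law \<alpha> lam \<mu>" and Y: "standard_stable_variable \<alpha> N Y"
    and f: "f \<in> Cc_infinity" and q: "1 \<le> q"
  shows "Lp_norm q lborel (\<lambda>x. stable_semigroup \<alpha> \<mu> t f x - f x)
       \<le> ennreal (t powr (1 / \<alpha>)) * enn_powr (\<integral>\<^sup>+\<omega>. ennreal (\<bar>Y \<omega>\<bar> powr q) \<partial>N) (1 / q)
          * Lp_norm q lborel (\<lambda>x. stable_scale \<alpha> lam (gradient f x))"
proof -
  define R where "R = t powr (1 / \<alpha>)"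
  have R: "0 \<le> R" by (simp add: R_def)
  interpret M: prob_space \<mu> using law by (simp add: stable_law_def)
  have [measurable_cong]: "sets \<mu> = sets borel" using law by (simp add: stable_law_def)
  have [measurable]: "gradient f \<in> borel_measurable borel"
    using smooth_gradient(2)[OF Cc_infinity_smooth[OF f]] by (rule borel_measurable_continuous_onI)
  note borel_measurable_stable_scale[OF \<alpha> law, measurable]
  let ?U = "density lborel (\<lambda>s::real. indicator {0..1} s)"
  have U: "emeasure ?U (space ?U) = 1" by (simp add: emeasure_density)
  interpret U: finite_measure ?U by (rule finite_measureI) (simp add: emeasure_density)
  interpret MU: pair_sigma_finite \<mu> ?U ..
  interpret WL: pair_sigma_finite \<mu> "lborel :: 'a measure" ..
  let ?EY = "\<integral>\<^sup>+\<omega>. ennreal (\<bar>Y \<omega>\<bar> powr q) \<partial>N"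
  let ?S = "\<integral>\<^sup>+x. ennreal (stable_scale \<alpha> lam (gradient f x) powr q) \<partial>lborel"
  define H where "H x w = \<bar>(R *\<^sub>R fst w) \<bullet> gradient f (x + snd w *\<^sub>R (R *\<^sub>R fst w))\<bar>" for x :: 'a and w :: "'a \<times> real"
  have EM: "emeasure (\<mu> \<Otimes>\<^sub>M ?U) (space (\<mu> \<Otimes>\<^sub>M ?U)) = ennreal 1"
    using U.emeasure_pair_measure_Times[of "space \<mu>" \<mu> "space ?U"] U M.emeasure_space_1
    by (simp add: space_pair_measure)
  have Hq: "(\<integral>\<^sup>+x. ennreal (H x w powr q) \<partial>lborel) = ennreal (R powr q) * (\<integral>\<^sup>+x. ennreal (\<bar>fst w \<bullet> gradient f x\<bar> powr q) \<partial>lborel)" for w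
  proof -
    have "(\<integral>\<^sup>+x. ennreal (H x w powr q) \<partial>lborel) = (\<integral>\<^sup>+x. ennreal (\<bar>(R *\<^sub>R fst w) \<bullet> gradient f x\<bar> powr q) \<partial>lborel)"
      unfolding H_def by (rule nn_integral_lborel_translate) measurable
    also have "\<dots> = (\<integral>\<^sup>+x. ennreal (R powr q) * ennreal (\<bar>fst w \<bullet> gradient f x\<bar> powr q) \<partial>lborel)"
      using R by (intro nn_integral_cong) (simp add: abs_mult powr_mult flip: ennreal_mult)
    also have "\<dots> = ennreal (R powr q) * (\<integral>\<^sup>+x. ennreal (\<bar>fst w \<bullet> gradient f x\<bar> powr q) \<partial>lborel)"
      by (rule nn_integral_cmult) measurable
    finally show ?thesis .
  qed
  have "(\<integral>\<^sup>+x. ennreal (\<bar>stable_semigroup \<alpha> \<mu> t f x - f x\<bar> powr q) \<partial>lborel)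
      \<le> ennreal (1 powr (q - 1)) * (\<integral>\<^sup>+w. (\<integral>\<^sup>+x. ennreal (H x w powr q) \<partial>lborel) \<partial>(\<mu> \<Otimes>\<^sub>M ?U))"
  proof (rule nn_integral_powr_mixture_le)
    show "sigma_finite_measure (\<mu> \<Otimes>\<^sub>M ?U)" by unfold_locales
    show "sigma_finite_measure lborel" by (rule sigma_finite_lborel)
    show "case_prod H \<in> borel_measurable (lborel \<Otimes>\<^sub>M (\<mu> \<Otimes>\<^sub>M ?U))" unfolding H_def by measurable
    show "ennreal \<bar>stable_semigroup \<alpha> \<mu> t f x - f x\<bar> \<le> (\<integral>\<^sup>+w. ennreal (H x w) \<partial>(\<mu> \<Otimes>\<^sub>M ?U))" for x
      unfolding H_def R_def by (rule stable_semigroup_increment_bound[OF f law])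
  qed (use EM q in \<open>auto simp: H_def\<close>)
  also have "\<dots> = ennreal (R powr q) * (\<integral>\<^sup>+w. (\<integral>\<^sup>+x. ennreal (\<bar>fst w \<bullet> gradient f x\<bar> powr q) \<partial>lborel) \<partial>(\<mu> \<Otimes>\<^sub>M ?U))"
    unfolding Hq by (simp add: nn_integral_cmult)
  also have "(\<integral>\<^sup>+w. (\<integral>\<^sup>+x. ennreal (\<bar>fst w \<bullet> gradient f x\<bar> powr q) \<partial>lborel) \<partial>(\<mu> \<Otimes>\<^sub>M ?U))
      = (\<integral>\<^sup>+y. (\<integral>\<^sup>+x. ennreal (\<bar>y \<bullet> gradient f x\<bar> powr q) \<partial>lborel) \<partial>\<mu>)"
    using U by (subst U.nn_integral_fst[symmetric]) auto
  \<comment> \<open>The order is reversed so that, at fixed \<open>x\<close>, the integral over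
    \<open>y\<close> is a moment of the projection of \<open>\<mu>\<close> in the fixed direction
    \<open>gradient f x\<close>.\<close>
  also have "\<dots> = (\<integral>\<^sup>+x. (\<integral>\<^sup>+y. ennreal (\<bar>y \<bullet> gradient f x\<bar> powr q) \<partial>\<mu>) \<partial>lborel)"
    by (rule WL.Fubini'[symmetric]) measurable
  also have "\<dots> = (\<integral>\<^sup>+x. ennreal (stable_scale \<alpha> lam (gradient f x) powr q) * ?EY \<partial>lborel)"
    unfolding stable_law_projection_moment[OF \<alpha> law Y] ..
  also have "\<dots> = ?S * ?EY"
    by (rule nn_integral_multc) measurable
  finally have *: "(\<integral>\<^sup>+x. ennreal (\<bar>stable_semigroup \<alpha> \<mu> t f x - f x\<bar> powr q) \<partial>lborel) \<le> ennreal (R powr q) * ?EY * ?S"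
    by (simp add: mult_ac)
  have "Lp_norm q lborel (\<lambda>x. stable_semigroup \<alpha> \<mu> t f x - f x) \<le> enn_powr (ennreal (R powr q) * ?EY * ?S) (1 / q)"
    unfolding Lp_norm_def real_norm_def using * q by (intro enn_powr_mono) auto
  also have "\<dots> = ennreal R * enn_powr ?EY (1 / q) * Lp_norm q lborel (\<lambda>x. stable_scale \<alpha> lam (gradient f x))"
    unfolding Lp_norm_def using q R by (simp add: enn_powr_mult enn_powr_ennreal_powr stable_scale_def)
  finally show ?thesis unfolding R_def .
qed

theorem proposition1p1:
  fixes \<alpha> :: real
    and \<sigma> \<nu> lam\<^sub>1 \<mu> :: "'a::euclidean_space measure"
    and p\<^sub>\<alpha> :: "'a \<Rightarrow> real"
    and N :: "'w measure" and Y :: "'w \<Rightarrow> real"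
  assumes "1 < \<alpha>" and "\<alpha> < 2"
    and "symmetric_stable_levy_measure \<alpha> \<sigma> \<nu>"
    and "lam\<^sub>1 = spectral_measure \<alpha> \<sigma>"
    and "non_degenerate \<alpha> lam\<^sub>1"
    and "stable_law \<alpha> lam\<^sub>1 \<mu>"
    and "positive_smooth_density \<mu> p\<^sub>\<alpha>"
    and "\<forall>p\<ge>1. Lp_norm p \<mu> (\<lambda>x. gradient p\<^sub>\<alpha> x /\<^sub>R p\<^sub>\<alpha> x) < \<infinity>"
  shows
    "(\<forall>p\<ge>1. \<forall>t>0. \<forall>f\<in>Cc_infinity.
        Lp_norm p lborel (\<lambda>x. stable_semigroup \<alpha> \<mu> t f x - f x)
          \<le> ennreal (t powr (1 - 1 / \<alpha>) / (\<alpha> - 1))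
             * Lp_norm p \<mu> (\<lambda>x. gradient p\<^sub>\<alpha> x /\<^sub>R p\<^sub>\<alpha> x)
             * Lp_norm p lborel (frac_gradient \<nu> f))
     \<and>
     (standard_stable_variable \<alpha> N Y \<longrightarrow>
        (\<forall>p. 1 \<le> p \<and> p < \<alpha> \<longrightarrow> (\<forall>t>0. \<forall>f\<in>Cc_infinity.
          Lp_norm p lborel (\<lambda>x. stable_semigroup \<alpha> \<mu> t f x - f x)
            \<le> ennreal (t powr (1 / \<alpha>))
               * enn_powr (\<integral>\<^sup>+\<omega>. ennreal (\<bar>Y \<omega>\<bar> powr p) \<partial>N) (1 / p)
               * Lp_norm p lborel (\<lambda>x. stable_scale \<alpha> lam\<^sub>1 (gradient f x)))))"
proof -
  \<comment> \<open>The score hypothesis at exponent 1.\<close>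
  have "integrable lborel (gradient p\<^sub>\<alpha>)"
    using assms(7,8) by (intro score_integrable) auto
  with assms interpret stable_density \<alpha> \<sigma> \<nu> lam\<^sub>1 \<mu> p\<^sub>\<alpha>
    by unfold_locales
  show ?thesis
    using assms(1) law by (auto intro!: semigroup_Lp_bound stable_semigroup_Lp_bound)
qed

end
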